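(* Let $a$, $b$, $c$ be nonnegative integers. Then, for any triple of partitions $\lambda$, $\mu$, $\nu$ of the same size, there is an $L\in\mathbb{N}$ such that for all $n\ge L$, $$\mathsf{g}\bigl(\lambda+n(b+c+1,1^a),\ \mu+n(a+c+1,1^b),\ \nu+n(c+1,1^{a+b})\bigr)=\mathsf{g}\bigl(\lambda+L(b+c+1,1^a),\ \mu+L(a+c+1,1^b),\ \nu+L(c+1,1^{a+b})\bigr).$$
   Context: $\mathbb{N}$ is the set of positive integers. A partition is a weakly decreasing sequence of positive integers; its size is the sum of its parts. In a partition, $i^{k}$ stands for $k$ parts equal to $i$; for example $(b+c+1,1^a)$ has one part $b+c+1$ followed by $a$ parts equal to $1$. The sum of two partitions is taken coordinatewise after appending zeros to the shorter one, and $n\alpha$ is the partition $\alpha$ with every part multiplied by $n$. For partitions $\lambda,\mu,\nu$ of $m$, let $\chi^\lambda$ denote the irreducible complex character of the symmetric group $S_m$ associated to $\lambda$. The Kronecker coefficient is $\mathsf{g}(\lambda,\mu,\nu)=\langle\chi^\lambda\otimes\chi^\mu,\chi^\nu\rangle$, the multiplicity of $\chi^\nu$ in $\chi^\lambda\otimes\chi^\mu$. *)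

theory Defs
  imports Complex_Main "HOL-Library.Function_Algebras" "HOL-Combinatorics.Permutations"
begin

definition is_partition :: "nat list \<Rightarrow> bool" where
  "is_partition la \<longleftrightarrow> sorted_wrt (\<ge>) la \<and> 0 \<notin> set la"

fun part_add :: "nat list \<Rightarrow> nat list \<Rightarrow> nat list" (infixl \<open>\<oplus>\<^sub>p\<close> 65) where
  "[] \<oplus>\<^sub>p \<mu> = \<mu>"
| "la \<oplus>\<^sub>p [] = la"
| "(x # la) \<oplus>\<^sub>p (y # \<mu>) = (x + y) # (la \<oplus>\<^sub>p \<mu>)"

definition part_mult :: "nat \<Rightarrow> nat list \<Rightarrow> nat list" (infixr \<open>\<cdot>\<^sub>p\<close> 70) where
  "n \<cdot>\<^sub>p la = map (\<lambda>x. n * x) la"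

global_interpretation cfun: vector_space "\<lambda>(z::complex) (v :: 'a \<Rightarrow> complex) x. z * v x"
  by unfold_locales (auto simp: fun_eq_iff algebra_simps)

text \<open>Trace of an endomorphism of a finite-dimensional subspace \<open>V\<close>; the value does not
  depend on which basis of \<open>V\<close> is selected.\<close>

definition trace_on :: "('a \<Rightarrow> complex) set \<Rightarrow> (('a \<Rightarrow> complex) \<Rightarrow> ('a \<Rightarrow> complex)) \<Rightarrow> complex" where
  "trace_on V f =
     (let B = (SOME B. cfun.independent B \<and> cfun.span B = V)
      in \<Sum>b\<in>B. cfun.representation B (f b) b)"

text \<open>The group \<open>S\<^sub>m\<close> consists of the permutations of \<open>{..<m}\<close>. The irreducible character
  \<open>\<chi>\<^sup>\<lambda>\<close> is the character of the Specht module, the submodule spanned by the polytabloids in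
  the permutation module on the tabloids of shape \<open>\<lambda>\<close>. In this convention \<open>(m)\<close> labels the
  trivial character and \<open>(1\<^sup>m)\<close> the sign character.\<close>

definition cells :: "nat list \<Rightarrow> (nat \<times> nat) set" where
  "cells la = {(i, j). i < length la \<and> j < la ! i}"

definition is_tableau :: "nat list \<Rightarrow> (nat \<times> nat \<Rightarrow> nat) \<Rightarrow> bool" where
  "is_tableau la t \<longleftrightarrow> bij_betw t (cells la) {..<sum_list la}"

text \<open>A tabloid (row-equivalence class of tableaux) is encoded as its list of rows, each
  row being a set.\<close>

definition tabloid_of :: "nat list \<Rightarrow> (nat \<times> nat \<Rightarrow> nat) \<Rightarrow> nat set list" where
  "tabloid_of la t = map (\<lambda>i. {t (i, j) |j. (i, j) \<in> cells la}) [0..<length la]"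

definition perm_tabloid :: "(nat \<Rightarrow> nat) \<Rightarrow> nat set list \<Rightarrow> nat set list" where
  "perm_tabloid \<sigma> T = map (\<lambda>R. \<sigma> ` R) T"

definition column_group :: "nat list \<Rightarrow> (nat \<times> nat \<Rightarrow> nat) \<Rightarrow> (nat \<Rightarrow> nat) set" where
  "column_group la t =
     {\<pi>. \<pi> permutes {..<sum_list la} \<and>
         (\<forall>j. \<pi> ` {t (i, j) |i. (i, j) \<in> cells la} = {t (i, j) |i. (i, j) \<in> cells la})}"

text \<open>Elements of the permutation module are written as coefficient functions on tabloids:
  the polytabloid is the sum of \<open>sign \<pi> \<cdot> \<pi>{t}\<close> over the column group of \<open>t\<close>.\<close>

definition polytabloid :: "nat list \<Rightarrow> (nat \<times> nat \<Rightarrow> nat) \<Rightarrow> (nat set list \<Rightarrow> complex)" where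
  "polytabloid la t =
     (\<lambda>T. \<Sum>\<pi>\<in>column_group la t.
        of_int (sign \<pi>) * of_bool (perm_tabloid \<pi> (tabloid_of la t) = T))"

definition specht_module :: "nat list \<Rightarrow> (nat set list \<Rightarrow> complex) set" where
  "specht_module la = cfun.span {polytabloid la t |t. is_tableau la t}"

text \<open>The inverse makes this the linear extension of \<open>T \<mapsto> \<sigma>T\<close>.\<close>

definition perm_act :: "(nat \<Rightarrow> nat) \<Rightarrow> (nat set list \<Rightarrow> complex) \<Rightarrow> (nat set list \<Rightarrow> complex)" where
  "perm_act \<sigma> v = (\<lambda>T. v (perm_tabloid (inv \<sigma>) T))"

definition irr_char :: "nat list \<Rightarrow> (nat \<Rightarrow> nat) \<Rightarrow> complex" where
  "irr_char la \<sigma> = trace_on (specht_module la) (perm_act \<sigma>)"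

definition class_inner :: "nat \<Rightarrow> ((nat \<Rightarrow> nat) \<Rightarrow> complex) \<Rightarrow> ((nat \<Rightarrow> nat) \<Rightarrow> complex) \<Rightarrow> complex" where
  "class_inner m \<phi> \<psi> = (\<Sum>\<sigma> | \<sigma> permutes {..<m}. \<phi> \<sigma> * cnj (\<psi> \<sigma>)) / fact m"

text \<open>Meaningful for three partitions of the same size.\<close>

definition kronecker :: "nat list \<Rightarrow> nat list \<Rightarrow> nat list \<Rightarrow> complex" where
  "kronecker la \<mu> \<nu> =
     class_inner (sum_list la) (\<lambda>\<sigma>. irr_char la \<sigma> * irr_char \<mu> \<sigma>) (irr_char \<nu>)"

end

theory Submission
  imports Defs "HOL-Computational_Algebra.Polynomial" "HOL-Library.Nat_Bijection"
begin

text \<open>Along the sequence of the theorem the Kronecker coefficient is a natural number that never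
decreases and stays bounded, so it is eventually constant. Both facts come from one description
of the coefficient as the dimension of a space of polynomials.

Take three fillings \<open>f\<close>, \<open>g\<close>, \<open>h\<close> of Young diagrams of
shapes \<open>\<lambda>\<close>, \<open>\<mu>\<close>, \<open>\<nu>\<close> by the same points.
Antisymmetrising the monomial
\<open>\<Prod>\<^sub>x z (row\<^sub>f x, row\<^sub>g x, row\<^sub>h x)\<close> over the three
column groups gives a polynomial \<open>hw_poly\<close> in variables \<open>z (i, j, k)\<close>.
It encodes the orbit sum of a tensor product of three polytabloids: a triple of tabloids assigns
to every point a triple of row numbers, and up to the action of the symmetric group only the
multiplicities of these triples matter, that is, a monomial in \<open>z\<close>. The averaging
operator projects the tensor product of three Specht modules onto its invariants, its trace is
\<open>g(\<lambda>, \<mu>, \<nu>)\<close>, and therefore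
\<open>g(\<lambda>, \<mu>, \<nu>)\<close> is the dimension of the span of the polynomials
\<open>hw_poly\<close> (\<open>kronecker_eq_dim_hw_polys\<close>). These polynomials are highest
weight vectors for the three linear groups acting on the indices of \<open>z\<close>.

The coefficient never decreases because the product of the polynomials of two disjoint triples
of fillings is again such a polynomial, for the sums of the shapes: the diagram of
\<open>\<lambda> + \<alpha>\<close> has the columns of \<open>\<lambda>\<close> together with
those of \<open>\<alpha>\<close> (\<open>hw_poly_join\<close>). Multiplication by a fixed
nonzero polynomial is injective, and the three hooks of the theorem do have a nonzero polynomial
(\<open>hook_hw_poly_nonzero\<close>).

For the bound, \<open>hw_poly\<close> is invariant under adding multiples of the slice
\<open>k\<close> of \<open>z\<close> to later slices (\<open>hw_poly_column_op\<close>). List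
the pairs \<open>(i, j)\<close> in some order and view \<open>z\<close> as a matrix whose rows
are these pairs and whose columns are the indices \<open>k\<close>. Gaussian elimination shows
that the polynomial is determined by its restriction to lower triangular matrices
(\<open>eq_0_if_eq_0_on_triangular\<close>), so the coefficient is at most the number of
three-dimensional tables with marginals \<open>\<lambda>\<close>, \<open>\<mu>\<close>,
\<open>\<nu>\<close> that are supported on the lower triangle. The hooks of the theorem are the
row sums, the column sums and the sorted entries of the matrix with corner \<open>c + 1\<close>,
with entries \<open>1\<close> in the rest of the first row and column, and \<open>0\<close>
elsewhere. List the pairs by decreasing entry. Because this matrix is additive (its entries are
ordered like sums \<open>x\<^sub>i + y\<^sub>j\<close>), a weighted count shows that all entries
of such a table off the diagonal are bounded independently of \<open>n\<close>
(\<open>hook_table_count_le\<close>); the entries on the diagonal are then determined by the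
marginals.\<close>

section \<open>Linear algebra of complex functions\<close>

lemma sum_fun_apply: "(\<Sum>i\<in>A. f i) x = (\<Sum>i\<in>A. f i x)"
  for f :: "'i \<Rightarrow> 'a \<Rightarrow> 'b::comm_monoid_add"
  by (induction A rule: infinite_finite_induct) auto

lemma fun_span_finite_expansion:
  assumes "finite S" and "v \<in> cfun.span S"
  obtains k where "\<And>x. v x = (\<Sum>s\<in>S. k s * s x)"
proof -
  obtain k where "v = (\<Sum>s\<in>S. (\<lambda>x. k s * s x))"
    using assms(2) unfolding cfun.span_finite[OF assms(1)] by blast
  then show thesis
    using that[of k] by (simp add: sum_fun_apply)
qed

lemma fun_independent_coeff_eq_0:
  assumes "finite S" and "cfun.independent S" and "\<And>x. (\<Sum>s\<in>S. k s * s x) = 0" and "s \<in> S"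
  shows "k s = 0"
proof -
  have "(\<Sum>s\<in>S. (\<lambda>x. k s * s x)) = 0"
    using assms(3) by (simp add: fun_eq_iff sum_fun_apply)
  then show ?thesis
    using cfun.independentD[OF assms(2,1) order_refl _ assms(4)] by simp
qed

lemma fun_span_sum:
  assumes "\<And>i. i \<in> I \<Longrightarrow> f i \<in> cfun.span S"
  shows "(\<lambda>x. \<Sum>i\<in>I. k i * f i x) \<in> cfun.span S"
proof -
  have "(\<Sum>i\<in>I. (\<lambda>x. k i * f i x)) \<in> cfun.span S"
    by (intro cfun.span_sum cfun.span_scale assms)
  also have "(\<Sum>i\<in>I. (\<lambda>x. k i * f i x)) = (\<lambda>x. \<Sum>i\<in>I. k i * f i x)"
    by (simp add: fun_eq_iff sum_fun_apply)
  finally show ?thesis .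
qed

lemma sum_delta_mult:
  fixes f :: "'a \<Rightarrow> complex"
  assumes "finite A" "i \<in> A"
  shows "(\<Sum>k\<in>A. of_bool (k = i) * f k) = f i"
proof -
  have "(\<Sum>k\<in>A. of_bool (k = i) * f k) = (\<Sum>k\<in>A. if k = i then f k else 0)"
    by (rule sum.cong) auto
  then show ?thesis using assms by (simp add: sum.delta)
qed

text \<open>A matrix \<open>p\<close> that acts on a finite family \<open>F\<close> as the identity and
whose rows satisfy all linear relations of the family has trace equal to the dimension of its
span. For an averaging operator \<open>p\<close> in a basis and the images \<open>F\<close> of
the basis vectors this says that the trace of a projection is its rank, without mentioning the
space on which it acts. Expanding \<open>F\<close> in a basis \<open>C\<close> taken from
\<open>F\<close> factors \<open>p\<close> as a product of an \<open>I \<times> C\<close> matrix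
and a \<open>C \<times> I\<close> matrix whose product in the other order is the identity of
\<open>C\<close>.\<close>
lemma trace_eq_dim_span:
  fixes p :: "'i \<Rightarrow> 'i \<Rightarrow> complex" and F :: "'i \<Rightarrow> 'a \<Rightarrow> complex"
  assumes fin: "finite I"
    and fix_F: "\<And>i x. i \<in> I \<Longrightarrow> F i x = (\<Sum>j\<in>I. p i j * F j x)"
    and ker: "\<And>k j. (\<And>x. (\<Sum>i\<in>I. k i * F i x) = 0) \<Longrightarrow> j \<in> I \<Longrightarrow> (\<Sum>i\<in>I. k i * p i j) = 0"
  shows "(\<Sum>i\<in>I. p i i) = of_nat (cfun.dim (F ` I))"
proof -
  obtain C where C: "C \<subseteq> F ` I" "cfun.independent C" "F ` I \<subseteq> cfun.span C"
      "card C = cfun.dim (F ` I)"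
    using cfun.basis_exists .
  have finC: "finite C" using C(1) fin finite_surj by blast
  have "\<exists>\<iota>. \<forall>c\<in>C. \<iota> c \<in> I \<and> F (\<iota> c) = c"
    using C(1) by (intro bchoice) auto
  then obtain \<iota> where \<iota>: "\<And>c. c \<in> C \<Longrightarrow> \<iota> c \<in> I" "\<And>c. c \<in> C \<Longrightarrow> F (\<iota> c) = c" by blast
  have "\<exists>a. \<forall>i\<in>I. \<forall>x. F i x = (\<Sum>c\<in>C. a i c * c x)"
  proof (rule bchoice, rule ballI)
    fix i assume "i \<in> I"
    then have "F i \<in> cfun.span C" using C(3) by blast
    then show "\<exists>k. \<forall>x. F i x = (\<Sum>c\<in>C. k c * c x)"
      using fun_span_finite_expansion[OF finC] by metis
  qed
  then obtain a where a: "\<And>i x. i \<in> I \<Longrightarrow> F i x = (\<Sum>c\<in>C. a i c * c x)" by blast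
  have p_eq: "p i j = (\<Sum>c\<in>C. a i c * p (\<iota> c) j)" if "i \<in> I" "j \<in> I" for i j
  proof -
    \<comment> \<open>The coefficients of the relation that expands \<open>F i\<close> in the basis
      \<open>C\<close>.\<close>
    define k where "k l = of_bool (l = i) - (\<Sum>c\<in>C. of_bool (l = \<iota> c) * a i c)" for l
    have k: "(\<Sum>l\<in>I. k l * g l) = g i - (\<Sum>c\<in>C. a i c * g (\<iota> c))" for g
    proof -
      have "(\<Sum>l\<in>I. k l * g l) = (\<Sum>l\<in>I. of_bool (l = i) * g l)
          - (\<Sum>l\<in>I. \<Sum>c\<in>C. of_bool (l = \<iota> c) * (a i c * g l))"
        by (simp add: k_def algebra_simps sum_subtractf sum_distrib_left sum_distrib_right)
      also have "(\<Sum>l\<in>I. of_bool (l = i) * g l) = g i"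
        using sum_delta_mult[OF fin \<open>i \<in> I\<close>] .
      also have "(\<Sum>l\<in>I. \<Sum>c\<in>C. of_bool (l = \<iota> c) * (a i c * g l)) = (\<Sum>c\<in>C. a i c * g (\<iota> c))"
        by (subst sum.swap, rule sum.cong[OF refl]) (simp add: sum_delta_mult[OF fin \<iota>(1)])
      finally show ?thesis .
    qed
    have "(\<Sum>l\<in>I. k l * F l x) = 0" for x
      using a[OF \<open>i \<in> I\<close>, of x] \<iota>(2) by (simp add: k)
    then have "(\<Sum>l\<in>I. k l * p l j) = 0" using ker \<open>j \<in> I\<close> by blast
    then show ?thesis by (simp add: k)
  qed
  have one: "(\<Sum>i\<in>I. p (\<iota> c) i * a i c) = 1" if "c \<in> C" for c
  proof -
    have "(\<Sum>d\<in>C. ((\<Sum>i\<in>I. p (\<iota> c) i * a i d) - of_bool (d = c)) * d x) = 0" for x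
    proof -
      have "c x = (\<Sum>i\<in>I. p (\<iota> c) i * F i x)"
        using fix_F[OF \<iota>(1)[OF that], of x] \<iota>(2)[OF that] by simp
      also have "\<dots> = (\<Sum>i\<in>I. \<Sum>d\<in>C. p (\<iota> c) i * a i d * d x)"
        by (rule sum.cong[OF refl]) (simp add: a sum_distrib_left mult.assoc)
      also have "\<dots> = (\<Sum>d\<in>C. (\<Sum>i\<in>I. p (\<iota> c) i * a i d) * d x)"
        by (subst sum.swap) (simp add: sum_distrib_right)
      finally have "c x = (\<Sum>d\<in>C. (\<Sum>i\<in>I. p (\<iota> c) i * a i d) * d x)" .
      then show ?thesis
        using sum_delta_mult[OF finC that, of "\<lambda>d. d x"] by (simp add: algebra_simps sum_subtractf)
    qed
    from fun_independent_coeff_eq_0[OF finC C(2) this that] show ?thesis by simp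
  qed
  have "(\<Sum>i\<in>I. p i i) = (\<Sum>i\<in>I. \<Sum>c\<in>C. a i c * p (\<iota> c) i)"
    using p_eq by (intro sum.cong) auto
  also have "\<dots> = (\<Sum>c\<in>C. \<Sum>i\<in>I. p (\<iota> c) i * a i c)"
    by (subst sum.swap) (simp add: mult.commute)
  also have "\<dots> = of_nat (card C)" using one by simp
  finally show ?thesis using C(4) by simp
qed

lemma dim_le_dim_of_injective:
  fixes h :: "('a \<Rightarrow> complex) \<Rightarrow> ('b \<Rightarrow> complex)"
  assumes add: "\<And>u v. h (u + v) = h u + h v"
    and scale: "\<And>k v. h (\<lambda>x. k * v x) = (\<lambda>x. k * h v x)"
    and inj: "\<And>v. v \<in> cfun.span S \<Longrightarrow> h v = 0 \<Longrightarrow> v = 0"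
    and fin: "finite T" and img: "h ` S \<subseteq> cfun.span T"
  shows "cfun.dim S \<le> cfun.dim T"
proof -
  interpret vector_space_pair "\<lambda>(z::complex) (v :: 'a \<Rightarrow> complex) x. z * v x"
      "\<lambda>(z::complex) (v :: 'b \<Rightarrow> complex) x. z * v x" ..
  have lin: "Vector_Spaces.linear (\<lambda>(z::complex) (v :: 'a \<Rightarrow> complex) x. z * v x)
      (\<lambda>(z::complex) (v :: 'b \<Rightarrow> complex) x. z * v x) h"
    by unfold_locales (use add scale in auto)
  obtain B where B: "B \<subseteq> S" "cfun.independent B" "S \<subseteq> cfun.span B" "card B = cfun.dim S"
    using cfun.basis_exists .
  have span: "cfun.span B \<subseteq> cfun.span S" using B(1) by (rule cfun.span_mono)
  have inj_span: "inj_on h (cfun.span B)"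
    using inj span linear_inj_on_span_iff_independent_image[OF lin]
      linear_inj_on_iff_eq_0[OF lin cfun.subspace_span]
    by blast
  have indep: "cfun.independent (h ` B)"
    using linear_independent_injective_image[OF lin B(2) inj_span] .
  obtain D where D: "D \<subseteq> T" "cfun.independent D" "T \<subseteq> cfun.span D" "card D = cfun.dim T"
    using cfun.basis_exists .
  have "h ` B \<subseteq> cfun.span D"
    using B(1) img cfun.span_minimal[OF D(3) cfun.subspace_span] by blast
  then have "card (h ` B) \<le> card D"
    using cfun.independent_span_bound[OF finite_subset[OF D(1) fin] indep] by blast
  moreover have "inj_on h B" using inj_span cfun.span_superset by (rule inj_on_subset)
  ultimately show ?thesis using B(4) D(4) by (simp add: card_image)
qed

text \<open>Dedekind's lemma. It yields the linear independence of distinct monomials as functions.\<close>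
lemma distinct_characters_independent:
  fixes X :: "('m::monoid_mult \<Rightarrow> complex) set"
  assumes "finite X"
    and mult: "\<And>\<chi> z w. \<chi> \<in> X \<Longrightarrow> \<chi> (z * w) = \<chi> z * \<chi> w"
    and one: "\<And>\<chi>. \<chi> \<in> X \<Longrightarrow> \<chi> 1 = 1"
    and zero: "\<And>z. (\<Sum>\<chi>\<in>X. k \<chi> * \<chi> z) = 0"
    and "\<chi> \<in> X"
  shows "k \<chi> = 0"
  using assms
proof (induction X arbitrary: k \<chi> rule: finite_induct)
  case (insert \<psi> X)
  have rest: "k \<chi> = 0" if "\<chi> \<in> X" for \<chi>
  proof -
    have "k \<chi> * (\<chi> w - \<psi> w) = 0" for w
    proof (rule insert.IH[where k = "\<lambda>\<chi>. k \<chi> * (\<chi> w - \<psi> w)"])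
      fix z
      have eqs: "k \<psi> * \<psi> u + (\<Sum>\<chi>\<in>X. k \<chi> * \<chi> u) = 0" for u
        using insert.prems(3)[of u] insert.hyps by simp
      have 1: "(\<Sum>\<chi>\<in>X. k \<chi> * \<chi> (z * w)) = (\<Sum>\<chi>\<in>X. k \<chi> * (\<chi> z * \<chi> w))"
        by (rule sum.cong) (auto simp: insert.prems(1))
      have "(\<Sum>\<chi>\<in>X. k \<chi> * (\<chi> w - \<psi> w) * \<chi> z)
          = (\<Sum>\<chi>\<in>X. k \<chi> * (\<chi> z * \<chi> w)) - \<psi> w * (\<Sum>\<chi>\<in>X. k \<chi> * \<chi> z)"
        by (simp add: algebra_simps sum_subtractf sum_distrib_left)
      also have "\<dots> = - (k \<psi> * \<psi> (z * w)) + \<psi> w * (k \<psi> * \<psi> z)"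
        using eqs[of "z * w"] eqs[of z] by (simp add: 1 add_eq_0_iff)
      also have "\<dots> = 0" using insert.prems(1)[of \<psi> z w] by simp
      finally show "(\<Sum>\<chi>\<in>X. k \<chi> * (\<chi> w - \<psi> w) * \<chi> z) = 0" .
    qed (use insert.prems that in auto)
    moreover have "\<chi> \<noteq> \<psi>" using that insert.hyps by auto
    then obtain w where "\<chi> w \<noteq> \<psi> w" by (auto simp: fun_eq_iff)
    ultimately show ?thesis by fastforce
  qed
  moreover have "k \<psi> = 0"
    using insert.prems(3)[of 1] insert.hyps insert.prems(2)[of \<psi>] rest by simp
  ultimately show ?case using insert.prems(4) by blast
qed simp

section \<open>Functions that are polynomial on lines\<close>

text \<open>The only properties of polynomial functions in many variables that the proof uses: the product
of two nonzero functions is nonzero, and a function that vanishes on a line outside one point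
vanishes at that point. Both follow from the restriction to lines.\<close>
definition poly_on_lines :: "(('i \<Rightarrow> complex) \<Rightarrow> complex) \<Rightarrow> bool" where
  "poly_on_lines f \<longleftrightarrow> (\<forall>z w. \<exists>p. \<forall>t. f (\<lambda>i. z i + t * w i) = poly p t)"

lemma poly_on_lines_const: "poly_on_lines (\<lambda>z. c)"
  unfolding poly_on_lines_def by (intro allI exI[of _ "[:c:]"]) simp

lemma poly_on_lines_coordinate: "poly_on_lines (\<lambda>z. z i)"
  unfolding poly_on_lines_def
proof (intro allI)
  fix z w :: "'a \<Rightarrow> complex"
  show "\<exists>p. \<forall>t. z i + t * w i = poly p t" by (intro exI[of _ "[:z i, w i:]"]) simp
qed

lemma poly_on_lines_add:
  assumes "poly_on_lines f" "poly_on_lines g" shows "poly_on_lines (\<lambda>z. f z + g z)"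
  using assms unfolding poly_on_lines_def by (metis poly_add)

lemma poly_on_lines_mult:
  assumes "poly_on_lines f" "poly_on_lines g" shows "poly_on_lines (\<lambda>z. f z * g z)"
  using assms unfolding poly_on_lines_def by (metis poly_mult)

lemma poly_on_lines_sum:
  "(\<And>a. a \<in> A \<Longrightarrow> poly_on_lines (f a)) \<Longrightarrow> poly_on_lines (\<lambda>z. \<Sum>a\<in>A. f a z)"
  by (induction A rule: infinite_finite_induct)
    (auto intro: poly_on_lines_const poly_on_lines_add)

lemma poly_on_lines_prod:
  "(\<And>a. a \<in> A \<Longrightarrow> poly_on_lines (f a)) \<Longrightarrow> poly_on_lines (\<lambda>z. \<Prod>a\<in>A. f a z)"
  by (induction A rule: infinite_finite_induct)
    (auto intro: poly_on_lines_const poly_on_lines_mult)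

lemma poly_on_lines_span:
  assumes S: "\<And>f. f \<in> S \<Longrightarrow> poly_on_lines f" and f: "f \<in> cfun.span S"
  shows "poly_on_lines f"
  using f
proof (induction rule: cfun.span_induct_alt)
  case base
  then show ?case using poly_on_lines_const[of 0] by (simp add: zero_fun_def)
next
  case (step c x y)
  then show ?case
    using poly_on_lines_add[OF poly_on_lines_mult[OF poly_on_lines_const S]]
    by (simp add: plus_fun_def)
qed

lemma poly_on_lines_no_zero_divisors:
  assumes f: "poly_on_lines f" and g: "poly_on_lines g" and "f z \<noteq> 0" "g w \<noteq> 0"
  shows "\<exists>y. f y * g y \<noteq> 0"
proof -
  obtain p where p: "\<And>t. f (\<lambda>i. z i + t * (w i - z i)) = poly p t"
    using f[unfolded poly_on_lines_def, rule_format, of z "\<lambda>i. w i - z i"] by blast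
  obtain q where q: "\<And>t. g (\<lambda>i. z i + t * (w i - z i)) = poly q t"
    using g[unfolded poly_on_lines_def, rule_format, of z "\<lambda>i. w i - z i"] by blast
  have "p \<noteq> 0" using p[of 0] assms(3) by auto
  moreover have "q \<noteq> 0" using q[of 1] assms(4) by auto
  ultimately have "p * q \<noteq> 0" by simp
  then obtain t where "poly (p * q) t \<noteq> 0" using poly_all_0_iff_0 by blast
  then show ?thesis using p q by (metis poly_mult)
qed

lemma poly_on_lines_eq_0_at:
  assumes f: "poly_on_lines f" and zero: "\<And>t. t \<noteq> 0 \<Longrightarrow> f (\<lambda>i. z i + t * w i) = 0"
  shows "f z = 0"
proof -
  obtain p where p: "\<And>t. f (\<lambda>i. z i + t * w i) = poly p t"
    using f unfolding poly_on_lines_def by blast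
  have "p = 0"
  proof (rule ccontr)
    assume "p \<noteq> 0"
    then have "finite {t. poly p t = 0}" by (rule poly_roots_finite)
    moreover have "- {0} \<subseteq> {t. poly p t = 0}" using zero p by auto
    ultimately have "finite (- {0::complex})" by (rule finite_subset[rotated])
    then show False by (metis finite_compl finite.emptyI finite.insertI infinite_UNIV_char_0)
  qed
  then show ?thesis using p[of 0] by simp
qed

section \<open>Polynomials attached to three fillings\<close>

definition row_len :: "nat list \<Rightarrow> nat \<Rightarrow> nat" where
  "row_len la i = (if i < length la then la ! i else 0)"

text \<open>Shapes are given by the function of their row lengths, so that the sum of two partitions becomes
a pointwise sum.\<close>
definition diagram :: "(nat \<Rightarrow> nat) \<Rightarrow> (nat \<times> nat) set" where
  "diagram s = {(i, j). j < s i}"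

lemma cells_eq_diagram: "cells la = diagram (row_len la)"
  by (auto simp: cells_def diagram_def row_len_def split: if_splits)

text \<open>A filling is stored as the map from the points to their cells, which is the inverse of a
tableau. The column group sees only the second component, and only up to injective relabelling.\<close>
definition col_perms :: "nat set \<Rightarrow> (nat \<Rightarrow> nat \<times> nat) \<Rightarrow> (nat \<Rightarrow> nat) set" where
  "col_perms X f = {p. p permutes X \<and> (\<forall>x\<in>X. snd (f (p x)) = snd (f x))}"

text \<open>Summed over \<open>r\<close> this is a product of determinants, one for each column of the third
filling; the same holds for the other two. Hence the polynomial is a highest weight vector for
the action of the three linear groups on the indices of \<open>z\<close>.\<close>
definition hw_poly :: "nat set \<Rightarrow> (nat \<Rightarrow> nat \<times> nat) \<Rightarrow> (nat \<Rightarrow> nat \<times> nat) \<Rightarrow> (nat \<Rightarrow> nat \<times> nat) \<Rightarrow>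
    (nat \<times> nat \<times> nat \<Rightarrow> complex) \<Rightarrow> complex" where
  "hw_poly X f g h z =
     (\<Sum>p\<in>col_perms X f. of_int (sign p) * (\<Sum>q\<in>col_perms X g. of_int (sign q) *
       (\<Sum>r\<in>col_perms X h. of_int (sign r) *
         (\<Prod>x\<in>X. z (fst (f (p x)), fst (g (q x)), fst (h (r x)))))))"

definition hw_polys :: "nat set \<Rightarrow> (nat \<Rightarrow> nat) \<Rightarrow> (nat \<Rightarrow> nat) \<Rightarrow> (nat \<Rightarrow> nat) \<Rightarrow>
    ((nat \<times> nat \<times> nat \<Rightarrow> complex) \<Rightarrow> complex) set" where
  "hw_polys X s t u = {hw_poly X f g h | f g h.
     bij_betw f X (diagram s) \<and> bij_betw g X (diagram t) \<and> bij_betw h X (diagram u)}"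

lemma finite_col_perms: "finite X \<Longrightarrow> finite (col_perms X f)"
  unfolding col_perms_def by (rule finite_subset[OF _ finite_permutations]) auto

lemma col_perms_permutes: "p \<in> col_perms X f \<Longrightarrow> p permutes X"
  by (simp add: col_perms_def)

lemma col_perms_inv: "inv p \<in> col_perms X f" if "p \<in> col_perms X f"
proof -
  have p: "p permutes X" using that by (rule col_perms_permutes)
  have "snd (f (inv p x)) = snd (f x)" if "x \<in> X" for x
  proof -
    have "inv p x \<in> X" using that permutes_in_image[OF permutes_inv[OF p]] by simp
    then have "snd (f (p (inv p x))) = snd (f (inv p x))"
      using \<open>p \<in> col_perms X f\<close> unfolding col_perms_def by blast
    then show ?thesis using permutes_inverses(1)[OF p] by simp
  qed
  then show ?thesis using permutes_inv[OF p] by (simp add: col_perms_def)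
qed

lemma sum_col_perms_inv:
  "(\<Sum>p\<in>col_perms X f. g (inv p)) = (\<Sum>p\<in>col_perms X f. g p)"
proof (rule sum.reindex_bij_witness[of _ inv inv])
qed (auto simp: col_perms_inv permutes_inv_inv[OF col_perms_permutes])

section \<open>Tabloids and polytabloids\<close>

text \<open>Ordered set partitions of \<open>{..<m}\<close> into \<open>l\<close> possibly empty blocks, of
any sizes. Leaving the sizes free makes the set visibly stable under permutations, and a tabloid
of shape \<open>\<lambda>\<close> is one of its elements.\<close>
definition tabloids :: "nat \<Rightarrow> nat \<Rightarrow> nat set list set" where
  "tabloids m l = {T. length T = l \<and> (\<forall>i<l. T ! i \<subseteq> {..<m}) \<and> (\<forall>x<m. \<exists>!i. i < l \<and> x \<in> T ! i)}"

definition row_of :: "nat set list \<Rightarrow> nat \<Rightarrow> nat" where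
  "row_of T x = (THE i. i < length T \<and> x \<in> T ! i)"

lemma finite_tabloids: "finite (tabloids m l)"
proof (rule finite_subset)
  show "tabloids m l \<subseteq> {T. set T \<subseteq> Pow {..<m} \<and> length T = l}"
    unfolding tabloids_def by (fastforce simp: in_set_conv_nth)
qed (simp add: finite_lists_length_eq)

lemma row_of_unique:
  assumes "T \<in> tabloids m l" "i < l" "x \<in> T ! i" shows "row_of T x = i"
proof -
  have "x < m" using assms unfolding tabloids_def by auto
  then have "\<exists>!i. i < l \<and> x \<in> T ! i" using assms(1) unfolding tabloids_def by blast
  then show ?thesis
    unfolding row_of_def using assms by (intro the1_equality) (auto simp: tabloids_def)
qed

lemma row_of:
  assumes "T \<in> tabloids m l" "x < m" shows "row_of T x < l" "x \<in> T ! row_of T x"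
proof -
  obtain i where "i < l" "x \<in> T ! i" using assms unfolding tabloids_def by blast
  then show "row_of T x < l" "x \<in> T ! row_of T x" using row_of_unique[OF assms(1)] by auto
qed

lemma tabloid_eqI:
  assumes T: "T \<in> tabloids m l" and T': "T' \<in> tabloids m l"
    and eq: "\<And>x. x < m \<Longrightarrow> row_of T x = row_of T' x"
  shows "T = T'"
proof (rule nth_equalityI)
  show "length T = length T'" using T T' by (simp add: tabloids_def)
  have sub: "A ! i \<subseteq> B ! i" if A: "A \<in> tabloids m l" and B: "B \<in> tabloids m l"
    and AB: "\<And>x. x < m \<Longrightarrow> row_of A x = row_of B x" and i: "i < l" for A B i
  proof
    fix x assume x: "x \<in> A ! i"
    then have "x < m" using A i unfolding tabloids_def by auto
    then show "x \<in> B ! i" using row_of_unique[OF A i x] AB row_of(2)[OF B] by metis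
  qed
  fix i assume "i < length T"
  then have "i < l" using T by (simp add: tabloids_def)
  then show "T ! i = T' ! i" using sub[OF T T' eq] sub[OF T' T eq[symmetric]] by blast
qed

lemma perm_tabloid_in:
  assumes "p permutes {..<m}" "T \<in> tabloids m l" shows "perm_tabloid p T \<in> tabloids m l"
proof -
  have img: "x \<in> p ` A \<longleftrightarrow> inv p x \<in> A" for x A
    using permutes_inverses[OF assms(1)] by (metis image_eqI imageE)
  have "inv p x < m \<longleftrightarrow> x < m" for x
    using permutes_in_image[OF permutes_inv[OF assms(1)]] by simp
  moreover have "p x < m \<longleftrightarrow> x < m" for x
    using permutes_in_image[OF assms(1)] by simp
  ultimately show ?thesis
    using assms(2) by (auto simp: tabloids_def perm_tabloid_def img cong: conj_cong)
qed

lemma row_of_perm_tabloid: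
  assumes "p permutes {..<m}" "T \<in> tabloids m l" "x < m"
  shows "row_of (perm_tabloid p T) x = row_of T (inv p x)"
proof (rule row_of_unique[OF perm_tabloid_in[OF assms(1,2)]])
  have x: "inv p x < m"
    using permutes_in_image[OF permutes_inv[OF assms(1)], of x] assms(3) by simp
  show "row_of T (inv p x) < l" using row_of(1)[OF assms(2) x] .
  moreover have "length T = l" using assms(2) by (simp add: tabloids_def)
  moreover have "x \<in> p ` (T ! row_of T (inv p x))"
    using row_of(2)[OF assms(2) x] permutes_inverses(1)[OF assms(1)] by (metis image_eqI)
  ultimately show "x \<in> perm_tabloid p T ! row_of T (inv p x)"
    by (simp add: perm_tabloid_def)
qed

lemma perm_tabloid_comp: "perm_tabloid p (perm_tabloid q T) = perm_tabloid (p \<circ> q) T"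
  by (simp add: perm_tabloid_def image_comp comp_def)

lemma perm_tabloid_id [simp]: "perm_tabloid id T = T"
  by (simp add: perm_tabloid_def map_idI)

lemma perm_tabloid_inverse:
  assumes "p permutes X"
  shows "perm_tabloid p (perm_tabloid (inv p) T) = T" "perm_tabloid (inv p) (perm_tabloid p T) = T"
  using permutes_inv_o[OF assms] by (simp_all add: perm_tabloid_comp)

lemma bij_inv_tableau:
  assumes "is_tableau la t"
  shows "bij_betw (inv_into (cells la) t) {..<sum_list la} (cells la)"
  using assms unfolding is_tableau_def by (rule bij_betw_inv_into)

lemma tableau_row_fibre:
  assumes "is_tableau la t"
  shows "{t (i, j) |j. (i, j) \<in> cells la}
      = {x. x < sum_list la \<and> fst (inv_into (cells la) t x) = i}"
    and "{t (i, j) |i. (i, j) \<in> cells la}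
      = {x. x < sum_list la \<and> snd (inv_into (cells la) t x) = j}"
proof -
  let ?f = "inv_into (cells la) t"
  have t: "bij_betw t (cells la) {..<sum_list la}" using assms by (simp add: is_tableau_def)
  have a: "?f (t c) = c" "t c < sum_list la" if "c \<in> cells la" for c
    using that bij_betw_inv_into_left[OF t] bij_betwE[OF t] by auto
  have b: "t (?f x) = x" "?f x \<in> cells la" if "x < sum_list la" for x
    using that bij_betw_inv_into_right[OF t] bij_betwE[OF bij_inv_tableau[OF assms]] by auto
  show "{t (i, j) |j. (i, j) \<in> cells la}
      = {x. x < sum_list la \<and> fst (?f x) = i}"
    using a b by (auto, metis prod.collapse)
  show "{t (i, j) |i. (i, j) \<in> cells la}
      = {x. x < sum_list la \<and> snd (?f x) = j}"
    using a b by (auto, metis prod.collapse)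
qed

lemma tabloid_of_in:
  assumes "is_tableau la t"
  shows "tabloid_of la t \<in> tabloids (sum_list la) (length la)"
proof -
  have "fst (inv_into (cells la) t x) < length la" if "x < sum_list la" for x
    using bspec[OF bij_betwE[OF bij_inv_tableau[OF assms]], of x] that
    by (simp add: cells_def case_prod_beta)
  then show ?thesis
    by (auto simp: tabloids_def tabloid_of_def tableau_row_fibre[OF assms] cong: conj_cong)
qed

lemma row_of_tabloid_of:
  assumes "is_tableau la t" "x < sum_list la"
  shows "row_of (tabloid_of la t) x = fst (inv_into (cells la) t x)"
proof (rule row_of_unique[OF tabloid_of_in[OF assms(1)]])
  show "fst (inv_into (cells la) t x) < length la"
    using bspec[OF bij_betwE[OF bij_inv_tableau[OF assms(1)]], of x] assms(2)
    by (simp add: cells_def case_prod_beta)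
  then show "x \<in> tabloid_of la t ! fst (inv_into (cells la) t x)"
    using assms(2) by (simp add: tabloid_of_def tableau_row_fibre[OF assms(1)])
qed

text \<open>A permutation that maps each fibre of the column number into itself maps it onto itself, because
fibres are finite.\<close>
lemma column_group_eq:
  assumes "is_tableau la t"
  shows "column_group la t = col_perms {..<sum_list la} (inv_into (cells la) t)"
proof -
  let ?f = "inv_into (cells la) t" and ?m = "sum_list la"
  have "(\<forall>j. p ` {x. x < ?m \<and> snd (?f x) = j} = {x. x < ?m \<and> snd (?f x) = j})
      \<longleftrightarrow> (\<forall>x\<in>{..<?m}. snd (?f (p x)) = snd (?f x))" (is "?l \<longleftrightarrow> ?r") if p: "p permutes {..<?m}" for p
  proof
    assume l: ?l
    show ?r
    proof
      fix x assume "x \<in> {..<?m}"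
      then have "p x \<in> p ` {y. y < ?m \<and> snd (?f y) = snd (?f x)}" by simp
      also have "\<dots> = {y. y < ?m \<and> snd (?f y) = snd (?f x)}" using l by blast
      finally show "snd (?f (p x)) = snd (?f x)" by simp
    qed
  next
    assume r: ?r
    show ?l
    proof
      fix j
      show "p ` {x. x < ?m \<and> snd (?f x) = j} = {x. x < ?m \<and> snd (?f x) = j}"
      proof (rule card_subset_eq)
        show "finite {x. x < ?m \<and> snd (?f x) = j}" by simp
        show "p ` {x. x < ?m \<and> snd (?f x) = j} \<subseteq> {x. x < ?m \<and> snd (?f x) = j}"
          using r permutes_in_image[OF p] by auto
        show "card (p ` {x. x < ?m \<and> snd (?f x) = j}) = card {x. x < ?m \<and> snd (?f x) = j}"
          by (rule card_image) (rule permutes_inj_on[OF p])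
      qed
    qed
  qed
  then show ?thesis
    unfolding column_group_def col_perms_def tableau_row_fibre[OF assms] by blast
qed

lemma polytabloid_outside:
  assumes "is_tableau la t" "T \<notin> tabloids (sum_list la) (length la)"
  shows "polytabloid la t T = 0"
proof -
  have "perm_tabloid p (tabloid_of la t) \<noteq> T" if "p \<in> column_group la t" for p
    using perm_tabloid_in[OF _ tabloid_of_in[OF assms(1)]] that assms(2)
    by (auto simp: column_group_def)
  then show ?thesis by (simp add: polytabloid_def)
qed

text \<open>Pairing a polytabloid with any function turns the coefficients into an alternating sum over the
column group. The substitution of the inverse makes the row number of a point \<open>x\<close>
in the permuted tabloid equal to the row number of \<open>p x\<close> in the original one.\<close>
lemma sum_polytabloid:
  assumes t: "is_tableau la t"
  shows "(\<Sum>T\<in>tabloids (sum_list la) (length la). polytabloid la t T * F T)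
    = (\<Sum>p\<in>col_perms {..<sum_list la} (inv_into (cells la) t).
        of_int (sign p) * F (perm_tabloid (inv p) (tabloid_of la t)))"
proof -
  let ?C = "col_perms {..<sum_list la} (inv_into (cells la) t)"
    and ?T = "tabloids (sum_list la) (length la)"
  have "(\<Sum>T\<in>?T. polytabloid la t T * F T)
      = (\<Sum>p\<in>?C. \<Sum>T\<in>?T. of_int (sign p) * (of_bool (T = perm_tabloid p (tabloid_of la t)) * F T))"
    by (subst sum.swap)
      (simp add: polytabloid_def column_group_eq[OF t] sum_distrib_right mult.assoc eq_commute)
  also have "\<dots> = (\<Sum>p\<in>?C. of_int (sign p) * F (perm_tabloid p (tabloid_of la t)))"
  proof (rule sum.cong[OF refl])
    fix p assume "p \<in> ?C"
    then have "perm_tabloid p (tabloid_of la t) \<in> ?T"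
      using perm_tabloid_in[OF _ tabloid_of_in[OF t]] by (simp add: col_perms_def)
    then show "(\<Sum>T\<in>?T. of_int (sign p) * (of_bool (T = perm_tabloid p (tabloid_of la t)) * F T))
        = of_int (sign p) * F (perm_tabloid p (tabloid_of la t))"
      by (simp add: sum_distrib_left[symmetric] sum_delta_mult[OF finite_tabloids])
  qed
  also have "\<dots> = (\<Sum>p\<in>?C. of_int (sign (inv p)) * F (perm_tabloid (inv p) (tabloid_of la t)))"
    by (rule sum_col_perms_inv[symmetric])
  also have "\<dots> = (\<Sum>p\<in>?C. of_int (sign p) * F (perm_tabloid (inv p) (tabloid_of la t)))"
  proof (rule sum.cong[OF refl])
    fix p assume "p \<in> ?C"
    then have "permutation p" by (auto simp: col_perms_def intro: permutes_imp_permutation)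
    then show "of_int (sign (inv p)) * F (perm_tabloid (inv p) (tabloid_of la t))
        = of_int (sign p) * F (perm_tabloid (inv p) (tabloid_of la t))"
      by (simp add: sign_inverse)
  qed
  finally show ?thesis .
qed

lemma finite_polytabloids: "finite {polytabloid la t |t. is_tableau la t}"
proof -
  define G where "G = (\<lambda>(T0, C). (\<lambda>T. \<Sum>p\<in>C. complex_of_int (sign p) * of_bool (perm_tabloid p T0 = T)))"
  have "{polytabloid la t |t. is_tableau la t}
      \<subseteq> G ` (tabloids (sum_list la) (length la) \<times> Pow {p. p permutes {..<sum_list la}})"
  proof
    fix v assume "v \<in> {polytabloid la t |t. is_tableau la t}"
    then obtain t where t: "is_tableau la t" "v = polytabloid la t" by blast
    have "v = G (tabloid_of la t, column_group la t)"
      by (simp add: t(2) polytabloid_def G_def)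
    moreover have "column_group la t \<subseteq> {p. p permutes {..<sum_list la}}"
      by (auto simp: column_group_def)
    ultimately show "v \<in> G ` (tabloids (sum_list la) (length la) \<times> Pow {p. p permutes {..<sum_list la}})"
      using tabloid_of_in[OF t(1)] by blast
  qed
  then show ?thesis
    by (rule finite_subset) (simp add: finite_tabloids finite_permutations)
qed

lemma specht_outside:
  assumes "v \<in> specht_module la" "T \<notin> tabloids (sum_list la) (length la)"
  shows "v T = 0"
  using assms(1) unfolding specht_module_def
  by (induction rule: cfun.span_induct_alt) (use polytabloid_outside[OF _ assms(2)] in auto)

text \<open>The column group of \<open>s \<circ> t\<close> is the conjugate by \<open>s\<close> of the
column group of \<open>t\<close>, and conjugation preserves the sign.\<close>
lemma perm_act_polytabloid:
  assumes t: "is_tableau la t" and s: "s permutes {..<sum_list la}"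
  shows "is_tableau la (s \<circ> t)" "perm_act s (polytabloid la t) = polytabloid la (s \<circ> t)"
proof -
  let ?m = "sum_list la"
  have "bij_betw t (cells la) {..<?m}" using t by (simp add: is_tableau_def)
  from bij_betw_trans[OF this permutes_imp_bij[OF s]]
  show "is_tableau la (s \<circ> t)" by (simp add: is_tableau_def)
  have tab: "tabloid_of la (s \<circ> t) = perm_tabloid s (tabloid_of la t)"
    by (simp add: tabloid_of_def perm_tabloid_def) blast
  have conj: "s \<circ> p \<circ> inv s \<in> column_group la (s \<circ> t)" if "p \<in> column_group la t"
    and s: "s permutes {..<?m}" for s t p
  proof -
    have p: "p permutes {..<?m}" using that by (simp add: column_group_def)
    have "(s \<circ> p \<circ> inv s) ` {(s \<circ> t) (i, j) |i. (i, j) \<in> cells la}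
        = {(s \<circ> t) (i, j) |i. (i, j) \<in> cells la}" for j
    proof -
      have "{(s \<circ> t) (i, j) |i. (i, j) \<in> cells la} = s ` {t (i, j) |i. (i, j) \<in> cells la}"
        by auto
      moreover have "(s \<circ> p \<circ> inv s) ` s ` A = s ` p ` A" for A
        using permutes_inverses(2)[OF s] by (simp add: image_image)
      ultimately show ?thesis using that(1) by (simp add: column_group_def)
    qed
    then show ?thesis
      using permutes_compose[OF permutes_inv[OF s] permutes_compose[OF p s]]
      by (simp add: column_group_def comp_assoc)
  qed
  have perm: "permutation p" if "p \<in> column_group la t" for p t
    using that by (auto simp: column_group_def intro: permutes_imp_permutation)
  have perm_s: "permutation s" using s by (auto intro: permutes_imp_permutation)
  show "perm_act s (polytabloid la t) = polytabloid la (s \<circ> t)"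
  proof
    fix T
    have "polytabloid la (s \<circ> t) T
      = (\<Sum>p\<in>column_group la t. of_int (sign (s \<circ> p \<circ> inv s))
          * of_bool (perm_tabloid (s \<circ> p \<circ> inv s) (tabloid_of la (s \<circ> t)) = T))"
      unfolding polytabloid_def
    proof (rule sum.reindex_bij_witness[of _ "\<lambda>p. s \<circ> p \<circ> inv s" "\<lambda>p. inv s \<circ> p \<circ> s"])
      fix p assume p: "p \<in> column_group la (s \<circ> t)"
      have "inv s \<circ> (s \<circ> t) = t" by (simp add: o_assoc permutes_inv_o[OF s])
      then show "inv s \<circ> p \<circ> s \<in> column_group la t"
        using conj[OF p permutes_inv[OF s]] by (simp add: permutes_inv_inv[OF s])
      show eq: "s \<circ> (inv s \<circ> p \<circ> s) \<circ> inv s = p"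
        by (simp add: fun_eq_iff permutes_inverses[OF s])
      then show "of_int (sign (s \<circ> (inv s \<circ> p \<circ> s) \<circ> inv s))
          * of_bool (perm_tabloid (s \<circ> (inv s \<circ> p \<circ> s) \<circ> inv s) (tabloid_of la (s \<circ> t)) = T)
        = complex_of_int (sign p) * of_bool (perm_tabloid p (tabloid_of la (s \<circ> t)) = T)" by simp
    next
      fix p assume p: "p \<in> column_group la t"
      show "inv s \<circ> (s \<circ> p \<circ> inv s) \<circ> s = p"
        by (simp add: fun_eq_iff permutes_inverses[OF s])
      show "s \<circ> p \<circ> inv s \<in> column_group la (s \<circ> t)" by (rule conj[OF p s])
    qed
    also have "\<dots> = (\<Sum>p\<in>column_group la t. of_int (sign p)
          * of_bool (perm_tabloid p (tabloid_of la t) = perm_tabloid (inv s) T))"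
    proof (rule sum.cong[OF refl])
      fix p assume p: "p \<in> column_group la t"
      have "sign (s \<circ> p \<circ> inv s) = sign s * sign p * sign s"
        by (simp add: sign_compose sign_inverse permutation_compose permutation_inverse perm[OF p] perm_s)
      also have "\<dots> = sign p" by (simp add: mult.commute mult.left_commute)
      finally have sgn: "sign (s \<circ> p \<circ> inv s) = sign p" .
      have "s \<circ> p \<circ> inv s \<circ> s = s \<circ> p"
        by (simp add: fun_eq_iff permutes_inverses[OF s])
      then have "perm_tabloid (s \<circ> p \<circ> inv s) (tabloid_of la (s \<circ> t))
          = perm_tabloid s (perm_tabloid p (tabloid_of la t))"
        by (simp add: tab perm_tabloid_comp)
      moreover have "perm_tabloid s (perm_tabloid p (tabloid_of la t)) = T
          \<longleftrightarrow> perm_tabloid p (tabloid_of la t) = perm_tabloid (inv s) T"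
        using perm_tabloid_inverse[OF s] by metis
      ultimately show "of_int (sign (s \<circ> p \<circ> inv s))
          * of_bool (perm_tabloid (s \<circ> p \<circ> inv s) (tabloid_of la (s \<circ> t)) = T)
        = complex_of_int (sign p) * of_bool (perm_tabloid p (tabloid_of la t) = perm_tabloid (inv s) T)"
        by (simp add: sgn)
    qed
    finally show "perm_act s (polytabloid la t) T = polytabloid la (s \<circ> t) T"
      by (simp add: perm_act_def polytabloid_def)
  qed
qed

lemma perm_act_specht:
  assumes s: "s permutes {..<sum_list la}" and v: "v \<in> specht_module la"
  shows "perm_act s v \<in> specht_module la"
  using v unfolding specht_module_def
proof (induction rule: cfun.span_induct_alt)
  case base
  have "perm_act s 0 = 0" by (simp add: perm_act_def fun_eq_iff)
  then show ?case by (metis cfun.span_zero)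
next
  case (step c x y)
  then have "perm_act s x \<in> cfun.span {polytabloid la t |t. is_tableau la t}"
    using perm_act_polytabloid[OF _ s] by (blast intro: cfun.span_base)
  then have "(\<lambda>T. c * perm_act s x T) + perm_act s y \<in> cfun.span {polytabloid la t |t. is_tableau la t}"
    using step.IH by (intro cfun.span_add cfun.span_scale)
  also have "(\<lambda>T. c * perm_act s x T) + perm_act s y = perm_act s ((\<lambda>T. c * x T) + y)"
    by (simp add: perm_act_def fun_eq_iff)
  finally show ?case .
qed

lemma cnj_specht:
  assumes "v \<in> specht_module la" shows "(\<lambda>T. cnj (v T)) \<in> specht_module la"
  using assms unfolding specht_module_def
proof (induction rule: cfun.span_induct_alt)
  case base
  show ?case using cfun.span_zero by (simp add: zero_fun_def)
next
  case (step c x y)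
  have "cnj (of_bool P) = of_bool P" for P by (cases P) auto
  then have "(\<lambda>T. cnj (x T)) = x" using step.hyps by (auto simp: polytabloid_def)
  then have "(\<lambda>T. cnj (x T)) \<in> cfun.span {polytabloid la t |t. is_tableau la t}"
    using step.hyps by (simp add: cfun.span_base)
  then have "(\<lambda>T. cnj c * cnj (x T)) + (\<lambda>T. cnj (y T))
      \<in> cfun.span {polytabloid la t |t. is_tableau la t}"
    using step.IH by (intro cfun.span_add cfun.span_scale)
  also have "(\<lambda>T. cnj c * cnj (x T)) + (\<lambda>T. cnj (y T)) = (\<lambda>T. cnj (((\<lambda>T. c * x T) + y) T))"
    by (simp add: fun_eq_iff)
  finally show ?case .
qed

text \<open>The character in matrix form, in the basis that the definition of the trace selects.\<close>
lemma specht_basis: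
  obtains B R where "finite B" "cfun.independent B" "cfun.span B = specht_module la"
    "\<And>s b T. s permutes {..<sum_list la} \<Longrightarrow> b \<in> B \<Longrightarrow> perm_act s b T = (\<Sum>c\<in>B. R s b c * c T)"
    "\<And>s. irr_char la s = (\<Sum>b\<in>B. R s b b)"
proof -
  let ?V = "specht_module la"
  define B where "B = (SOME B. cfun.independent B \<and> cfun.span B = ?V)"
  obtain B' where "cfun.independent B'" "B' \<subseteq> ?V" "?V \<subseteq> cfun.span B'"
    using cfun.maximal_independent_subset .
  then have "cfun.independent B' \<and> cfun.span B' = ?V"
    using cfun.span_minimal[of B' ?V] by (auto simp: specht_module_def)
  then have B: "cfun.independent B" "cfun.span B = ?V"
    unfolding B_def by (metis (mono_tags, lifting) someI_ex)+
  have fin: "finite B"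
    using cfun.independent_span_bound[OF finite_polytabloids B(1), of la] B(2)
      cfun.span_superset[of B] by (auto simp: specht_module_def)
  show thesis
  proof (rule that[of B "\<lambda>s b c. cfun.representation B (perm_act s b) c"])
    fix s b T assume s: "s permutes {..<sum_list la}" and b: "b \<in> B"
    have "b \<in> ?V" using b B(2) cfun.span_base by blast
    then have "perm_act s b \<in> cfun.span B" using perm_act_specht[OF s] B(2) by blast
    from cfun.sum_representation_eq[OF B(1) this fin order_refl]
    show "perm_act s b T = (\<Sum>c\<in>B. cfun.representation B (perm_act s b) c * c T)"
      by (metis (no_types, lifting) sum.cong sum_fun_apply)
  next
    show "irr_char la s = (\<Sum>b\<in>B. cfun.representation B (perm_act s b) b)" for s
      by (simp add: irr_char_def trace_on_def B_def[symmetric])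
  qed (use fin B in auto)
qed

section \<open>Kronecker coefficients as dimensions\<close>

lemma sum_triple_prod:
  "(\<Sum>i\<in>A \<times> B \<times> C. F (fst i) (fst (snd i)) (snd (snd i))) = (\<Sum>a\<in>A. \<Sum>b\<in>B. \<Sum>c\<in>C. F a b c)"
  by (simp add: sum.cartesian_product case_prod_beta)

type_synonym tabloid3 = "nat set list \<times> nat set list \<times> nat set list"

text \<open>A triple of tabloids is the same as a word that gives to every point the triple of its row
numbers. The monomial of the word forgets the order of the letters, hence is a complete
invariant of its orbit.\<close>
definition word :: "tabloid3 \<Rightarrow> nat \<Rightarrow> nat \<times> nat \<times> nat" where
  "word T x = (row_of (fst T) x, row_of (fst (snd T)) x, row_of (snd (snd T)) x)"

definition word_monomial :: "nat \<Rightarrow> tabloid3 \<Rightarrow> (nat \<times> nat \<times> nat \<Rightarrow> complex) \<Rightarrow> complex" where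
  "word_monomial m T z = (\<Prod>x<m. z (word T x))"

definition perm_tabloid3 :: "(nat \<Rightarrow> nat) \<Rightarrow> tabloid3 \<Rightarrow> tabloid3" where
  "perm_tabloid3 s = map_prod (perm_tabloid s) (map_prod (perm_tabloid s) (perm_tabloid s))"

definition tabloid3s :: "nat \<Rightarrow> nat \<Rightarrow> nat \<Rightarrow> nat \<Rightarrow> tabloid3 set" where
  "tabloid3s m k l n = tabloids m k \<times> tabloids m l \<times> tabloids m n"

lemma finite_tabloid3s [simp]: "finite (tabloid3s m k l n)"
  by (simp add: tabloid3s_def finite_tabloids)

lemma perm_tabloid3_in:
  "s permutes {..<m} \<Longrightarrow> T \<in> tabloid3s m k l n \<Longrightarrow> perm_tabloid3 s T \<in> tabloid3s m k l n"
  by (auto simp: perm_tabloid3_def tabloid3s_def perm_tabloid_in)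

lemma perm_tabloid3_inverse:
  assumes "s permutes X"
  shows "perm_tabloid3 s (perm_tabloid3 (inv s) T) = T" "perm_tabloid3 (inv s) (perm_tabloid3 s T) = T"
  by (cases T; simp add: perm_tabloid3_def perm_tabloid_inverse[OF assms])+

lemma perm_tabloid3_comp: "perm_tabloid3 s (perm_tabloid3 t T) = perm_tabloid3 (s \<circ> t) T"
  by (cases T) (simp add: perm_tabloid3_def perm_tabloid_comp)

lemma word_perm_tabloid3:
  assumes "s permutes {..<m}" "T \<in> tabloid3s m k l n" "x < m"
  shows "word (perm_tabloid3 s T) x = word T (inv s x)"
  using assms by (auto simp: word_def perm_tabloid3_def tabloid3s_def row_of_perm_tabloid)

lemma word_eqI:
  assumes "S \<in> tabloid3s m k l n" "T \<in> tabloid3s m k l n" "\<And>x. x < m \<Longrightarrow> word S x = word T x"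
  shows "S = T"
  using assms by (auto simp: tabloid3s_def word_def intro!: tabloid_eqI)

lemma word_monomial_perm:
  assumes s: "s permutes {..<m}" and T: "T \<in> tabloid3s m k l n"
  shows "word_monomial m (perm_tabloid3 s T) = word_monomial m T"
proof
  fix z
  have "word_monomial m (perm_tabloid3 s T) z = (\<Prod>x<m. z (word T (inv s x)))"
    unfolding word_monomial_def by (rule prod.cong) (auto simp: word_perm_tabloid3[OF s T])
  also have "\<dots> = word_monomial m T z"
    unfolding word_monomial_def
    using prod.permute[OF permutes_inv[OF s], of "\<lambda>x. z (word T x)"] by (simp add: comp_def)
  finally show "word_monomial m (perm_tabloid3 s T) z = word_monomial m T z" .
qed

text \<open>Evaluating the monomial at \<open>2\<close> in one variable and \<open>1\<close> in the others
counts the occurrences of one letter, so words with the same monomial are rearrangements of each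
other.\<close>
lemma word_monomial_eq_imp_perm:
  assumes S: "S \<in> tabloid3s m k l n" and T: "T \<in> tabloid3s m k l n"
    and eq: "word_monomial m S = word_monomial m T"
  obtains s where "s permutes {..<m}" "S = perm_tabloid3 s T"
proof -
  have count: "card {x\<in>{..<m}. word S x = c} = card {x\<in>{..<m}. word T x = c}" for c
  proof -
    have pow: "word_monomial m T (\<lambda>d. if d = c then 2 else 1) = 2 ^ card {x\<in>{..<m}. word T x = c}" for T
    proof -
      have "(\<Prod>x<m. if word T x = c then 2 else (1::complex))
          = (\<Prod>x\<in>{x\<in>{..<m}. word T x = c}. 2)"
        by (rule prod.mono_neutral_cong_right) auto
      then show ?thesis by (simp add: word_monomial_def)
    qed
    have "(2::complex) ^ card {x\<in>{..<m}. word S x = c} = 2 ^ card {x\<in>{..<m}. word T x = c}"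
      using pow[of S] pow[of T] eq by simp
    then have "complex_of_nat (2 ^ card {x\<in>{..<m}. word S x = c})
        = complex_of_nat (2 ^ card {x\<in>{..<m}. word T x = c})"
      by (simp only: of_nat_power of_nat_numeral)
    then have "(2::nat) ^ card {x\<in>{..<m}. word S x = c} = 2 ^ card {x\<in>{..<m}. word T x = c}"
      by (simp only: of_nat_eq_iff)
    then show ?thesis by (rule power_inject_exp[THEN iffD1, rotated]) simp
  qed
  have "image_mset (word S) (mset_set {..<m}) = image_mset (word T) (mset_set {..<m})"
  proof (rule multiset_eqI)
    fix c
    have *: "{x\<in>{..<m}. word T x = c} = word T -` {c} \<inter> {..<m}" for T by auto
    show "count (image_mset (word S) (mset_set {..<m})) c = count (image_mset (word T) (mset_set {..<m})) c"
      using count[of c, unfolded *] by (simp add: count_image_mset)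
  qed
  then obtain p where p: "p permutes {..<m}" "\<forall>x\<in>{..<m}. word S x = word T (p x)"
    using image_mset_eq_implies_permutes[of "{..<m}" "word S" "word T"] by auto
  have "S = perm_tabloid3 (inv p) T"
  proof (rule word_eqI[OF S perm_tabloid3_in[OF permutes_inv[OF p(1)] T]])
    fix x assume "x < m"
    then show "word S x = word (perm_tabloid3 (inv p) T) x"
      using p(2) word_perm_tabloid3[OF permutes_inv[OF p(1)] T] by (simp add: permutes_inv_inv[OF p(1)])
  qed
  then show thesis using that permutes_inv[OF p(1)] by blast
qed

lemma sum_perms_reindex:
  assumes "t permutes {..<m}"
  shows "(\<Sum>s | s permutes {..<m}. F (inv s \<circ> t)) = (\<Sum>s | s permutes {..<m}. F (inv s))"
proof (rule sum.reindex_bij_witness[of _ "\<lambda>s. t \<circ> s" "\<lambda>s. inv t \<circ> s"])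
  fix s assume "s \<in> {s. s permutes {..<m}}"
  then have s: "s permutes {..<m}" by simp
  show "t \<circ> (inv t \<circ> s) = s" "inv t \<circ> (t \<circ> s) = s"
    by (simp_all add: o_assoc permutes_inv_o[OF assms])
  show "t \<circ> s \<in> {s. s permutes {..<m}}" "inv t \<circ> s \<in> {s. s permutes {..<m}}"
    using s permutes_compose permutes_inv[OF assms] assms by auto
  have "inv (inv t \<circ> s) = inv s \<circ> t"
    using permutes_inv[OF assms] s
    by (subst o_inv_distrib) (auto simp: permutes_bij permutes_inv_inv[OF assms])
  then show "F (inv (inv t \<circ> s)) = F (inv s \<circ> t)" by simp
qed

text \<open>Passing from coefficient functions on triples of tabloids to polynomials loses nothing beyond
the orbit sums. The sums over the classes \<open>K\<close> of triples with a common monomial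
vanish by independence of characters; averaging over the group spreads such a sum evenly over
the class, which is one orbit.\<close>
lemma orbit_sum_eq_0:
  fixes U :: "tabloid3 \<Rightarrow> complex"
  assumes zero: "\<And>z. (\<Sum>T\<in>tabloid3s m k l n. U T * word_monomial m T z) = 0"
    and T0: "T0 \<in> tabloid3s m k l n"
  shows "(\<Sum>s | s permutes {..<m}. U (perm_tabloid3 (inv s) T0)) = 0"
proof -
  let ?TT = "tabloid3s m k l n" and ?S = "{s. s permutes {..<m}}"
  define K where "K = {T\<in>?TT. word_monomial m T = word_monomial m T0}"
  have "(\<Sum>T | T \<in> ?TT \<and> word_monomial m T = word_monomial m T0. U T) = 0"
  proof (rule distinct_characters_independent[of "word_monomial m ` ?TT"
          "\<lambda>\<chi>. \<Sum>T | T \<in> ?TT \<and> word_monomial m T = \<chi>. U T"])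
    fix z
    have "(\<Sum>\<chi>\<in>word_monomial m ` ?TT. (\<Sum>T | T \<in> ?TT \<and> word_monomial m T = \<chi>. U T) * \<chi> z)
        = (\<Sum>\<chi>\<in>word_monomial m ` ?TT. \<Sum>T | T \<in> ?TT \<and> word_monomial m T = \<chi>. U T * word_monomial m T z)"
      by (auto simp: sum_distrib_right intro!: sum.cong)
    also have "\<dots> = (\<Sum>T\<in>?TT. U T * word_monomial m T z)"
      by (rule sum.image_gen[symmetric]) simp
    also have "\<dots> = 0" by (rule zero)
    finally show "(\<Sum>\<chi>\<in>word_monomial m ` ?TT. (\<Sum>T | T \<in> ?TT \<and> word_monomial m T = \<chi>. U T) * \<chi> z) = 0" .
  qed (use T0 in \<open>auto simp: word_monomial_def prod.distrib\<close>)
  then have sum_K: "(\<Sum>T\<in>K. U T) = 0" by (simp add: K_def)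
  have finK: "finite K" by (simp add: K_def)
  have const: "(\<Sum>s\<in>?S. U (perm_tabloid3 (inv s) T)) = (\<Sum>s\<in>?S. U (perm_tabloid3 (inv s) T0))"
    if "T \<in> K" for T
  proof -
    have "T \<in> ?TT" "word_monomial m T = word_monomial m T0" using that by (auto simp: K_def)
    then obtain t where t: "t permutes {..<m}" "T = perm_tabloid3 t T0"
      using word_monomial_eq_imp_perm[OF _ T0] by metis
    then show ?thesis
      using sum_perms_reindex[OF t(1), of "\<lambda>s. U (perm_tabloid3 s T0)"]
      by (simp add: perm_tabloid3_comp)
  qed
  have perm_K: "(\<Sum>T\<in>K. U (perm_tabloid3 (inv s) T)) = (\<Sum>T\<in>K. U T)" if "s \<in> ?S" for s
  proof (rule sum.reindex_bij_witness[of _ "perm_tabloid3 s" "perm_tabloid3 (inv s)"])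
    have s: "s permutes {..<m}" using that by simp
    fix T assume "T \<in> K"
    then have T: "T \<in> ?TT" "word_monomial m T = word_monomial m T0" by (simp_all add: K_def)
    show "perm_tabloid3 s (perm_tabloid3 (inv s) T) = T" "perm_tabloid3 (inv s) (perm_tabloid3 s T) = T"
      using perm_tabloid3_inverse[OF s] by blast+
    show "perm_tabloid3 (inv s) T \<in> K" "perm_tabloid3 s T \<in> K"
      using perm_tabloid3_in[OF s T(1)] perm_tabloid3_in[OF permutes_inv[OF s] T(1)] T(2)
        word_monomial_perm[OF s T(1)] word_monomial_perm[OF permutes_inv[OF s] T(1)]
      by (simp_all add: K_def)
  qed simp
  have "of_nat (card K) * (\<Sum>s\<in>?S. U (perm_tabloid3 (inv s) T0))
      = (\<Sum>T\<in>K. \<Sum>s\<in>?S. U (perm_tabloid3 (inv s) T))"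
    using const by simp
  also have "\<dots> = (\<Sum>s\<in>?S. \<Sum>T\<in>K. U (perm_tabloid3 (inv s) T))" by (rule sum.swap)
  also have "\<dots> = 0" using perm_K sum_K by simp
  finally have "card K = 0 \<or> (\<Sum>s\<in>?S. U (perm_tabloid3 (inv s) T0)) = 0" by simp
  moreover have "T0 \<in> K" using T0 by (simp add: K_def)
  ultimately show ?thesis using finK by auto
qed

text \<open>The polynomial of a tensor \<open>u \<otimes> v \<otimes> w\<close> of coefficient functions;
the set \<open>TT\<close> of triples is the common domain of the three tensor factors.\<close>
definition word_poly :: "nat \<Rightarrow> tabloid3 set \<Rightarrow> (nat set list \<Rightarrow> complex) \<Rightarrow> (nat set list \<Rightarrow> complex) \<Rightarrow>
    (nat set list \<Rightarrow> complex) \<Rightarrow> (nat \<times> nat \<times> nat \<Rightarrow> complex) \<Rightarrow> complex" where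
  "word_poly m TT u v w z =
     (\<Sum>T\<in>TT. u (fst T) * v (fst (snd T)) * w (snd (snd T)) * word_monomial m T z)"

lemma word_poly_perm:
  assumes s: "s permutes {..<m}"
  shows "word_poly m (tabloid3s m k l n) (perm_act s u) (perm_act s v) (perm_act s w)
    = word_poly m (tabloid3s m k l n) u v w"
proof
  fix z
  let ?TT = "tabloid3s m k l n"
  note s' = permutes_inv[OF s]
  have "word_poly m ?TT (perm_act s u) (perm_act s v) (perm_act s w) z
    = (\<Sum>T\<in>?TT. (\<lambda>T. u (fst T) * v (fst (snd T)) * w (snd (snd T)) * word_monomial m T z) (perm_tabloid3 (inv s) T))"
    unfolding word_poly_def
    by (rule sum.cong[OF refl])
      (simp add: word_monomial_perm[OF s'], simp add: perm_act_def perm_tabloid3_def)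
  also have "\<dots> = word_poly m ?TT u v w z"
    unfolding word_poly_def
    by (rule sum.reindex_bij_witness[of _ "perm_tabloid3 s" "perm_tabloid3 (inv s)"])
      (auto simp: perm_tabloid3_inverse[OF s] perm_tabloid3_in[OF s] perm_tabloid3_in[OF s'])
  finally show "word_poly m ?TT (perm_act s u) (perm_act s v) (perm_act s w) z = word_poly m ?TT u v w z" .
qed

lemma word_poly_linear:
  "word_poly m TT 0 v w = 0" "word_poly m TT u 0 w = 0" "word_poly m TT u v 0 = 0"
  "word_poly m TT ((\<lambda>x. c * u x) + u') v w = (\<lambda>z. c * word_poly m TT u v w z) + word_poly m TT u' v w"
  "word_poly m TT u ((\<lambda>x. c * v x) + v') w = (\<lambda>z. c * word_poly m TT u v w z) + word_poly m TT u v' w"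
  "word_poly m TT u v ((\<lambda>x. c * w x) + w') = (\<lambda>z. c * word_poly m TT u v w z) + word_poly m TT u v w'"
  by (simp_all add: word_poly_def fun_eq_iff algebra_simps sum.distrib sum_distrib_left)

lemma word_poly_in_span:
  assumes "u \<in> cfun.span A" "v \<in> cfun.span B" "w \<in> cfun.span C"
  shows "word_poly m TT u v w \<in> cfun.span {word_poly m TT a b c |a b c. a \<in> A \<and> b \<in> B \<and> c \<in> C}"
    (is "_ \<in> cfun.span ?G")
proof -
  have 1: "word_poly m TT a b w \<in> cfun.span ?G" if "a \<in> A" "b \<in> B" for a b
    using assms(3)
  proof (induction rule: cfun.span_induct_alt)
    case base
    show ?case by (metis word_poly_linear(3) cfun.span_zero zero_fun_def)
  next
    case (step c x y)
    then show ?case unfolding word_poly_linear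
      using that by (intro cfun.span_add cfun.span_scale) (auto intro: cfun.span_base)
  qed
  have 2: "word_poly m TT a v w \<in> cfun.span ?G" if "a \<in> A" for a
    using assms(2)
  proof (induction rule: cfun.span_induct_alt)
    case base
    show ?case by (metis word_poly_linear(2) cfun.span_zero zero_fun_def)
  next
    case (step c x y)
    then show ?case unfolding word_poly_linear
      using that by (intro cfun.span_add cfun.span_scale) (auto intro: 1)
  qed
  show ?thesis
    using assms(1)
  proof (induction rule: cfun.span_induct_alt)
    case base
    show ?case by (metis word_poly_linear(1) cfun.span_zero zero_fun_def)
  next
    case (step c x y)
    then show ?case unfolding word_poly_linear
      by (intro cfun.span_add cfun.span_scale) (auto intro: 2)
  qed
qed

text \<open>Summation against a polytabloid becomes an alternating sum over its column group, once in each
of the three factors.\<close>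
lemma word_poly_polytabloid:
  assumes t: "is_tableau la t" "is_tableau \<mu> t'" "is_tableau \<nu> t''"
    and m: "sum_list la = m" "sum_list \<mu> = m" "sum_list \<nu> = m"
  shows "word_poly m (tabloid3s m (length la) (length \<mu>) (length \<nu>))
      (polytabloid la t) (polytabloid \<mu> t') (polytabloid \<nu> t'')
    = hw_poly {..<m} (inv_into (cells la) t) (inv_into (cells \<mu>) t') (inv_into (cells \<nu>) t'')"
proof
  fix z
  let ?f = "inv_into (cells la) t" and ?g = "inv_into (cells \<mu>) t'" and ?h = "inv_into (cells \<nu>) t''"
  let ?mon = "\<lambda>T T' T''. word_monomial m (T, T', T'') z"
  let ?P = "\<lambda>p. perm_tabloid (inv p) (tabloid_of la t)"
    and ?Q = "\<lambda>p. perm_tabloid (inv p) (tabloid_of \<mu> t')"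
    and ?R = "\<lambda>p. perm_tabloid (inv p) (tabloid_of \<nu> t'')"
  have row: "row_of (perm_tabloid (inv p) (tabloid_of la t)) x = fst (inv_into (cells la) t (p x))"
    if "is_tableau la t" "sum_list la = m" "p \<in> col_perms {..<m} f" "x < m" for la t p f x
  proof -
    have p: "p permutes {..<m}" using that(3) by (rule col_perms_permutes)
    then have "p x < m" using permutes_in_image[OF p, of x] that(4) by simp
    then show ?thesis
      using row_of_perm_tabloid[OF permutes_inv[OF p] tabloid_of_in[OF that(1), unfolded that(2)] that(4)]
        row_of_tabloid_of[OF that(1), of "p x"] that(2) by (simp add: permutes_inv_inv[OF p])
  qed
  have "word_poly m (tabloid3s m (length la) (length \<mu>) (length \<nu>))
      (polytabloid la t) (polytabloid \<mu> t') (polytabloid \<nu> t'') z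
    = (\<Sum>T\<in>tabloids m (length la). polytabloid la t T * (\<Sum>T'\<in>tabloids m (length \<mu>). polytabloid \<mu> t' T' *
        (\<Sum>T''\<in>tabloids m (length \<nu>). polytabloid \<nu> t'' T'' * ?mon T T' T'')))"
    using sum_triple_prod[of "\<lambda>T T' T''. polytabloid la t T * polytabloid \<mu> t' T' * polytabloid \<nu> t'' T''
        * ?mon T T' T''" "tabloids m (length la)" "tabloids m (length \<mu>)" "tabloids m (length \<nu>)"]
    by (simp add: word_poly_def tabloid3s_def sum_distrib_left mult.assoc)
  also have "\<dots> = (\<Sum>p\<in>col_perms {..<m} ?f. of_int (sign p) * (\<Sum>q\<in>col_perms {..<m} ?g. of_int (sign q) *
        (\<Sum>r\<in>col_perms {..<m} ?h. of_int (sign r) * ?mon (?P p) (?Q q) (?R r))))"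
    by (simp only: sum_polytabloid[OF t(1), unfolded m] sum_polytabloid[OF t(2), unfolded m]
        sum_polytabloid[OF t(3), unfolded m])
  also have "\<dots> = hw_poly {..<m} ?f ?g ?h z"
    unfolding hw_poly_def word_monomial_def word_def
    by (intro sum.cong[OF refl] arg_cong2[where f = "(*)"] prod.cong refl)
      (simp add: row[OF t(1) m(1)] row[OF t(2) m(2)] row[OF t(3) m(3)])
  finally show "word_poly m (tabloid3s m (length la) (length \<mu>) (length \<nu>))
      (polytabloid la t) (polytabloid \<mu> t') (polytabloid \<nu> t'') z = hw_poly {..<m} ?f ?g ?h z" .
qed

lemma hw_poly_cong:
  assumes "\<And>x. x \<in> X \<Longrightarrow> f x = f' x" "\<And>x. x \<in> X \<Longrightarrow> g x = g' x" "\<And>x. x \<in> X \<Longrightarrow> h x = h' x"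
  shows "hw_poly X f g h = hw_poly X f' g' h'"
proof
  fix z
  have C: "col_perms X f = col_perms X f'" if "\<And>x. x \<in> X \<Longrightarrow> f x = f' x" for f f'
    using that permutes_in_image[of _ X] by (auto simp: col_perms_def)
  have in_X: "p x \<in> X" if "p \<in> col_perms X f" "x \<in> X" for p f x
    using that permutes_in_image[OF col_perms_permutes] by blast
  have C1: "col_perms X f = col_perms X f'" by (rule C) (rule assms)
  have C2: "col_perms X g = col_perms X g'" by (rule C) (rule assms)
  have C3: "col_perms X h = col_perms X h'" by (rule C) (rule assms)
  show "hw_poly X f g h z = hw_poly X f' g' h' z"
    unfolding hw_poly_def C1 C2 C3
    by (intro sum.cong[OF refl] arg_cong2[where f = "(*)"] prod.cong refl)
      (simp add: assms in_X)
qed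

lemma inv_tableau_exhaust:
  assumes "bij_betw f {..<sum_list la} (diagram (row_len la))"
  obtains t where "is_tableau la t" "\<And>x. x < sum_list la \<Longrightarrow> inv_into (cells la) t x = f x"
proof -
  let ?t = "inv_into {..<sum_list la} f"
  have f: "bij_betw f {..<sum_list la} (cells la)" using assms by (simp add: cells_eq_diagram)
  have t: "is_tableau la ?t" unfolding is_tableau_def using f by (rule bij_betw_inv_into)
  have "inv_into (cells la) ?t x = f x" if "x < sum_list la" for x
  proof (rule inv_into_f_eq)
    show "inj_on ?t (cells la)" using t by (simp add: is_tableau_def bij_betw_def)
    show "f x \<in> cells la" using f that by (auto simp: bij_betw_def)
    show "?t (f x) = x" using f that by (simp add: bij_betw_def inv_into_f_f)
  qed
  then show thesis using that t by blast
qed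

lemma word_polys_eq_hw_polys:
  assumes m: "sum_list la = m" "sum_list \<mu> = m" "sum_list \<nu> = m"
  shows "{word_poly m (tabloid3s m (length la) (length \<mu>) (length \<nu>)) u v w |u v w.
      u \<in> {polytabloid la t |t. is_tableau la t} \<and> v \<in> {polytabloid \<mu> t |t. is_tableau \<mu> t} \<and>
      w \<in> {polytabloid \<nu> t |t. is_tableau \<nu> t}}
    = hw_polys {..<m} (row_len la) (row_len \<mu>) (row_len \<nu>)" (is "?L = ?R")
proof
  show "?L \<subseteq> ?R"
  proof
    fix F assume "F \<in> ?L"
    then obtain t t' t'' where t: "is_tableau la t" "is_tableau \<mu> t'" "is_tableau \<nu> t''"
      and F: "F = word_poly m (tabloid3s m (length la) (length \<mu>) (length \<nu>))
        (polytabloid la t) (polytabloid \<mu> t') (polytabloid \<nu> t'')" by blast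
    have "F = hw_poly {..<m} (inv_into (cells la) t) (inv_into (cells \<mu>) t') (inv_into (cells \<nu>) t'')"
      unfolding F by (rule word_poly_polytabloid[OF t m])
    then show "F \<in> ?R"
      unfolding hw_polys_def
      using bij_inv_tableau[OF t(1)] bij_inv_tableau[OF t(2)] bij_inv_tableau[OF t(3)]
      by (auto simp: m cells_eq_diagram)
  qed
  show "?R \<subseteq> ?L"
  proof
    fix F assume "F \<in> ?R"
    then obtain f g h where F: "F = hw_poly {..<m} f g h"
      and "bij_betw f {..<m} (diagram (row_len la))" "bij_betw g {..<m} (diagram (row_len \<mu>))"
        "bij_betw h {..<m} (diagram (row_len \<nu>))"
      unfolding hw_polys_def by blast
    then obtain t t' t'' where t: "is_tableau la t" "is_tableau \<mu> t'" "is_tableau \<nu> t''"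
      and eq: "\<And>x. x < m \<Longrightarrow> inv_into (cells la) t x = f x"
        "\<And>x. x < m \<Longrightarrow> inv_into (cells \<mu>) t' x = g x"
        "\<And>x. x < m \<Longrightarrow> inv_into (cells \<nu>) t'' x = h x"
      using inv_tableau_exhaust[of f la] inv_tableau_exhaust[of g \<mu>] inv_tableau_exhaust[of h \<nu>]
      by (metis m)
    have "F = hw_poly {..<m} (inv_into (cells la) t) (inv_into (cells \<mu>) t') (inv_into (cells \<nu>) t'')"
      unfolding F by (rule hw_poly_cong) (simp_all add: eq)
    also have "\<dots> = word_poly m (tabloid3s m (length la) (length \<mu>) (length \<nu>))
        (polytabloid la t) (polytabloid \<mu> t') (polytabloid \<nu> t'')"
      by (rule word_poly_polytabloid[OF t m, symmetric])
    finally show "F \<in> ?L" using t by blast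
  qed
qed

lemma dim_eqI:
  assumes "A \<subseteq> cfun.span B" "B \<subseteq> cfun.span A" shows "cfun.dim A = cfun.dim B"
proof -
  have "cfun.span A = cfun.span B"
    using assms cfun.span_minimal[OF _ cfun.subspace_span] by blast
  then show ?thesis by (metis cfun.dim_span)
qed

text \<open>Independence is used in one tensor factor after the other, with the remaining arguments fixed.\<close>
lemma triple_independent:
  assumes fin: "finite A" "finite B" "finite C"
    and ind: "cfun.independent A" "cfun.independent B" "cfun.independent C"
    and zero: "\<And>x y z. (\<Sum>i\<in>A \<times> B \<times> C. k i * (fst i x * fst (snd i) y * snd (snd i) z)) = 0"
    and i: "i \<in> A \<times> B \<times> C"
  shows "k i = 0"
proof -
  obtain a b c where abc: "i = (a, b, c)" "a \<in> A" "b \<in> B" "c \<in> C" using i by auto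
  have z: "(\<Sum>a\<in>A. (\<Sum>b\<in>B. (\<Sum>c\<in>C. k (a, b, c) * c z) * b y) * a x) = 0" for x y z
  proof -
    have "(\<Sum>a\<in>A. (\<Sum>b\<in>B. (\<Sum>c\<in>C. k (a, b, c) * c z) * b y) * a x)
        = (\<Sum>a\<in>A. \<Sum>b\<in>B. \<Sum>c\<in>C. k (a, b, c) * (a x * b y * c z))"
      by (simp add: sum_distrib_left mult_ac)
    also have "\<dots> = 0"
      using zero[of x y z] sum_triple_prod[of "\<lambda>a b c. k (a, b, c) * (a x * b y * c z)" A B C] by simp
    finally show ?thesis .
  qed
  have "(\<Sum>b\<in>B. (\<Sum>c\<in>C. k (a, b, c) * c z) * b y) = 0" for y z
    using fun_independent_coeff_eq_0[OF fin(1) ind(1) z abc(2)] .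
  then have "(\<Sum>c\<in>C. k (a, b, c) * c z) = 0" for z
    using fun_independent_coeff_eq_0[OF fin(2) ind(2) _ abc(3), of "\<lambda>b. \<Sum>c\<in>C. k (a, b, c) * c z"]
    by blast
  then show ?thesis
    using fun_independent_coeff_eq_0[OF fin(3) ind(3) _ abc(4), of "\<lambda>c. k (a, b, c)"] abc(1) by blast
qed

text \<open>Polytabloids have real coefficients, so the conjugate of a basis of the Specht module is again a
basis. In this way the conjugate character in the inner product of class functions is expressed
through matrix entries of the same module.\<close>
lemma specht_conj_basis:
  obtains D S where "finite D" "cfun.independent D" "cfun.span D = specht_module la"
    "\<And>s d T. s permutes {..<sum_list la} \<Longrightarrow> d \<in> D \<Longrightarrow> perm_act s d T = (\<Sum>e\<in>D. S s d e * e T)"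
    "\<And>s. cnj (irr_char la s) = (\<Sum>d\<in>D. S s d d)"
proof -
  define cj :: "(nat set list \<Rightarrow> complex) \<Rightarrow> nat set list \<Rightarrow> complex" where "cj v = (\<lambda>T. cnj (v T))" for v
  have cj_cj [simp]: "cj (cj v) = v" for v by (simp add: cj_def)
  have inj: "inj_on cj A" for A by (metis cj_cj inj_on_inverseI)
  obtain B R where B: "finite B" "cfun.independent B" "cfun.span B = specht_module la"
    and R: "\<And>s b T. s permutes {..<sum_list la} \<Longrightarrow> b \<in> B \<Longrightarrow> perm_act s b T = (\<Sum>c\<in>B. R s b c * c T)"
    and char: "\<And>s. irr_char la s = (\<Sum>b\<in>B. R s b b)"
    using specht_basis[of la] by blast
  have "cfun.independent (cj ` B)"
  proof (rule cfun.independent_if_scalars_zero)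
    fix k v assume k: "(\<Sum>d\<in>cj ` B. (\<lambda>x. k d * d x)) = 0" and v: "v \<in> cj ` B"
    have "(\<Sum>b\<in>B. cnj (k (cj b)) * b x) = 0" for x
    proof -
      have "(\<Sum>b\<in>B. k (cj b) * cj b x) = 0"
        using fun_cong[OF k, of x] by (simp add: sum_fun_apply sum.reindex[OF inj])
      then have "cnj (\<Sum>b\<in>B. k (cj b) * cj b x) = 0" by simp
      then show ?thesis by (simp add: cj_def)
    qed
    then have "cnj (k (cj b)) = 0" if "b \<in> B" for b
      using fun_independent_coeff_eq_0[OF B(1,2), of "\<lambda>b. cnj (k (cj b))"] that by blast
    then show "k v = 0" using v by auto
  qed (use B(1) in simp)
  moreover have sub: "v \<in> cfun.span (cj ` B)" if "v \<in> specht_module la" for v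
  proof -
    have "cj v \<in> cfun.span B" using cnj_specht[OF that] B(3) by (simp add: cj_def)
    then obtain k where k: "\<And>x. cj v x = (\<Sum>b\<in>B. k b * b x)"
      using fun_span_finite_expansion[OF B(1)] by blast
    have "v = (\<lambda>x. \<Sum>b\<in>B. cnj (k b) * cj b x)"
    proof
      fix x
      have "v x = cnj (cj v x)" by (simp add: cj_def)
      then show "v x = (\<Sum>b\<in>B. cnj (k b) * cj b x)" by (simp only: k) (simp add: cj_def)
    qed
    also have "\<dots> \<in> cfun.span (cj ` B)"
      by (rule fun_span_sum) (simp add: cfun.span_base)
    finally show ?thesis .
  qed
  moreover have "cj ` B \<subseteq> specht_module la"
    using cnj_specht cfun.span_superset[of B] B(3) by (auto simp: cj_def)
  then have "cfun.span (cj ` B) \<subseteq> specht_module la"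
    by (simp add: cfun.span_minimal specht_module_def)
  ultimately show thesis
  proof (intro that[of "cj ` B" "\<lambda>s d e. cnj (R s (cj d) (cj e))"])
    fix s d T assume s: "s permutes {..<sum_list la}" and "d \<in> cj ` B"
    then obtain b where b: "b \<in> B" "d = cj b" by blast
    have "perm_act s d T = cnj (perm_act s b T)" by (simp add: b(2) cj_def perm_act_def)
    also have "\<dots> = (\<Sum>c\<in>B. cnj (R s b c) * cj c T)" by (simp add: R[OF s b(1)] cj_def)
    also have "\<dots> = (\<Sum>e\<in>cj ` B. cnj (R s (cj d) (cj e)) * e T)"
      by (simp add: sum.reindex[OF inj] b(2))
    finally show "perm_act s d T = (\<Sum>e\<in>cj ` B. cnj (R s (cj d) (cj e)) * e T)" .
  next
    show "cnj (irr_char la s) = (\<Sum>d\<in>cj ` B. cnj (R s (cj d) (cj d)))" for s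
      by (simp add: sum.reindex[OF inj] char)
  qed (use B(1) in auto)
qed

lemma sum_triple_product:
  fixes f g h :: "'a \<Rightarrow> complex"
  shows "(\<Sum>a\<in>A. f a) * (\<Sum>b\<in>B. g b) * (\<Sum>c\<in>C. h c)
    = (\<Sum>i\<in>A \<times> B \<times> C. f (fst i) * g (fst (snd i)) * h (snd (snd i)))"
proof -
  have "(\<Sum>i\<in>A \<times> B \<times> C. f (fst i) * g (fst (snd i)) * h (snd (snd i)))
      = (\<Sum>a\<in>A. \<Sum>b\<in>B. \<Sum>c\<in>C. f a * g b * h c)"
    by (simp add: sum.cartesian_product case_prod_beta)
  also have "\<dots> = (\<Sum>a\<in>A. f a) * (\<Sum>b\<in>B. g b) * (\<Sum>c\<in>C. h c)"
    by (simp add: mult.assoc flip: sum_distrib_left sum_distrib_right)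
  finally show ?thesis ..
qed

text \<open>With bases of the three Specht modules (conjugated in the third factor), the matrix
\<open>p\<close> of the averaging operator on the tensor product has the Kronecker coefficient
as its trace. The polynomials \<open>F\<close> of the basis tensors are fixed by
\<open>p\<close> because the polynomial of a tensor is invariant under permutations, and they
satisfy no further relations because a tensor with zero polynomial has zero orbit sums.\<close>
theorem kronecker_eq_dim_hw_polys:
  assumes m: "sum_list la = m" "sum_list \<mu> = m" "sum_list \<nu> = m"
  shows "kronecker la \<mu> \<nu> = of_nat (cfun.dim (hw_polys {..<m} (row_len la) (row_len \<mu>) (row_len \<nu>)))"
proof -
  obtain B1 R1 where B1: "finite B1" "cfun.independent B1" "cfun.span B1 = specht_module la"
    and R1: "\<And>s b T. s permutes {..<sum_list la} \<Longrightarrow> b \<in> B1 \<Longrightarrow> perm_act s b T = (\<Sum>c\<in>B1. R1 s b c * c T)"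
    and char1: "\<And>s. irr_char la s = (\<Sum>b\<in>B1. R1 s b b)"
    using specht_basis[of la] by blast
  obtain B2 R2 where B2: "finite B2" "cfun.independent B2" "cfun.span B2 = specht_module \<mu>"
    and R2: "\<And>s b T. s permutes {..<sum_list \<mu>} \<Longrightarrow> b \<in> B2 \<Longrightarrow> perm_act s b T = (\<Sum>c\<in>B2. R2 s b c * c T)"
    and char2: "\<And>s. irr_char \<mu> s = (\<Sum>b\<in>B2. R2 s b b)"
    using specht_basis[of \<mu>] by blast
  obtain B3 R3 where B3: "finite B3" "cfun.independent B3" "cfun.span B3 = specht_module \<nu>"
    and R3: "\<And>s b T. s permutes {..<sum_list \<nu>} \<Longrightarrow> b \<in> B3 \<Longrightarrow> perm_act s b T = (\<Sum>c\<in>B3. R3 s b c * c T)"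
    and char3: "\<And>s. cnj (irr_char \<nu> s) = (\<Sum>b\<in>B3. R3 s b b)"
    using specht_conj_basis[of \<nu>] by blast
  define I where "I = B1 \<times> B2 \<times> B3"
  define TT where "TT = tabloid3s m (length la) (length \<mu>) (length \<nu>)"
  define S where "S = {s. s permutes {..<m}}"
  define q where "q s i j = R1 s (fst i) (fst j) * R2 s (fst (snd i)) (fst (snd j)) * R3 s (snd (snd i)) (snd (snd j))" for s i j
  define p where "p i j = (\<Sum>s\<in>S. q s i j) / fact m" for i j
  define F where "F i = word_poly m TT (fst i) (fst (snd i)) (snd (snd i))" for i
  have finI: "finite I" using B1 B2 B3 by (simp add: I_def)
  have cardS: "of_nat (card S) = (fact m :: complex)"
    unfolding S_def by (subst card_permutations) auto
  have act: "perm_act s (fst i) x * perm_act s (fst (snd i)) y * perm_act s (snd (snd i)) z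
      = (\<Sum>j\<in>I. q s i j * (fst j x * fst (snd j) y * snd (snd j) z))" if "s \<in> S" "i \<in> I" for s i x y z
  proof -
    have "s permutes {..<m}" using that by (simp add: S_def)
    moreover have "fst i \<in> B1" "fst (snd i) \<in> B2" "snd (snd i) \<in> B3" using that by (auto simp: I_def)
    ultimately have "perm_act s (fst i) x * perm_act s (fst (snd i)) y * perm_act s (snd (snd i)) z
      = (\<Sum>c\<in>B1. R1 s (fst i) c * c x) * (\<Sum>c\<in>B2. R2 s (fst (snd i)) c * c y) * (\<Sum>c\<in>B3. R3 s (snd (snd i)) c * c z)"
      using R1 R2 R3 m by simp
    also have "\<dots> = (\<Sum>j\<in>I. q s i j * (fst j x * fst (snd j) y * snd (snd j) z))"
      unfolding sum_triple_product I_def q_def by (simp add: mult_ac)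
    finally show ?thesis .
  qed
  have fix_F: "F i z = (\<Sum>j\<in>I. p i j * F j z)" if i: "i \<in> I" for i z
  proof -
    have "F i z = (\<Sum>j\<in>I. q s i j * F j z)" if "s \<in> S" for s
    proof -
      have "F i z = word_poly m TT (perm_act s (fst i)) (perm_act s (fst (snd i))) (perm_act s (snd (snd i))) z"
        using word_poly_perm that by (simp add: F_def TT_def S_def)
      also have "\<dots> = (\<Sum>T\<in>TT. \<Sum>j\<in>I. q s i j * (fst j (fst T) * fst (snd j) (fst (snd T)) * snd (snd j) (snd (snd T)) * word_monomial m T z))"
        unfolding word_poly_def act[OF that i] by (simp add: sum_distrib_right mult.assoc)
      also have "\<dots> = (\<Sum>j\<in>I. q s i j * F j z)"
        by (subst sum.swap) (simp add: F_def word_poly_def sum_distrib_left)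
      finally show ?thesis .
    qed
    then have "(\<Sum>s\<in>S. F i z) = (\<Sum>s\<in>S. \<Sum>j\<in>I. q s i j * F j z)" by (rule sum.cong[OF refl])
    also have "\<dots> = (\<Sum>j\<in>I. (\<Sum>s\<in>S. q s i j) * F j z)"
      by (subst sum.swap) (simp add: sum_distrib_right)
    finally have "fact m * F i z = (\<Sum>j\<in>I. (\<Sum>s\<in>S. q s i j) * F j z)"
      by (simp add: cardS)
    then have "F i z = (\<Sum>j\<in>I. (\<Sum>s\<in>S. q s i j) * F j z) / fact m"
      by (simp add: field_simps)
    then show "F i z = (\<Sum>j\<in>I. p i j * F j z)"
      unfolding p_def by (subst (asm) sum_divide_distrib) simp
  qed
  have "(\<Sum>i\<in>I. p i i) = of_nat (cfun.dim (F ` I))"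
  proof (rule trace_eq_dim_span[where p = p and F = F, OF finI fix_F])
    fix k j assume zero: "\<And>z. (\<Sum>i\<in>I. k i * F i z) = 0" and j: "j \<in> I"
    \<comment> \<open>The tensor with coordinates \<open>k\<close>; the relation \<open>zero\<close> says that
      its polynomial vanishes.\<close>
    define U where "U T = (\<Sum>i\<in>I. k i * (fst i (fst T) * fst (snd i) (fst (snd T)) * snd (snd i) (snd (snd T))))" for T
    have "(\<Sum>T\<in>TT. U T * word_monomial m T z) = 0" for z
    proof -
      have "(\<Sum>T\<in>TT. U T * word_monomial m T z) = (\<Sum>i\<in>I. k i * F i z)"
        unfolding U_def F_def word_poly_def
        by (simp add: sum_distrib_right sum_distrib_left mult.assoc) (rule sum.swap)
      then show ?thesis using zero by simp
    qed
    then have orbit: "(\<Sum>s\<in>S. U (perm_tabloid3 (inv s) T)) = 0" if "T \<in> TT" for T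
      unfolding S_def using orbit_sum_eq_0 that unfolding TT_def by blast
    show "(\<Sum>i\<in>I. k i * p i j) = 0"
    proof (rule triple_independent[OF B1(1) B2(1) B3(1) B1(2) B2(2) B3(2)])
      fix x y z
      show "(\<Sum>j\<in>B1 \<times> B2 \<times> B3. (\<Sum>i\<in>I. k i * p i j) * (fst j x * fst (snd j) y * snd (snd j) z)) = 0"
      proof (cases "(x, y, z) \<in> TT")
        case True
        have "U (perm_tabloid3 (inv s) (x, y, z))
            = (\<Sum>j\<in>I. (\<Sum>i\<in>I. k i * q s i j) * (fst j x * fst (snd j) y * snd (snd j) z))" if "s \<in> S" for s
        proof -
          have "U (perm_tabloid3 (inv s) (x, y, z))
            = (\<Sum>i\<in>I. k i * (perm_act s (fst i) x * perm_act s (fst (snd i)) y * perm_act s (snd (snd i)) z))"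
            by (simp add: U_def perm_tabloid3_def perm_act_def)
          also have "\<dots> = (\<Sum>i\<in>I. \<Sum>j\<in>I. k i * q s i j * (fst j x * fst (snd j) y * snd (snd j) z))"
            by (rule sum.cong[OF refl], subst act[OF that], assumption)
              (simp add: sum_distrib_left mult.assoc)
          also have "\<dots> = (\<Sum>j\<in>I. (\<Sum>i\<in>I. k i * q s i j) * (fst j x * fst (snd j) y * snd (snd j) z))"
            by (subst sum.swap) (simp add: sum_distrib_right)
          finally show ?thesis .
        qed
        then have "(\<Sum>s\<in>S. \<Sum>j\<in>I. (\<Sum>i\<in>I. k i * q s i j) * (fst j x * fst (snd j) y * snd (snd j) z)) = 0"
          using orbit[OF True] by simp
        moreover have "(\<Sum>s\<in>S. \<Sum>j\<in>I. (\<Sum>i\<in>I. k i * q s i j) * (fst j x * fst (snd j) y * snd (snd j) z))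
            = (\<Sum>j\<in>I. (\<Sum>s\<in>S. \<Sum>i\<in>I. k i * q s i j) * (fst j x * fst (snd j) y * snd (snd j) z))"
          by (subst sum.swap) (simp add: sum_distrib_right)
        ultimately have zero_j: "(\<Sum>j\<in>I. (\<Sum>s\<in>S. \<Sum>i\<in>I. k i * q s i j) * (fst j x * fst (snd j) y * snd (snd j) z)) = 0"
          by simp
        have coeff: "(\<Sum>i\<in>I. k i * p i j) = (\<Sum>s\<in>S. \<Sum>i\<in>I. k i * q s i j) / fact m" for j
          by (subst sum.swap) (simp add: p_def sum_distrib_left sum_divide_distrib)
        have "(\<Sum>j\<in>I. (\<Sum>i\<in>I. k i * p i j) * (fst j x * fst (snd j) y * snd (snd j) z))
            = (\<Sum>j\<in>I. (\<Sum>s\<in>S. \<Sum>i\<in>I. k i * q s i j) * (fst j x * fst (snd j) y * snd (snd j) z)) / fact m"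
          unfolding coeff by (subst sum_divide_distrib) simp
        then show ?thesis unfolding zero_j by (simp only: I_def[symmetric] div_0)
      next
        case False
        have "fst j x * fst (snd j) y * snd (snd j) z = 0" if "j \<in> B1 \<times> B2 \<times> B3" for j
        proof -
          have "fst j \<in> specht_module la" "fst (snd j) \<in> specht_module \<mu>" "snd (snd j) \<in> specht_module \<nu>"
            using that cfun.span_superset[of B1] cfun.span_superset[of B2] cfun.span_superset[of B3] B1(3) B2(3) B3(3)
            by auto
          then show ?thesis
            using False specht_outside[of "fst j" la x] specht_outside[of "fst (snd j)" \<mu> y]
              specht_outside[of "snd (snd j)" \<nu> z] m by (auto simp: TT_def tabloid3s_def)
        qed
        then show ?thesis by (intro sum.neutral ballI) (simp only: mult_zero_right)
      qed
    qed (use j in \<open>simp add: I_def\<close>)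
  qed
  moreover have "kronecker la \<mu> \<nu> = (\<Sum>i\<in>I. p i i)"
  proof -
    have "irr_char la s * irr_char \<mu> s * cnj (irr_char \<nu> s) = (\<Sum>i\<in>I. q s i i)" for s
      unfolding char1 char2 char3 by (simp add: sum_triple_product I_def q_def)
    then have "kronecker la \<mu> \<nu> = (\<Sum>s\<in>S. \<Sum>i\<in>I. q s i i) / fact m"
      by (simp add: kronecker_def class_inner_def m S_def)
    also have "(\<Sum>s\<in>S. \<Sum>i\<in>I. q s i i) = (\<Sum>i\<in>I. \<Sum>s\<in>S. q s i i)" by (rule sum.swap)
    finally show ?thesis by (simp add: p_def sum_divide_distrib)
  qed
  moreover have "cfun.dim (F ` I) = cfun.dim (hw_polys {..<m} (row_len la) (row_len \<mu>) (row_len \<nu>))"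
  proof (rule dim_eqI)
    have FI: "F ` I = {word_poly m TT a b c |a b c. a \<in> B1 \<and> b \<in> B2 \<and> c \<in> B3}"
      by (force simp: F_def I_def image_def)
    show "F ` I \<subseteq> cfun.span (hw_polys {..<m} (row_len la) (row_len \<mu>) (row_len \<nu>))"
    proof
      fix G assume "G \<in> F ` I"
      then obtain u v w where "u \<in> B1" "v \<in> B2" "w \<in> B3" and G: "G = word_poly m TT u v w"
        unfolding FI by blast
      then have "u \<in> specht_module la" "v \<in> specht_module \<mu>" "w \<in> specht_module \<nu>"
        unfolding B1(3)[symmetric] B2(3)[symmetric] B3(3)[symmetric] by (simp_all add: cfun.span_base)
      then show "G \<in> cfun.span (hw_polys {..<m} (row_len la) (row_len \<mu>) (row_len \<nu>))"
        unfolding G word_polys_eq_hw_polys[OF m, symmetric] TT_def[symmetric] specht_module_def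
        by (rule word_poly_in_span)
    qed
    show "hw_polys {..<m} (row_len la) (row_len \<mu>) (row_len \<nu>) \<subseteq> cfun.span (F ` I)"
    proof
      fix G assume "G \<in> hw_polys {..<m} (row_len la) (row_len \<mu>) (row_len \<nu>)"
      then obtain u v w where "u \<in> {polytabloid la t |t. is_tableau la t}"
          "v \<in> {polytabloid \<mu> t |t. is_tableau \<mu> t}" "w \<in> {polytabloid \<nu> t |t. is_tableau \<nu> t}"
        and G: "G = word_poly m TT u v w"
        unfolding word_polys_eq_hw_polys[OF m, symmetric] TT_def[symmetric] by blast
      from this(1-3)[THEN cfun.span_base]
      have "u \<in> cfun.span B1" "v \<in> cfun.span B2" "w \<in> cfun.span B3"
        unfolding B1(3) B2(3) B3(3) specht_module_def .
      then show "G \<in> cfun.span (F ` I)"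
        unfolding G FI by (rule word_poly_in_span)
    qed
  qed
  ultimately show ?thesis by simp
qed

section \<open>Column lengths and straightening\<close>

lemma down_closed_eq_lessThan:
  fixes A :: "nat set"
  assumes "finite A" "\<And>i j. j \<in> A \<Longrightarrow> i < j \<Longrightarrow> i \<in> A"
  shows "A = {..<card A}"
proof -
  have "A = {..<n}" if "n = (LEAST n. n \<notin> A)" for n
  proof -
    obtain k where "k \<notin> A" using ex_new_if_finite[OF infinite_UNIV_nat assms(1)] by blast
    then have n: "n \<notin> A" unfolding that by (rule LeastI)
    have "i < n" if "i \<in> A" for i using assms(2)[OF that] n that by (metis linorder_neqE_nat)
    moreover have "i \<in> A" if "i < n" for i using not_less_Least that \<open>n = _\<close> by blast
    ultimately show ?thesis by blast
  qed
  then show ?thesis by (metis card_lessThan)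
qed

text \<open>Sorting: the element that minimises \<open>h\<close> is put last.\<close>
lemma ex_decreasing_enumeration:
  fixes h :: "'a \<Rightarrow> nat"
  assumes "finite D"
  shows "\<exists>g. bij_betw g D {..<card D} \<and> (\<forall>d\<in>D. \<forall>e\<in>D. h e < h d \<longrightarrow> g d < g e)"
  using assms
proof (induction "card D" arbitrary: D)
  case 0
  then show ?case by (auto simp: bij_betw_def)
next
  case (Suc n)
  then have "D \<noteq> {}" by auto
  define a where "a = arg_min_on h D"
  have a: "a \<in> D" "\<And>d. d \<in> D \<Longrightarrow> h a \<le> h d"
    using arg_min_if_finite[OF Suc.prems \<open>D \<noteq> {}\<close>, of h] by (auto simp: a_def not_less)
  have "n = card (D - {a})" using Suc.hyps(2) a(1) Suc.prems by simp
  from Suc.hyps(1)[OF this] Suc.prems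
  obtain g where g: "bij_betw g (D - {a}) {..<card (D - {a})}"
    "\<And>d e. d \<in> D - {a} \<Longrightarrow> e \<in> D - {a} \<Longrightarrow> h e < h d \<Longrightarrow> g d < g e" by blast
  have n: "card (D - {a}) = n" "card D = Suc n" using \<open>n = card (D - {a})\<close> Suc.hyps(2) by auto
  define g' where "g' = g(a := n)"
  have "bij_betw g' (D - {a}) {..<n}"
    using g(1) n(1) bij_betw_cong[of "D - {a}" g' g "{..<n}"] by (auto simp: g'_def)
  moreover have "g' a = n" by (simp add: g'_def)
  ultimately have "bij_betw g' ((D - {a}) \<union> {a}) ({..<n} \<union> {n})"
    using notIn_Un_bij_betw3[of a "D - {a}" g' "{..<n}"] by simp
  moreover have "(D - {a}) \<union> {a} = D" "{..<n} \<union> {n} = {..<card D}"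
    using a(1) n by auto
  ultimately have "bij_betw g' D {..<card D}" by simp
  moreover have "g' d < g' e" if "d \<in> D" "e \<in> D" "h e < h d" for d e
  proof -
    have "d \<noteq> a" using a(2) that by (metis not_less)
    then have "g d < n" using g(1) that n by (auto simp: bij_betw_def)
    then show ?thesis using g(2) that \<open>d \<noteq> a\<close> by (auto simp: g'_def)
  qed
  ultimately show ?case by blast
qed

text \<open>A tableau with arbitrary column labels: the rows have the prescribed lengths, and every column
occupies an initial segment of the rows, but the columns need not be sorted by length nor be
numbered consecutively. This form is stable under taking the union of two fillings.\<close>
definition filling :: "(nat \<Rightarrow> nat) \<Rightarrow> nat set \<Rightarrow> (nat \<Rightarrow> nat \<times> nat) \<Rightarrow> bool" where
  "filling s X f \<longleftrightarrow> inj_on f X \<and> (\<forall>i. card {x\<in>X. fst (f x) = i} = s i) \<and>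
     (\<forall>x\<in>X. \<forall>i<fst (f x). \<exists>y\<in>X. f y = (i, snd (f x)))"

text \<open>Numbering the columns by decreasing length turns a filling into a bijection with the cells of
the diagram: the columns that reach row \<open>i\<close> then come first, and there are
\<open>s i\<close> of them.\<close>
lemma filling_straighten:
  assumes fin: "finite X" and f: "filling s X f"
  obtains g where "inj_on g (snd ` f ` X)"
    "bij_betw (\<lambda>x. (fst (f x), g (snd (f x)))) X (diagram s)"
proof -
  let ?D = "snd ` f ` X"
  define h where "h d = card {i. (i, d) \<in> f ` X}" for d
  have col: "{i. (i, d) \<in> f ` X} = {..<h d}" for d
    unfolding h_def
  proof (rule down_closed_eq_lessThan)
    have "{i. (i, d) \<in> f ` X} \<subseteq> fst ` f ` X"
      using imageI[of "(_, d)" "f ` X" fst] by auto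
    then show "finite {i. (i, d) \<in> f ` X}" using fin finite_subset by blast
    fix i j assume "j \<in> {i. (i, d) \<in> f ` X}" "i < j"
    then obtain x where x: "x \<in> X" "f x = (j, d)" by auto
    then obtain y where "y \<in> X" "f y = (i, d)"
      using f \<open>i < j\<close> unfolding filling_def by (metis fst_conv snd_conv)
    then show "i \<in> {i. (i, d) \<in> f ` X}" by force
  qed
  have finD: "finite ?D" using fin by simp
  obtain g where g: "bij_betw g ?D {..<card ?D}"
    and g_less: "\<forall>d\<in>?D. \<forall>e\<in>?D. h e < h d \<longrightarrow> g d < g e"
    using ex_decreasing_enumeration[OF finD, of h] by (elim exE conjE)
  have injg: "inj_on g ?D" using g by (simp add: bij_betw_def)
  have row: "g ` {d. (i, d) \<in> f ` X} = {..<s i}" for i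
  proof -
    have eq: "{d. (i, d) \<in> f ` X} = (\<lambda>x. snd (f x)) ` {x\<in>X. fst (f x) = i}"
    proof
      show "{d. (i, d) \<in> f ` X} \<subseteq> (\<lambda>x. snd (f x)) ` {x\<in>X. fst (f x) = i}"
      proof
        fix d assume "d \<in> {d. (i, d) \<in> f ` X}"
        then obtain x where "x \<in> X" "f x = (i, d)" by auto
        then show "d \<in> (\<lambda>x. snd (f x)) ` {x\<in>X. fst (f x) = i}"
          by (intro image_eqI[of _ _ x]) auto
      qed
    qed (use imageI[of _ X f] in auto)
    have "inj_on (\<lambda>x. snd (f x)) {x\<in>X. fst (f x) = i}"
      using f unfolding filling_def inj_on_def by (metis (mono_tags, lifting) mem_Collect_eq prod_eqI)
    then have "card {d. (i, d) \<in> f ` X} = s i"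
      using f unfolding eq filling_def by (simp add: card_image)
    moreover have sub: "{d. (i, d) \<in> f ` X} \<subseteq> ?D"
      using imageI[of "(i, _)" "f ` X" snd] by auto
    then have "card (g ` {d. (i, d) \<in> f ` X}) = card {d. (i, d) \<in> f ` X}"
      using injg by (intro card_image) (rule inj_on_subset)
    moreover have "g ` {d. (i, d) \<in> f ` X} = {..<card (g ` {d. (i, d) \<in> f ` X})}"
    proof (rule down_closed_eq_lessThan)
      show "finite (g ` {d. (i, d) \<in> f ` X})" using sub finD finite_subset by blast
      fix n k assume "k \<in> g ` {d. (i, d) \<in> f ` X}" "n < k"
      then obtain d where d: "(i, d) \<in> f ` X" "n < g d" by blast
      then have dD: "d \<in> ?D" using sub by blast
      then have "g d \<in> {..<card ?D}" using g bij_betwE by blast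
      then have "n \<in> {..<card ?D}" using d(2) by simp
      then obtain e where e: "e \<in> ?D" "n = g e"
        using bij_betw_imp_surj_on[OF g] by blast
      have "h d \<le> h e" using g_less[rule_format, OF dD e(1)] d(2) e(2) by (metis not_less less_asym)
      moreover have "i < h d" using d(1) col by blast
      ultimately have "i \<in> {..<h e}" by simp
      then show "n \<in> g ` {d. (i, d) \<in> f ` X}" using col e(2) by blast
    qed
    ultimately show ?thesis by simp
  qed
  have "bij_betw (\<lambda>x. (fst (f x), g (snd (f x)))) X (diagram s)"
    unfolding bij_betw_def
  proof
    have "inj_on f X" using f by (simp add: filling_def)
    then show "inj_on (\<lambda>x. (fst (f x), g (snd (f x)))) X"
    proof (intro inj_onI)
      fix x y assume xy: "x \<in> X" "y \<in> X" "(fst (f x), g (snd (f x))) = (fst (f y), g (snd (f y)))"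
      have "snd (f x) = snd (f y)" by (rule inj_onD[OF injg]) (use xy in auto)
      then have "f x = f y" using xy(3) by (simp add: prod_eq_iff)
      then show "x = y" by (rule inj_onD[OF \<open>inj_on f X\<close>]) (use xy in auto)
    qed
    have "(i, j) \<in> (\<lambda>x. (fst (f x), g (snd (f x)))) ` X \<longleftrightarrow> j \<in> g ` {d. (i, d) \<in> f ` X}" for i j
    proof
      assume "(i, j) \<in> (\<lambda>x. (fst (f x), g (snd (f x)))) ` X"
      then obtain x where x: "x \<in> X" "i = fst (f x)" "j = g (snd (f x))" by auto
      then have "(i, snd (f x)) \<in> f ` X" by simp
      then show "j \<in> g ` {d. (i, d) \<in> f ` X}" using x(3) by blast
    next
      assume "j \<in> g ` {d. (i, d) \<in> f ` X}"
      then obtain d where "(i, d) \<in> f ` X" "j = g d" by blast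
      moreover from this obtain x where "x \<in> X" "f x = (i, d)" by (metis imageE)
      ultimately show "(i, j) \<in> (\<lambda>x. (fst (f x), g (snd (f x)))) ` X"
        by (intro image_eqI[of _ _ x]) auto
    qed
    then show "(\<lambda>x. (fst (f x), g (snd (f x)))) ` X = diagram s"
      unfolding row by (auto simp: diagram_def)
  qed
  then show thesis using that injg by blast
qed

lemma filling_of_diagram:
  assumes "\<And>i j. i \<le> j \<Longrightarrow> s j \<le> s i" and f: "bij_betw f X (diagram s)"
  shows "filling s X f"
proof -
  have inj: "inj_on f X" and img: "f ` X = diagram s" using f by (auto simp: bij_betw_def)
  have "card {x\<in>X. fst (f x) = i} = s i" for i
  proof -
    have "bij_betw f {x\<in>X. fst (f x) = i} ({i} \<times> {..<s i})"
      unfolding bij_betw_def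
    proof
      show "inj_on f {x\<in>X. fst (f x) = i}" using inj by (rule inj_on_subset) auto
      have "(k, j) \<in> f ` {x\<in>X. fst (f x) = i} \<longleftrightarrow> k = i \<and> (k, j) \<in> f ` X" for k j
        by (auto simp: image_iff) (metis fst_conv)+
      then have "kj \<in> f ` {x\<in>X. fst (f x) = i} \<longleftrightarrow> kj \<in> {i} \<times> {..<s i}" for kj
        unfolding img by (cases kj) (simp add: diagram_def cong: conj_cong)
      then show "f ` {x\<in>X. fst (f x) = i} = {i} \<times> {..<s i}" by blast
    qed
    from bij_betw_same_card[OF this] show ?thesis by simp
  qed
  moreover have "\<exists>y\<in>X. f y = (i, snd (f x))" if "x \<in> X" "i < fst (f x)" for x i
  proof -
    have "snd (f x) < s (fst (f x))" using img that(1) by (auto simp: diagram_def)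
    then have "(i, snd (f x)) \<in> diagram s"
      using assms(1)[of i "fst (f x)"] that(2) by (auto simp: diagram_def)
    then show ?thesis using img by (metis imageE)
  qed
  ultimately show ?thesis using inj by (simp add: filling_def)
qed

lemma col_perms_relabel:
  assumes "inj_on g (snd ` f ` X)"
  shows "col_perms X (\<lambda>x. (fst (f x), g (snd (f x)))) = col_perms X f"
proof -
  have "g (snd (f (p x))) = g (snd (f x)) \<longleftrightarrow> snd (f (p x)) = snd (f x)" if "p permutes X" "x \<in> X" for p x
    using assms that permutes_in_image[OF that(1)] by (auto simp: inj_on_eq_iff)
  then show ?thesis by (auto simp: col_perms_def)
qed

lemma hw_poly_filling_in:
  assumes "finite X" "filling s X f" "filling t X g" "filling u X h"
  shows "hw_poly X f g h \<in> hw_polys X s t u"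
proof -
  obtain c where c: "inj_on c (snd ` f ` X)" "bij_betw (\<lambda>x. (fst (f x), c (snd (f x)))) X (diagram s)"
    using filling_straighten[OF assms(1,2)] .
  obtain d where d: "inj_on d (snd ` g ` X)" "bij_betw (\<lambda>x. (fst (g x), d (snd (g x)))) X (diagram t)"
    using filling_straighten[OF assms(1,3)] .
  obtain e where e: "inj_on e (snd ` h ` X)" "bij_betw (\<lambda>x. (fst (h x), e (snd (h x)))) X (diagram u)"
    using filling_straighten[OF assms(1,4)] .
  have "hw_poly X f g h = hw_poly X (\<lambda>x. (fst (f x), c (snd (f x)))) (\<lambda>x. (fst (g x), d (snd (g x))))
      (\<lambda>x. (fst (h x), e (snd (h x))))"
    by (rule ext) (simp add: hw_poly_def col_perms_relabel[OF c(1)] col_perms_relabel[OF d(1)]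
        col_perms_relabel[OF e(1)])
  then show ?thesis using c(2) d(2) e(2) unfolding hw_polys_def by blast
qed

lemma finite_hw_polys:
  assumes "finite X" shows "finite (hw_polys X s t u)"
proof (cases "finite (diagram s) \<and> finite (diagram t) \<and> finite (diagram u)")
  case True
  have "hw_polys X s t u \<subseteq> (\<lambda>(f, g, h). hw_poly X f g h) `
      ((X \<rightarrow>\<^sub>E diagram s) \<times> (X \<rightarrow>\<^sub>E diagram t) \<times> (X \<rightarrow>\<^sub>E diagram u))"
  proof
    fix F assume "F \<in> hw_polys X s t u"
    then obtain f g h where F: "F = hw_poly X f g h" and b: "bij_betw f X (diagram s)"
      "bij_betw g X (diagram t)" "bij_betw h X (diagram u)"
      unfolding hw_polys_def by blast
    have "F = hw_poly X (restrict f X) (restrict g X) (restrict h X)"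
      unfolding F by (rule hw_poly_cong) auto
    moreover have "restrict f X \<in> X \<rightarrow>\<^sub>E diagram s" "restrict g X \<in> X \<rightarrow>\<^sub>E diagram t"
      "restrict h X \<in> X \<rightarrow>\<^sub>E diagram u"
      using b by (auto dest: bij_betwE)
    ultimately show "F \<in> (\<lambda>(f, g, h). hw_poly X f g h) `
        ((X \<rightarrow>\<^sub>E diagram s) \<times> (X \<rightarrow>\<^sub>E diagram t) \<times> (X \<rightarrow>\<^sub>E diagram u))"
      by (intro image_eqI[of _ _ "(restrict f X, restrict g X, restrict h X)"]) auto
  qed
  then show ?thesis
    by (rule finite_subset) (use True assms in \<open>simp add: finite_PiE\<close>)
next
  case False
  then have "hw_polys X s t u = {}"
    using assms bij_betw_finite unfolding hw_polys_def by blast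
  then show ?thesis by simp
qed

lemma poly_on_lines_hw_poly: "poly_on_lines (hw_poly X f g h)"
  unfolding hw_poly_def
  by (intro poly_on_lines_sum poly_on_lines_mult poly_on_lines_const poly_on_lines_prod
      poly_on_lines_coordinate)

lemma poly_on_lines_span_hw_polys:
  "F \<in> cfun.span (hw_polys X s t u) \<Longrightarrow> poly_on_lines F"
  by (rule poly_on_lines_span) (auto simp: hw_polys_def poly_on_lines_hw_poly)

section \<open>Products of polynomials of fillings\<close>

text \<open>Even and odd labels keep the columns of the two fillings apart.\<close>
definition join :: "nat set \<Rightarrow> (nat \<Rightarrow> nat \<times> nat) \<Rightarrow> (nat \<Rightarrow> nat \<times> nat) \<Rightarrow> nat \<Rightarrow> nat \<times> nat" where
  "join X f g x = (if x \<in> X then (fst (f x), 2 * snd (f x)) else (fst (g x), 2 * snd (g x) + 1))"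

lemma double_ne_Suc_double: "2 * (m::nat) \<noteq> Suc (2 * n)"
  by presburger

lemma filling_join:
  assumes fin: "finite X" "finite Y" and disj: "X \<inter> Y = {}"
    and f: "filling s X f" and g: "filling t Y g"
  shows "filling (\<lambda>i. s i + t i) (X \<union> Y) (join X f g)"
proof -
  have Y: "x \<notin> X" if "x \<in> Y" for x using disj that by blast
  have "inj_on (join X f g) (X \<union> Y)"
  proof (rule inj_onI)
    fix x y assume "x \<in> X \<union> Y" "y \<in> X \<union> Y" "join X f g x = join X f g y"
    then show "x = y"
      using f g Y unfolding filling_def inj_on_def join_def
      by (auto split: if_splits simp: prod_eq_iff double_ne_Suc_double double_ne_Suc_double[symmetric])
  qed
  moreover have "card {x\<in>X \<union> Y. fst (join X f g x) = i} = s i + t i" for i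
  proof -
    have "{x\<in>X \<union> Y. fst (join X f g x) = i} = {x\<in>X. fst (f x) = i} \<union> {x\<in>Y. fst (g x) = i}"
      using Y by (auto simp: join_def split: if_splits)
    moreover have "card ({x\<in>X. fst (f x) = i} \<union> {x\<in>Y. fst (g x) = i})
        = card {x\<in>X. fst (f x) = i} + card {x\<in>Y. fst (g x) = i}"
      using fin disj by (intro card_Un_disjoint) auto
    ultimately show ?thesis using f g by (simp add: filling_def)
  qed
  moreover have "\<exists>y\<in>X \<union> Y. join X f g y = (i, snd (join X f g x))"
    if x: "x \<in> X \<union> Y" "i < fst (join X f g x)" for x i
  proof (cases "x \<in> X")
    case True
    then have "i < fst (f x)" using x(2) by (simp add: join_def)
    then obtain y where "y \<in> X" "f y = (i, snd (f x))"
      using f True unfolding filling_def by blast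
    then show ?thesis using True by (intro bexI[of _ y]) (auto simp: join_def)
  next
    case False
    then have "x \<in> Y" "i < fst (g x)" using x by (simp_all add: join_def)
    then obtain y where "y \<in> Y" "g y = (i, snd (g x))"
      using g unfolding filling_def by blast
    then show ?thesis using False Y by (intro bexI[of _ y]) (auto simp: join_def)
  qed
  ultimately show ?thesis unfolding filling_def by blast
qed

lemma restrict_permutes:
  assumes "finite X" "inj p" "p ` X \<subseteq> X"
  shows "(\<lambda>x. if x \<in> X then p x else x) permutes X"
proof (rule bij_imp_permutes)
  have "p ` X = X" using assms by (intro endo_inj_surj) (auto intro: inj_on_subset)
  then have "bij_betw p X X" using assms(2) by (auto simp: bij_betw_def intro: inj_on_subset)
  then show "bij_betw (\<lambda>x. if x \<in> X then p x else x) X X" by (simp cong: bij_betw_cong)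
qed auto

lemma join_col_perm_image:
  assumes disj: "X \<inter> Y = {}" and r: "r \<in> col_perms (X \<union> Y) (join X f g)"
  shows "r ` X \<subseteq> X" "r ` Y \<subseteq> Y"
proof -
  have perm: "r permutes X \<union> Y" using r by (simp add: col_perms_def)
  have eq: "snd (join X f g (r x)) = snd (join X f g x)" if "x \<in> X \<union> Y" for x
    using r that by (simp add: col_perms_def)
  have "r x \<in> X \<longleftrightarrow> x \<in> X" if "x \<in> X \<union> Y" for x
    using eq[OF that] unfolding join_def
    by (auto split: if_splits simp: double_ne_Suc_double double_ne_Suc_double[symmetric])
  moreover have "r x \<in> X \<union> Y" if "x \<in> X \<union> Y" for x using that permutes_in_image[OF perm] by blast
  ultimately show "r ` X \<subseteq> X" "r ` Y \<subseteq> Y" using disj by blast+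
qed

text \<open>The column group of the union of two fillings is the direct product of the two column groups.\<close>
lemma sum_col_perms_join:
  fixes F :: "(nat \<Rightarrow> nat) \<Rightarrow> complex"
  assumes fin: "finite X" "finite Y" and disj: "X \<inter> Y = {}"
    and F: "\<And>p q. p \<in> col_perms X f \<Longrightarrow> q \<in> col_perms Y g \<Longrightarrow> F (p \<circ> q) = A p * B q"
  shows "(\<Sum>r\<in>col_perms (X \<union> Y) (join X f g). of_int (sign r) * F r)
    = (\<Sum>p\<in>col_perms X f. of_int (sign p) * A p) * (\<Sum>q\<in>col_perms Y g. of_int (sign q) * B q)"
proof -
  define rst where "rst Z r = (\<lambda>x. if x \<in> Z then r x else x)" for Z and r :: "nat \<Rightarrow> nat"
  have Y: "x \<notin> X" if "x \<in> Y" for x using disj that by blast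
  have "(\<Sum>r\<in>col_perms (X \<union> Y) (join X f g). of_int (sign r) * F r)
      = (\<Sum>(p, q)\<in>col_perms X f \<times> col_perms Y g. of_int (sign (p \<circ> q)) * F (p \<circ> q))"
  proof (rule sum.reindex_bij_witness[of _ "\<lambda>(p, q). p \<circ> q" "\<lambda>r. (rst X r, rst Y r)"])
    fix r assume r: "r \<in> col_perms (X \<union> Y) (join X f g)"
    have perm: "r permutes X \<union> Y" using r by (simp add: col_perms_def)
    note img = join_col_perm_image[OF disj r]
    show eq: "(case (rst X r, rst Y r) of (p, q) \<Rightarrow> p \<circ> q) = r"
      using img Y permutes_not_in[OF perm] by (auto simp: rst_def fun_eq_iff)
    have "rst X r permutes X" "rst Y r permutes Y"
      unfolding rst_def using fin permutes_inj[OF perm] img by (auto intro!: restrict_permutes)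
    moreover have "snd (join X f g (r x)) = snd (join X f g x)" if "x \<in> X \<union> Y" for x
      using r that by (simp add: col_perms_def)
    then have "snd (f (rst X r x)) = snd (f x)" if "x \<in> X" for x
      using that img(1) by (fastforce simp: rst_def join_def)
    moreover have "snd (g (rst Y r x)) = snd (g x)" if "x \<in> Y" for x
      using that img(2) \<open>\<And>x. x \<in> X \<union> Y \<Longrightarrow> snd (join X f g (r x)) = snd (join X f g x)\<close>[of x] Y
      by (fastforce simp: rst_def join_def)
    ultimately show "(rst X r, rst Y r) \<in> col_perms X f \<times> col_perms Y g"
      by (simp add: col_perms_def)
    show "(case (rst X r, rst Y r) of (p, q) \<Rightarrow> of_int (sign (p \<circ> q)) * F (p \<circ> q))
        = of_int (sign r) * F r" using eq by simp
  next
    fix pq assume "pq \<in> col_perms X f \<times> col_perms Y g"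
    then obtain p q where pq: "pq = (p, q)" "p \<in> col_perms X f" "q \<in> col_perms Y g" by auto
    have p: "p permutes X" and q: "q permutes Y" using pq by (auto simp: col_perms_def)
    have inX: "p x \<in> X" if "x \<in> X" for x using permutes_in_image[OF p] that by blast
    have inY: "q x \<in> Y" if "x \<in> Y" for x using permutes_in_image[OF q] that by blast
    have pY: "p x = x" if "x \<in> Y" for x using permutes_not_in[OF p] Y that by blast
    have qX: "q x = x" if "x \<in> X" for x using permutes_not_in[OF q] disj that by blast
    show "(rst X (case pq of (p, q) \<Rightarrow> p \<circ> q), rst Y (case pq of (p, q) \<Rightarrow> p \<circ> q)) = pq"
      using inY pY qX permutes_not_in[OF p] permutes_not_in[OF q] by (auto simp: pq rst_def fun_eq_iff)
    have "p \<circ> q permutes X \<union> Y"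
      using permutes_subset[OF p, of "X \<union> Y"] permutes_subset[OF q, of "X \<union> Y"] permutes_compose by blast
    moreover have "snd (join X f g ((p \<circ> q) x)) = snd (join X f g x)" if "x \<in> X \<union> Y" for x
      using that pq inX inY pY qX Y by (auto simp: col_perms_def join_def)
    ultimately show "(case pq of (p, q) \<Rightarrow> p \<circ> q) \<in> col_perms (X \<union> Y) (join X f g)"
      by (simp add: pq col_perms_def)
  qed
  also have "\<dots> = (\<Sum>(p, q)\<in>col_perms X f \<times> col_perms Y g. (of_int (sign p) * A p) * (of_int (sign q) * B q))"
  proof (rule sum.cong[OF refl], clarify)
    fix p q assume pq: "p \<in> col_perms X f" "q \<in> col_perms Y g"
    have "permutation p" "permutation q"
      using pq fin by (auto simp: col_perms_def intro: permutes_imp_permutation)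
    then show "of_int (sign (p \<circ> q)) * F (p \<circ> q) = (of_int (sign p) * A p) * (of_int (sign q) * B q)"
      by (simp add: sign_compose F[OF pq])
  qed
  also have "\<dots> = (\<Sum>p\<in>col_perms X f. of_int (sign p) * A p) * (\<Sum>q\<in>col_perms Y g. of_int (sign q) * B q)"
    by (simp add: sum_product sum.cartesian_product)
  finally show ?thesis .
qed

lemma join_comp_col_perms:
  assumes disj: "X \<inter> Y = {}" and "p \<in> col_perms X f" "q \<in> col_perms Y g"
  shows "x \<in> X \<Longrightarrow> fst (join X f g ((p \<circ> q) x)) = fst (f (p x))"
    and "x \<in> Y \<Longrightarrow> fst (join X f g ((p \<circ> q) x)) = fst (g (q x))"
proof -
  have p: "p permutes X" and q: "q permutes Y" using assms by (auto simp: col_perms_def)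
  show "fst (join X f g ((p \<circ> q) x)) = fst (f (p x))" if "x \<in> X"
  proof -
    have "q x = x" using that disj permutes_not_in[OF q] by blast
    then show ?thesis using that permutes_in_image[OF p] by (simp add: join_def)
  qed
  show "fst (join X f g ((p \<circ> q) x)) = fst (g (q x))" if "x \<in> Y"
  proof -
    have "q x \<notin> X" using that permutes_in_image[OF q] disj by blast
    then show ?thesis using permutes_not_in[OF p] by (simp add: join_def)
  qed
qed

lemma hw_poly_join:
  assumes fin: "finite X" "finite Y" and disj: "X \<inter> Y = {}"
  shows "hw_poly (X \<union> Y) (join X f f') (join X g g') (join X h h') z
    = hw_poly X f g h z * hw_poly Y f' g' h' z"
  unfolding hw_poly_def
  by (intro sum_col_perms_join[OF fin disj])
    (simp add: prod.union_disjoint[OF fin disj] join_comp_col_perms[OF disj] del: comp_apply)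

text \<open>Multiplication by the polynomial of the fillings of \<open>Y\<close> is injective, since
polynomial functions have no zero divisors, and it maps into the space of the sum of the shapes
by the product formula.\<close>
lemma dim_hw_polys_mono:
  assumes fin: "finite X" "finite Y" and disj: "X \<inter> Y = {}"
    and part: "\<And>i j. i \<le> j \<Longrightarrow> s j \<le> s i" "\<And>i j. i \<le> j \<Longrightarrow> t j \<le> t i" "\<And>i j. i \<le> j \<Longrightarrow> u j \<le> u i"
    and fill: "filling s' Y f" "filling t' Y g" "filling u' Y h"
    and nz: "hw_poly Y f g h z \<noteq> 0"
  shows "cfun.dim (hw_polys X s t u)
    \<le> cfun.dim (hw_polys (X \<union> Y) (\<lambda>i. s i + s' i) (\<lambda>i. t i + t' i) (\<lambda>i. u i + u' i))"
proof (rule dim_le_dim_of_injective[of "\<lambda>F z. F z * hw_poly Y f g h z"])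
  fix F assume F: "F \<in> cfun.span (hw_polys X s t u)" and zero: "(\<lambda>z. F z * hw_poly Y f g h z) = 0"
  show "F = 0"
  proof (rule ccontr)
    assume "F \<noteq> 0"
    then obtain w where "F w \<noteq> 0" by (auto simp: fun_eq_iff)
    then obtain y where "F y * hw_poly Y f g h y \<noteq> 0"
      using poly_on_lines_no_zero_divisors[of F "hw_poly Y f g h" w z]
        poly_on_lines_span_hw_polys[OF F] poly_on_lines_hw_poly nz by blast
    then show False using fun_cong[OF zero, of y] by simp
  qed
next
  show "(\<lambda>F z. F z * hw_poly Y f g h z) ` hw_polys X s t u
    \<subseteq> cfun.span (hw_polys (X \<union> Y) (\<lambda>i. s i + s' i) (\<lambda>i. t i + t' i) (\<lambda>i. u i + u' i))"
  proof
    fix G assume "G \<in> (\<lambda>F z. F z * hw_poly Y f g h z) ` hw_polys X s t u"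
    then obtain f' g' h' where G: "G = (\<lambda>z. hw_poly X f' g' h' z * hw_poly Y f g h z)"
      and b: "bij_betw f' X (diagram s)" "bij_betw g' X (diagram t)" "bij_betw h' X (diagram u)"
      unfolding hw_polys_def by blast
    have "filling s X f'" "filling t X g'" "filling u X h'"
      using filling_of_diagram part b by blast+
    then have "hw_poly (X \<union> Y) (join X f' f) (join X g' g) (join X h' h)
        \<in> hw_polys (X \<union> Y) (\<lambda>i. s i + s' i) (\<lambda>i. t i + t' i) (\<lambda>i. u i + u' i)"
      using fin disj fill by (intro hw_poly_filling_in filling_join) auto
    moreover have "G = hw_poly (X \<union> Y) (join X f' f) (join X g' g) (join X h' h)"
      unfolding G by (rule ext) (rule hw_poly_join[OF fin disj, symmetric])
    ultimately show "G \<in> cfun.span (hw_polys (X \<union> Y) (\<lambda>i. s i + s' i) (\<lambda>i. t i + t' i) (\<lambda>i. u i + u' i))"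
      by (simp add: cfun.span_base)
  qed
next
  show "finite (hw_polys (X \<union> Y) (\<lambda>i. s i + s' i) (\<lambda>i. t i + t' i) (\<lambda>i. u i + u' i))"
    using fin by (simp add: finite_hw_polys)
qed (auto simp: fun_eq_iff algebra_simps)

section \<open>A nonzero polynomial for the hook triple\<close>

text \<open>The points of \<open>L\<close> form the leg of the hook, in the rows given by \<open>l\<close>.
All other points lie in row \<open>0\<close>, and each of them except the corner
\<open>m\<close> uses its own number as column label.\<close>
definition hook_filling :: "nat \<Rightarrow> nat set \<Rightarrow> (nat \<Rightarrow> nat) \<Rightarrow> nat \<Rightarrow> nat \<times> nat" where
  "hook_filling m L l x = (if x = m then (0, 0) else if x \<in> L then (l x, 0) else (0, x))"

lemma filling_hook_filling:
  assumes fin: "finite Y" and m: "m \<in> Y" and pos: "0 \<notin> Y - {m}"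
    and L: "L \<subseteq> Y - {m}" and l: "bij_betw l L {1..k}"
  shows "filling (\<lambda>i. if i = 0 then card Y - k else if i \<le> k then 1 else 0) Y (hook_filling m L l)"
proof -
  have cardL: "card L = k" using bij_betw_same_card[OF l] by simp
  have l_pos: "0 < l x" if "x \<in> L" for x using bij_betwE[OF l] that by fastforce
  have pos': "0 < x" if "x \<in> Y" "x \<noteq> m" for x using pos that by (metis DiffI gr0I singletonD)
  have inj_l: "l x = l y \<longleftrightarrow> x = y" if "x \<in> L" "y \<in> L" for x y
    using l that by (auto simp: bij_betw_def inj_on_eq_iff)
  have "inj_on (hook_filling m L l) Y"
  proof (rule inj_onI)
    fix x y assume "x \<in> Y" "y \<in> Y" "hook_filling m L l x = hook_filling m L l y"
    then show "x = y"
      using l_pos[of x] l_pos[of y] pos'[of x] pos'[of y] inj_l[of x y]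
      by (auto simp: hook_filling_def split: if_splits)
  qed
  moreover have "card {x\<in>Y. fst (hook_filling m L l x) = i}
      = (if i = 0 then card Y - k else if i \<le> k then 1 else 0)" for i
  proof (cases "i = 0")
    case True
    have "fst (hook_filling m L l x) = 0 \<longleftrightarrow> x \<notin> L" for x
      using L l_pos[of x] by (auto simp: hook_filling_def)
    then have "{x\<in>Y. fst (hook_filling m L l x) = i} = Y - L"
      using True by auto
    moreover have "card (Y - L) = card Y - k"
      using L cardL fin by (subst card_Diff_subset) (auto intro: finite_subset)
    ultimately show ?thesis using True by simp
  next
    case False
    have eq: "{x\<in>Y. fst (hook_filling m L l x) = i} = {x\<in>L. l x = i}"
      using False L by (auto simp: hook_filling_def)
    show ?thesis
    proof (cases "i \<le> k")
      case True
      then have "i \<in> l ` L" using l False by (auto simp: bij_betw_def)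
      then obtain x where "x \<in> L" "l x = i" by blast
      then have "{x\<in>L. l x = i} = {x}" using inj_l by auto
      then show ?thesis using eq True False by simp
    next
      case k: False
      have "{x\<in>L. l x = i} = {}" using bij_betwE[OF l] k by fastforce
      with eq have empty: "{x\<in>Y. fst (hook_filling m L l x) = i} = {}" by (rule trans)
      show ?thesis unfolding empty using k False by simp
    qed
  qed
  moreover have "\<exists>y\<in>Y. hook_filling m L l y = (i, snd (hook_filling m L l x))"
    if x: "x \<in> Y" "i < fst (hook_filling m L l x)" for x i
  proof -
    have xL: "x \<noteq> m" "x \<in> L" "i < l x" using x(2) by (auto simp: hook_filling_def split: if_splits)
    show ?thesis
    proof (cases "i = 0")
      case True
      then show ?thesis using xL m by (intro bexI[of _ m]) (auto simp: hook_filling_def)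
    next
      case False
      then have "i \<in> {1..k}" using xL(3) bij_betwE[OF l] xL(2) by fastforce
      then have "i \<in> l ` L" using bij_betw_imp_surj_on[OF l] by simp
      then obtain y where "y \<in> L" "l y = i" by blast
      then show ?thesis using xL L by (intro bexI[of _ y]) (auto simp: hook_filling_def)
    qed
  qed
  ultimately show ?thesis by (simp add: filling_def)
qed

text \<open>Only the first column of a hook has more than one cell. Positive labels are needed to keep the
other columns distinct from the column \<open>0\<close> of the corner.\<close>
lemma col_perms_hook_filling:
  assumes pos: "0 \<notin> Y - {m}" and p: "p \<in> col_perms Y (hook_filling m L l)"
    and sub: "L \<subseteq> Y" "m \<in> Y"
  shows "x \<notin> insert m L \<Longrightarrow> p x = x" and "x \<in> insert m L \<Longrightarrow> p x \<in> insert m L"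
proof -
  have perm: "p permutes Y" using p by (rule col_perms_permutes)
  have eq: "snd (hook_filling m L l (p x)) = snd (hook_filling m L l x)" if "x \<in> Y" for x
    using p that by (simp add: col_perms_def)
  have pos': "0 < x" if "x \<in> Y" "x \<noteq> m" for x using pos that by (metis DiffI gr0I singletonD)
  show "p x = x" if "x \<notin> insert m L"
  proof (cases "x \<in> Y")
    case True
    then show ?thesis
      using eq[OF True] that pos'[of x] by (auto simp: hook_filling_def split: if_splits)
  next
    case False
    then show ?thesis using permutes_not_in[OF perm] by blast
  qed
  show "p x \<in> insert m L" if "x \<in> insert m L"
  proof -
    have "x \<in> Y" using that sub by blast
    moreover from this have "p x \<in> Y" using permutes_in_image[OF perm] by blast
    ultimately show ?thesis
      using eq[of x] that pos'[of "p x"] by (auto simp: hook_filling_def split: if_splits)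
  qed
qed

text \<open>The legs of the first two hooks are disjoint, and the leg of the third is their union. In the
point \<open>z\<close> that is the indicator of the row triples of the points, the term of
\<open>(p, q, r)\<close> is nonzero only if \<open>r = p \<circ> q\<close>; then the three signs
multiply to \<open>1\<close>. So all terms are \<open>0\<close> or \<open>1\<close>, and the
identity contributes \<open>1\<close>.\<close>
lemma hook_hw_poly_nonzero:
  fixes a b c m :: nat
  defines "Y \<equiv> {m..<m + (a + b + c + 1)}"
  defines "f \<equiv> hook_filling m {m+1..m+a} (\<lambda>x. x - m)"
    and "g \<equiv> hook_filling m {m+a+1..m+a+b} (\<lambda>x. x - (m + a))"
    and "h \<equiv> hook_filling m {m+1..m+a+b} (\<lambda>x. x - m)"
  shows "\<exists>z. hw_poly Y f g h z \<noteq> 0"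
proof -
  define Z where "Z = (\<lambda>y. (fst (f y), fst (g y), fst (h y))) ` {m..m+a+b}"
  define z where "z = (\<lambda>i. of_bool (i \<in> Z) :: complex)"
  define ok where "ok p q r \<longleftrightarrow> (\<forall>x\<in>Y. (fst (f (p x)), fst (g (q x)), fst (h (r x))) \<in> Z)" for p q r
  have pos: "0 \<notin> Y - {m}" by (auto simp: Y_def)
  have comp: "r = p \<circ> q" if pqr: "p \<in> col_perms Y f" "q \<in> col_perms Y g" "r \<in> col_perms Y h"
    and "ok p q r" for p q r
  proof
    fix x
    have mY: "m \<in> Y" and sub: "{m+1..m+a} \<subseteq> Y" "{m+a+1..m+a+b} \<subseteq> Y" "{m+1..m+a+b} \<subseteq> Y"
      by (auto simp: Y_def)
    note p = col_perms_hook_filling[OF pos pqr(1)[unfolded f_def] sub(1) mY]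
    note q = col_perms_hook_filling[OF pos pqr(2)[unfolded g_def] sub(2) mY]
    note r = col_perms_hook_filling[OF pos pqr(3)[unfolded h_def] sub(3) mY]
    have inj_f: "u = v" if "u \<in> {m..m+a}" "v \<in> {m..m+a}" "fst (f u) = fst (f v)" for u v
      using that by (auto simp: f_def hook_filling_def split: if_splits)
    have inj_g: "u = v" if "u \<in> insert m {m+a+1..m+a+b}" "v \<in> insert m {m+a+1..m+a+b}"
        "fst (g u) = fst (g v)" for u v
      using that by (auto simp: g_def hook_filling_def split: if_splits)
    have inj_h: "u = v" if "u \<in> {m..m+a+b}" "v \<in> {m..m+a+b}" "fst (h u) = fst (h v)" for u v
      using that by (auto simp: h_def hook_filling_def split: if_splits)
    have f0: "fst (f u) = 0 \<longleftrightarrow> u \<notin> {m+1..m+a}" for u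
      by (auto simp: f_def hook_filling_def)
    have g0: "fst (g u) = 0 \<longleftrightarrow> u \<notin> {m+a+1..m+a+b}" for u
      by (auto simp: g_def hook_filling_def)
    have ins: "insert m {m+1..m+a} = {m..m+a}" "insert m {m+1..m+a+b} = {m..m+a+b}" by auto
    have r_in: "r x \<in> {m..m+a+b}" if "x \<in> {m..m+a+b}" for x using r(2)[of x] that unfolding ins by blast
    have p_in: "p x \<in> {m..m+a}" if "x \<in> {m..m+a}" for x using p(2)[of x] that unfolding ins by blast
    \<comment> \<open>The third filling separates the points up to \<open>m+a+b\<close>, so the row triple at
      \<open>x\<close> can only be that of the point \<open>r x\<close>.\<close>
    have rows: "fst (f (p x)) = fst (f (r x))" "fst (g (q x)) = fst (g (r x))"
      if x: "x \<in> {m..m+a+b}" for x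
    proof -
      have "x \<in> Y" using x by (auto simp: Y_def)
      then have "(fst (f (p x)), fst (g (q x)), fst (h (r x))) \<in> Z"
        using \<open>ok p q r\<close> by (simp add: ok_def)
      then obtain y where y: "y \<in> {m..m+a+b}" "fst (f (p x)) = fst (f y)"
          "fst (g (q x)) = fst (g y)" "fst (h (r x)) = fst (h y)"
        by (auto simp: Z_def)
      have "r x = y" using inj_h[OF r_in[OF x] y(1) y(4)] .
      then show "fst (f (p x)) = fst (f (r x))" "fst (g (q x)) = fst (g (r x))" using y by auto
    qed
    have m_in: "m \<in> {m..m+a+b}" by simp
    consider (A) "x \<in> {m+1..m+a}" | (B) "x \<in> {m+a+1..m+a+b}" | (M) "x = m" | (E) "x \<notin> {m..m+a+b}"
      by fastforce
    then show "r x = (p \<circ> q) x"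
    proof cases
      case A
      then have x: "x \<in> {m..m+a+b}" "x \<in> {m..m+a}" by auto
      have qx: "q x = x" using q(1)[of x] A by auto
      have "fst (g (r x)) = 0" using rows(2)[OF x(1)] g0[of x] A qx by auto
      then have "r x \<in> {m..m+a}" using r_in[OF x(1)] g0[of "r x"] by auto
      then have "p x = r x" using inj_f[OF p_in[OF x(2)]] rows(1)[OF x(1)] by blast
      then show ?thesis using qx by simp
    next
      case B
      then have x: "x \<in> {m..m+a+b}" by auto
      have px: "p x = x" using p(1)[of x] B by auto
      have "fst (f (r x)) = 0" using rows(1)[OF x] f0[of x] B px by auto
      then have "r x \<in> insert m {m+a+1..m+a+b}" using r_in[OF x] f0[of "r x"] by auto
      moreover have qx: "q x \<in> insert m {m+a+1..m+a+b}" using q(2)[of x] B by blast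
      ultimately have rq: "q x = r x" using inj_g rows(2)[OF x] by blast
      \<comment> \<open>If \<open>q\<close> moves \<open>x\<close> to the corner, it moves the corner into the leg
        of the second hook. Then so does \<open>r\<close>, and the first hook forces
        \<open>p\<close> to fix the corner.\<close>
      have "p (q x) = q x"
      proof (cases "q x = m")
        case True
        have "x \<noteq> m" using B by auto
        then have "q m \<noteq> m"
          using True permutes_inj[OF col_perms_permutes[OF pqr(2)]] by (metis injD)
        then have "q m \<in> {m+a+1..m+a+b}" using q(2)[of m] by blast
        then have "fst (g (r m)) \<noteq> 0" using g0[of "q m"] rows(2)[OF m_in] by auto
        then have "fst (f (p m)) = 0" using g0[of "r m"] f0[of "r m"] rows(1)[OF m_in] by auto
        then have "p m = m" using p_in[of m] f0[of "p m"] by auto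
        then show ?thesis using True by simp
      next
        case False
        then show ?thesis using qx p(1)[of "q x"] by auto
      qed
      then show ?thesis using rq by simp
    next
      case M
      show ?thesis
      proof (cases "q m = m")
        case True
        then have "fst (g (r m)) = 0" using rows(2)[OF m_in] g0[of m] by auto
        then have "r m \<in> {m..m+a}" using r_in[OF m_in] g0[of "r m"] by auto
        then have "p m = r m" using inj_f[OF p_in[of m]] rows(1)[OF m_in] by auto
        then show ?thesis using True M by simp
      next
        case False
        then have qm: "q m \<in> {m+a+1..m+a+b}" using q(2)[of m] by blast
        then have "fst (g (r m)) \<noteq> 0" using g0[of "q m"] rows(2)[OF m_in] by auto
        then have "r m \<in> {m+a+1..m+a+b}" using g0[of "r m"] by auto
        then have "q m = r m" using inj_g[of "q m" "r m"] rows(2)[OF m_in] qm by auto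
        moreover have "p (q m) = q m" using p(1)[of "q m"] qm by auto
        ultimately show ?thesis using M by simp
      qed
    next
      case E
      have "x \<notin> insert m {m+1..m+a+b}" "x \<notin> insert m {m+1..m+a}"
        "x \<notin> insert m {m+a+1..m+a+b}" using E by auto
      then have "r x = x" "p x = x" "q x = x" using r(1) p(1) q(1) by blast+
      then show ?thesis by simp
    qed
  qed
  have term_eq: "of_int (sign p) * (of_int (sign q) * (of_int (sign r) *
      (\<Prod>x\<in>Y. z (fst (f (p x)), fst (g (q x)), fst (h (r x)))))) = of_nat (of_bool (ok p q r))"
    if pqr: "p \<in> col_perms Y f" "q \<in> col_perms Y g" "r \<in> col_perms Y h" for p q r
  proof (cases "ok p q r")
    case True
    have finY: "finite Y" by (simp add: Y_def)
    have "permutation p" "permutation q"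
      using finY pqr(1,2)[THEN col_perms_permutes] by (auto intro: permutes_imp_permutation)
    then have "sign r = sign p * sign q" using comp[OF pqr True] by (simp add: sign_compose)
    then have "sign p * (sign q * sign r) = 1" by (simp add: mult_ac)
    then have "complex_of_int (sign p) * (of_int (sign q) * of_int (sign r)) = 1"
      by (metis of_int_1 of_int_mult)
    moreover have "(\<Prod>x\<in>Y. z (fst (f (p x)), fst (g (q x)), fst (h (r x)))) = 1"
      using True by (intro prod.neutral) (auto simp: ok_def z_def)
    ultimately show ?thesis using True by simp
  next
    case False
    then obtain x where "x \<in> Y" "(fst (f (p x)), fst (g (q x)), fst (h (r x))) \<notin> Z"
      by (auto simp: ok_def)
    then have "(\<Prod>x\<in>Y. z (fst (f (p x)), fst (g (q x)), fst (h (r x)))) = 0"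
      by (intro prod_zero) (auto simp: Y_def z_def)
    then show ?thesis using False by simp
  qed
  have "hw_poly Y f g h z = of_nat (\<Sum>p\<in>col_perms Y f. \<Sum>q\<in>col_perms Y g. \<Sum>r\<in>col_perms Y h. of_bool (ok p q r))"
    unfolding hw_poly_def of_nat_sum sum_distrib_left
    by (intro sum.cong refl term_eq)
  moreover have "(\<Sum>p\<in>col_perms Y f. \<Sum>q\<in>col_perms Y g. \<Sum>r\<in>col_perms Y h. of_bool (ok p q r)) \<noteq> (0::nat)"
  proof -
    have fin: "finite (col_perms Y f)" "finite (col_perms Y g)" "finite (col_perms Y h)"
      by (simp_all add: finite_col_perms Y_def)
    have id: "id \<in> col_perms Y f" "id \<in> col_perms Y g" "id \<in> col_perms Y h"
      by (simp_all add: col_perms_def permutes_id)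
    have "ok id id id"
      unfolding ok_def
    proof
      fix x assume x: "x \<in> Y"
      have "(fst (f x), fst (g x), fst (h x)) = (\<lambda>y. (fst (f y), fst (g y), fst (h y))) (if x \<le> m+a+b then x else m)"
        by (auto simp: f_def g_def h_def hook_filling_def)
      also have "\<dots> \<in> Z" unfolding Z_def using x by (intro imageI) (auto simp: Y_def)
      finally show "(fst (f (id x)), fst (g (id x)), fst (h (id x))) \<in> Z" by simp
    qed
    then show ?thesis using fin id by (auto simp: sum_eq_0_iff)
  qed
  ultimately show ?thesis by (metis of_nat_eq_0_iff)
qed

section \<open>Column operations\<close>

text \<open>Replacing a column permutation by its inverse moves the product from points to cells, so that
permutations act on the first argument of \<open>G\<close> only.\<close>
lemma sum_col_perms_transfer:
  assumes "finite X"
  shows "(\<Sum>r\<in>col_perms X h. of_int (sign r) * (\<Prod>x\<in>X. G x (r x)))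
    = (\<Sum>r\<in>col_perms X h. of_int (sign r) * (\<Prod>y\<in>X. (G (r y) y :: complex)))"
proof -
  have "(\<Sum>r\<in>col_perms X h. of_int (sign r) * (\<Prod>x\<in>X. G x (r x)))
      = (\<Sum>r\<in>col_perms X h. of_int (sign (inv r)) * (\<Prod>x\<in>X. G x (inv r x)))"
    by (rule sum_col_perms_inv[symmetric])
  also have "\<dots> = (\<Sum>r\<in>col_perms X h. of_int (sign r) * (\<Prod>y\<in>X. G (r y) y))"
  proof (rule sum.cong[OF refl])
    fix r assume "r \<in> col_perms X h"
    then have r: "r permutes X" by (rule col_perms_permutes)
    then have "sign (inv r) = sign r" using assms by (auto intro: sign_inverse permutes_imp_permutation)
    moreover have "(\<Prod>x\<in>X. G x (inv r x)) = (\<Prod>y\<in>X. G (r y) y)"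
      using prod.permute[OF r, of "\<lambda>x. G x (inv r x)"] by (simp add: comp_def permutes_inverses[OF r])
    ultimately show "of_int (sign (inv r)) * (\<Prod>x\<in>X. G x (inv r x)) = of_int (sign r) * (\<Prod>y\<in>X. G (r y) y)"
      by simp
  qed
  finally show ?thesis .
qed

lemma col_perms_transpose:
  assumes "r \<in> col_perms X h" "y \<in> X" "y' \<in> X" "snd (h y) = snd (h y')"
  shows "r \<circ> Transposition.transpose y y' \<in> col_perms X h"
proof -
  have r: "r permutes X" using assms(1) by (rule col_perms_permutes)
  have t: "Transposition.transpose y y' permutes X" using assms(2,3) by (rule permutes_swap_id)
  have "snd (h (r (Transposition.transpose y y' x))) = snd (h x)" if "x \<in> X" for x
  proof -
    have "Transposition.transpose y y' x \<in> X" using permutes_in_image[OF t] that by blast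
    then have "snd (h (r (Transposition.transpose y y' x))) = snd (h (Transposition.transpose y y' x))"
      using assms(1) by (simp add: col_perms_def)
    also have "\<dots> = snd (h x)" using assms(4) by (auto simp: Transposition.transpose_def)
    finally show ?thesis .
  qed
  then show ?thesis using permutes_compose[OF t r] by (simp add: col_perms_def)
qed

lemma sum_col_perms_symmetric_eq_0:
  fixes F :: "(nat \<Rightarrow> nat) \<Rightarrow> complex"
  assumes fin: "finite X" and y: "y \<in> X" "y' \<in> X" "y \<noteq> y'" "snd (h y) = snd (h y')"
    and F: "\<And>r. r \<in> col_perms X h \<Longrightarrow> F (r \<circ> Transposition.transpose y y') = F r"
  shows "(\<Sum>r\<in>col_perms X h. of_int (sign r) * F r) = 0"
proof -
  let ?t = "Transposition.transpose y y'"
  have "(\<Sum>r\<in>col_perms X h. of_int (sign r) * F r)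
      = (\<Sum>r\<in>col_perms X h. of_int (sign (r \<circ> ?t)) * F (r \<circ> ?t))"
    by (rule sum.reindex_bij_witness[of _ "\<lambda>r. r \<circ> ?t" "\<lambda>r. r \<circ> ?t"])
      (auto simp: comp_assoc col_perms_transpose[OF _ y(1,2,4)])
  also have "\<dots> = (\<Sum>r\<in>col_perms X h. - (of_int (sign r) * F r))"
  proof (rule sum.cong[OF refl])
    fix r assume r: "r \<in> col_perms X h"
    have "permutation r" using fin col_perms_permutes[OF r] by (auto intro: permutes_imp_permutation)
    then have "sign (r \<circ> ?t) = - sign r"
      using y(3) by (simp add: sign_compose permutation_swap_id sign_swap_id)
    then show "of_int (sign (r \<circ> ?t)) * F (r \<circ> ?t) = - (of_int (sign r) * F r)" by (simp add: F[OF r])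
  qed
  also have "\<dots> = - (\<Sum>r\<in>col_perms X h. of_int (sign r) * F r)" by (rule sum_negf)
  finally show ?thesis by simp
qed

text \<open>A product of determinants does not change when multiples of column \<open>j\<close> are added to
later columns. After expanding the product over the set \<open>Y\<close> of cells in which the
added multiple is chosen, a cell of \<open>Y\<close> below row \<open>j\<close> and the cell of
row \<open>j\<close> in the same column carry the same factor, and exchanging the two changes
the sign.\<close>
lemma alternating_sum_column_op:
  fixes w :: "nat \<Rightarrow> nat \<Rightarrow> complex"
  assumes fin: "finite X" and h: "filling u X h" and d: "\<And>k. k \<le> j \<Longrightarrow> d k = 0"
  shows "(\<Sum>r\<in>col_perms X h. of_int (sign r) *
        (\<Prod>x\<in>X. w x (fst (h (r x))) + d (fst (h (r x))) * w x j))
    = (\<Sum>r\<in>col_perms X h. of_int (sign r) * (\<Prod>x\<in>X. w x (fst (h (r x)))))"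
proof -
  let ?row = "\<lambda>y. fst (h y)" and ?C = "col_perms X h"
  define F where "F Y r = (\<Prod>y\<in>Y. d (?row y) * w (r y) j) * (\<Prod>y\<in>X - Y. w (r y) (?row y))" for Y r
  have vanish: "(\<Sum>r\<in>?C. of_int (sign r) * F Y r) = 0" if Y: "Y \<subseteq> X" "Y \<noteq> {}" for Y
  proof -
    have finY: "finite Y" using Y(1) fin by (rule finite_subset)
    obtain y where y: "y \<in> Y" using Y(2) by blast
    show ?thesis
    proof (cases "\<exists>y\<in>Y. d (?row y) = 0")
      case True
      then have "(\<Prod>y\<in>Y. d (?row y) * w (r y) j) = 0" for r
        using finY by (intro prod_zero) auto
      then show ?thesis by (simp add: F_def)
    next
      case False
      then have "j < ?row y" using d y by (metis not_less)
      then obtain y' where y': "y' \<in> X" "h y' = (j, snd (h y))"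
        using h y Y(1) unfolding filling_def by blast
      \<comment> \<open>The coefficient \<open>d j\<close> is zero, so no cell of row \<open>j\<close> contributes
        an added multiple.\<close>
      have "y' \<notin> Y" using False y'(2) d by auto
      then have "y' \<in> X - Y" "y \<noteq> y'" using y' y by auto
      show ?thesis
      proof (rule sum_col_perms_symmetric_eq_0[OF fin, of y y'])
        fix r
        let ?t = "Transposition.transpose y y'"
        have split: "F Y r = (d (?row y) * w (r y) j * (\<Prod>y\<in>Y - {y}. d (?row y) * w (r y) j))
            * (w (r y') j * (\<Prod>y\<in>X - Y - {y'}. w (r y) (?row y)))" for r
          unfolding F_def prod.remove[OF finY y] prod.remove[OF finite_Diff[OF fin] \<open>y' \<in> X - Y\<close>]
          by (simp add: y'(2))
        have t: "?t x = x" if "x \<in> Y - {y} \<or> x \<in> X - Y - {y'}" for x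
          using that \<open>y' \<notin> Y\<close> y by (auto simp: Transposition.transpose_def)
        have "(\<Prod>y\<in>Y - {y}. d (?row y) * w ((r \<circ> ?t) y) j) = (\<Prod>y\<in>Y - {y}. d (?row y) * w (r y) j)"
          "(\<Prod>y\<in>X - Y - {y'}. w ((r \<circ> ?t) y) (?row y)) = (\<Prod>y\<in>X - Y - {y'}. w (r y) (?row y))"
          by (auto intro!: prod.cong simp: t)
        then show "F Y (r \<circ> ?t) = F Y r" unfolding split by simp
      qed (use y y' Y \<open>y \<noteq> y'\<close> in auto)
    qed
  qed
  have "(\<Sum>r\<in>?C. of_int (sign r) * (\<Prod>x\<in>X. w x (?row (r x)) + d (?row (r x)) * w x j))
      = (\<Sum>r\<in>?C. of_int (sign r) * (\<Prod>y\<in>X. d (?row y) * w (r y) j + w (r y) (?row y)))"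
    using sum_col_perms_transfer[OF fin, where h = h and G = "\<lambda>x y. w x (?row y) + d (?row y) * w x j"]
    by (simp add: add.commute)
  also have "\<dots> = (\<Sum>r\<in>?C. \<Sum>Y\<in>Pow X. of_int (sign r) * F Y r)"
    by (simp add: prod_add[OF fin] F_def sum_distrib_left)
  also have "\<dots> = (\<Sum>Y\<in>Pow X. \<Sum>r\<in>?C. of_int (sign r) * F Y r)" by (rule sum.swap)
  also have "\<dots> = (\<Sum>Y\<in>{{}}. \<Sum>r\<in>?C. of_int (sign r) * F Y r)"
    using fin vanish by (intro sum.mono_neutral_right) auto
  also have "\<dots> = (\<Sum>r\<in>?C. of_int (sign r) * (\<Prod>y\<in>X. w (r y) (?row y)))"
    by (simp add: F_def)
  also have "\<dots> = (\<Sum>r\<in>?C. of_int (sign r) * (\<Prod>x\<in>X. w x (?row (r x))))"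
    by (rule sum_col_perms_transfer[OF fin, symmetric])
  finally show ?thesis .
qed

lemma hw_poly_column_op:
  assumes fin: "finite X" and h: "filling u X h" and d: "\<And>k. k \<le> j \<Longrightarrow> d k = 0"
  shows "hw_poly X f g h (\<lambda>(i, i', k). z (i, i', k) + d k * z (i, i', j)) = hw_poly X f g h z"
  unfolding hw_poly_def prod.case
  by (rule sum.cong[OF refl], rule arg_cong2[where f = "(*)", OF refl],
      rule sum.cong[OF refl], rule arg_cong2[where f = "(*)", OF refl],
      rule alternating_sum_column_op[OF fin h d, where w = "\<lambda>x k. z (fst (f (_ x)), fst (g (_ x)), k)"])

section \<open>Restriction to lower triangular arrays\<close>

text \<open>The function \<open>s\<close> numbers the pairs \<open>(i, j)\<close>; in the matrix with rows
\<open>s i j\<close> and columns \<open>k\<close> the entries above the diagonal are replaced by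
zero.\<close>
definition triangular_part :: "(nat \<Rightarrow> nat \<Rightarrow> nat) \<Rightarrow> (nat \<times> nat \<times> nat \<Rightarrow> complex) \<Rightarrow> nat \<times> nat \<times> nat \<Rightarrow> complex" where
  "triangular_part s z = (\<lambda>(i, j, k). if s i j < k then 0 else z (i, j, k))"

text \<open>Gaussian elimination, one row at a time from the last row to the first: if \<open>F\<close>
vanishes on arrays whose rows up to \<open>n\<close> are cleared to the right of the diagonal,
it vanishes on those whose rows before \<open>n\<close> are cleared. A nonzero pivot in row
\<open>n\<close> allows a column operation that clears this row and keeps the earlier ones
cleared. A zero pivot is reached as a limit along the line that varies only the pivot. Numbers
\<open>n\<close> that are not taken by any pair need no step.\<close>
lemma eq_0_if_eq_0_on_triangular:
  fixes F :: "(nat \<times> nat \<times> nat \<Rightarrow> complex) \<Rightarrow> complex"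
  assumes poly: "poly_on_lines F"
    and inv: "\<And>z n d. (\<And>k. k \<le> n \<Longrightarrow> d k = 0) \<Longrightarrow>
      F (\<lambda>(i, j, k). z (i, j, k) + d k * z (i, j, n)) = F z"
    and local: "\<And>z z'. (\<And>i j k. k < R \<Longrightarrow> z (i, j, k) = z' (i, j, k)) \<Longrightarrow> F z = F z'"
    and s_inj: "\<And>i j i' j'. s i j = s i' j' \<Longrightarrow> i = i' \<and> j = j'"
    and zero: "\<And>z. F (triangular_part s z) = 0"
  shows "F z = 0"
proof -
  \<comment> \<open>The rows with number below \<open>n\<close> vanish to the right of the diagonal.\<close>
  define cleared where "cleared n z \<longleftrightarrow> (\<forall>i j k. s i j < n \<longrightarrow> s i j < k \<longrightarrow> z (i, j, k) = 0)"
    for n and z :: "nat \<times> nat \<times> nat \<Rightarrow> complex"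
  have "\<forall>z. cleared 0 z \<longrightarrow> F z = 0"
  proof (rule inc_induct[of 0 R])
    show "\<forall>z. cleared R z \<longrightarrow> F z = 0"
    proof (intro allI impI)
      fix z assume z: "cleared R z"
      have "F z = F (triangular_part s z)"
        using z by (intro local) (auto simp: cleared_def triangular_part_def)
      then show "F z = 0" using zero by simp
    qed
  next
    fix n assume IH: "\<forall>z. cleared (Suc n) z \<longrightarrow> F z = 0"
    show "\<forall>z. cleared n z \<longrightarrow> F z = 0"
    proof (intro allI impI)
      fix z assume z: "cleared n z"
      show "F z = 0"
      proof (cases "\<exists>i j. s i j = n")
        case False
        then have "cleared (Suc n) z" using z by (auto simp: cleared_def less_Suc_eq)
        then show ?thesis using IH by blast
      next
        case True
        then obtain i j where ij: "s i j = n" by blast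
        have pivot: "F z = 0" if z: "cleared n z" and nz: "z (i, j, n) \<noteq> 0" for z
        proof -
          define d where "d k = (if k \<le> n then 0 else - (z (i, j, k) / z (i, j, n)))" for k
          define z' where "z' = (\<lambda>(i, j, k). z (i, j, k) + d k * z (i, j, n))"
          have "cleared (Suc n) z'"
            unfolding cleared_def
          proof (intro allI impI)
            fix i' j' k assume "s i' j' < Suc n" and k: "s i' j' < k"
            then consider "s i' j' < n" | "s i' j' = n" by linarith
            then show "z' (i', j', k) = 0"
            proof cases
              case 1
              then have "z (i', j', k) = 0" "z (i', j', n) = 0" using z k by (simp_all add: cleared_def)
              then show ?thesis by (simp add: z'_def)
            next
              case 2
              then have "i' = i" "j' = j" using s_inj[of i' j' i j] ij by auto
              then show ?thesis using k 2 nz by (simp add: z'_def d_def)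
            qed
          qed
          then have "F z' = 0" using IH by blast
          moreover have "F z' = F z" unfolding z'_def by (rule inv) (simp add: d_def)
          ultimately show ?thesis by simp
        qed
        show ?thesis
        proof (cases "z (i, j, n) = 0")
          case False
          then show ?thesis using pivot z by blast
        next
          case zn: True
          show ?thesis
          proof (rule poly_on_lines_eq_0_at[OF poly])
            fix t :: complex assume "t \<noteq> 0"
            then show "F (\<lambda>c. z c + t * of_bool (c = (i, j, n))) = 0"
              using z zn ij by (intro pivot) (auto simp: cleared_def)
          qed
        qed
      qed
    qed
  qed simp
  then show ?thesis by (simp add: cleared_def)
qed

section \<open>Tables on the lower triangle\<close>

text \<open>A multiset of index triples stands for a three-dimensional table of natural numbers, namely the
exponents of a monomial.\<close>
definition mset_monomial :: "(nat \<times> nat \<times> nat) multiset \<Rightarrow> (nat \<times> nat \<times> nat \<Rightarrow> complex) \<Rightarrow> complex" where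
  "mset_monomial N z = (\<Prod>c\<in>#N. z c)"

definition triangular_tables :: "(nat \<Rightarrow> nat \<Rightarrow> nat) \<Rightarrow> (nat \<Rightarrow> nat) \<Rightarrow> (nat \<Rightarrow> nat) \<Rightarrow> (nat \<Rightarrow> nat) \<Rightarrow>
    (nat \<times> nat \<times> nat) multiset set" where
  "triangular_tables s S T U = {N.
     (\<forall>i. size {#c\<in>#N. fst c = i#} = S i) \<and>
     (\<forall>j. size {#c\<in>#N. fst (snd c) = j#} = T j) \<and>
     (\<forall>k. size {#c\<in>#N. snd (snd c) = k#} = U k) \<and>
     (\<forall>(i, j, k)\<in>#N. k \<le> s i j)}"

lemma span_hw_polys_column_op:
  assumes fin: "finite X" and U: "\<And>i j. i \<le> j \<Longrightarrow> U j \<le> U i"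
    and F: "F \<in> cfun.span (hw_polys X S T U)" and d: "\<And>k. k \<le> n \<Longrightarrow> d k = 0"
  shows "F (\<lambda>(i, j, k). z (i, j, k) + d k * z (i, j, n)) = F z"
  using F
proof (induction rule: cfun.span_induct_alt)
  case base
  show ?case by simp
next
  case (step c x y)
  then obtain f g h where x: "x = hw_poly X f g h" and "bij_betw h X (diagram U)"
    unfolding hw_polys_def by blast
  then have "filling U X h" using filling_of_diagram[of U h X] U by blast
  then have "hw_poly X f g h (\<lambda>(i, j, k). z (i, j, k) + d k * z (i, j, n)) = hw_poly X f g h z"
    using fin d by (intro hw_poly_column_op)
  then show ?case using step.IH by (simp add: x)
qed

lemma span_hw_polys_local:
  assumes U: "\<And>k. R \<le> k \<Longrightarrow> U k = 0"
    and F: "F \<in> cfun.span (hw_polys X S T U)"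
    and z: "\<And>i j k. k < R \<Longrightarrow> z (i, j, k) = z' (i, j, k)"
  shows "F z = F z'"
  using F
proof (induction rule: cfun.span_induct_alt)
  case base
  show ?case by simp
next
  case (step c x y)
  then obtain f g h where x: "x = hw_poly X f g h" and h: "bij_betw h X (diagram U)"
    unfolding hw_polys_def by blast
  have row: "fst (h (r x)) < R" if "x \<in> X" "r \<in> col_perms X h" for r x
  proof -
    have "r x \<in> X" using permutes_in_image[OF col_perms_permutes[OF that(2)]] that(1) by blast
    then have "h (r x) \<in> diagram U" using bij_betwE[OF h] by blast
    then have "snd (h (r x)) < U (fst (h (r x)))" by (auto simp: diagram_def)
    then show ?thesis using U by (metis not_less not_less0)
  qed
  have "hw_poly X f g h z = hw_poly X f g h z'"
    unfolding hw_poly_def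
    by (intro sum.cong refl arg_cong2[where f = "(*)"] prod.cong) (simp add: z row)
  then show ?case using step.IH by (simp add: x)
qed

lemma card_row_comp_perm:
  assumes "p permutes X"
  shows "card {x\<in>X. F (p x) = i} = card {x\<in>X. F x = i}"
proof -
  have "p ` {x\<in>X. F (p x) = i} = {x\<in>X. F x = i}"
  proof
    show "{x\<in>X. F x = i} \<subseteq> p ` {x\<in>X. F (p x) = i}"
    proof
      fix x assume x: "x \<in> {x\<in>X. F x = i}"
      then have "inv p x \<in> {x\<in>X. F (p x) = i}"
        using permutes_in_image[OF permutes_inv[OF assms]] permutes_inverses[OF assms] by auto
      then show "x \<in> p ` {x\<in>X. F (p x) = i}"
        using permutes_inverses(1)[OF assms, of x] by (metis imageI)
    qed
  qed (use permutes_in_image[OF assms] in auto)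
  then show ?thesis using card_image[OF permutes_inj_on[OF assms]] by metis
qed

text \<open>Each term of the polynomial is a monomial whose table has the shapes as marginals, because
column permutations do not change how often a row number occurs. On triangular arrays only the
terms whose table lies on the lower triangle survive.\<close>
lemma hw_poly_triangular_in_span:
  assumes fin: "finite X" and f: "filling S X f" and g: "filling T X g" and h: "filling U X h"
  shows "(\<lambda>z. hw_poly X f g h (triangular_part s z)) \<in> cfun.span (mset_monomial ` triangular_tables s S T U)"
    (is "_ \<in> cfun.span ?M")
proof -
  have "(\<lambda>z. \<Prod>x\<in>X. triangular_part s z (fst (f (p x)), fst (g (q x)), fst (h (r x)))) \<in> cfun.span ?M"
    if pqr: "p \<in> col_perms X f" "q \<in> col_perms X g" "r \<in> col_perms X h" for p q r
  proof -
    define c where "c x = (fst (f (p x)), fst (g (q x)), fst (h (r x)))" for x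
    show ?thesis
    proof (cases "\<forall>x\<in>X. fst (h (r x)) \<le> s (fst (f (p x))) (fst (g (q x)))")
      case True
      define N where "N = image_mset c (mset_set X)"
      have size: "size {#d\<in>#N. \<phi> d = i#} = card {x\<in>X. \<phi> (c x) = i}" for \<phi> :: "_ \<Rightarrow> nat" and i
        by (simp add: N_def filter_mset_image_mset filter_mset_mset_set[OF fin])
      have N: "N \<in> triangular_tables s S T U"
        unfolding triangular_tables_def mem_Collect_eq size
        using card_row_comp_perm[OF col_perms_permutes[OF pqr(1)], of "\<lambda>x. fst (f x)"]
          card_row_comp_perm[OF col_perms_permutes[OF pqr(2)], of "\<lambda>x. fst (g x)"]
          card_row_comp_perm[OF col_perms_permutes[OF pqr(3)], of "\<lambda>x. fst (h x)"]
          f g h True fin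
        by (auto simp: filling_def c_def N_def)
      have "(\<lambda>z. \<Prod>x\<in>X. triangular_part s z (c x)) = mset_monomial N"
      proof
        fix z
        have "(\<Prod>x\<in>X. triangular_part s z (c x)) = (\<Prod>x\<in>X. z (c x))"
          using True by (intro prod.cong) (auto simp: triangular_part_def c_def)
        then show "(\<Prod>x\<in>X. triangular_part s z (c x)) = mset_monomial N z"
          by (simp add: mset_monomial_def N_def prod_unfold_prod_mset image_mset.compositionality comp_def)
      qed
      then show ?thesis
        unfolding c_def by (rule ssubst) (intro cfun.span_base imageI N)
    next
      case False
      then have "(\<Prod>x\<in>X. triangular_part s z (c x)) = 0" for z
        using fin by (intro prod_zero) (auto simp: triangular_part_def c_def not_le)
      then have "(\<lambda>z. \<Prod>x\<in>X. triangular_part s z (c x)) = 0" by (simp add: fun_eq_iff)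
      then show ?thesis unfolding c_def by (rule ssubst) (rule cfun.span_zero)
    qed
  qed
  then show ?thesis unfolding hw_poly_def by (intro fun_span_sum)
qed

lemma dim_hw_polys_le_card_triangular_tables:
  assumes fin: "finite X" and finite_tables: "finite (triangular_tables s S T U)"
    and part: "\<And>i j. i \<le> j \<Longrightarrow> S j \<le> S i" "\<And>i j. i \<le> j \<Longrightarrow> T j \<le> T i" "\<And>i j. i \<le> j \<Longrightarrow> U j \<le> U i"
    and R: "\<And>k. R \<le> k \<Longrightarrow> U k = 0"
    and s_inj: "\<And>i j i' j'. s i j = s i' j' \<Longrightarrow> i = i' \<and> j = j'"
  shows "cfun.dim (hw_polys X S T U) \<le> card (triangular_tables s S T U)"
proof -
  let ?M = "mset_monomial ` triangular_tables s S T U"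
  have "cfun.dim (hw_polys X S T U) \<le> cfun.dim ?M"
  proof (rule dim_le_dim_of_injective[of "\<lambda>F z. F (triangular_part s z)"])
    fix F assume F: "F \<in> cfun.span (hw_polys X S T U)" and zero: "(\<lambda>z. F (triangular_part s z)) = 0"
    have "F z = 0" for z
    proof (rule eq_0_if_eq_0_on_triangular[of F R s])
      show "poly_on_lines F" using F by (rule poly_on_lines_span_hw_polys)
      show "F (\<lambda>(i, j, k). z (i, j, k) + d k * z (i, j, n)) = F z" if "\<And>k. k \<le> n \<Longrightarrow> d k = 0" for z n d
        by (rule span_hw_polys_column_op[OF fin part(3) F that])
      show "F z = F z'" if "\<And>i j k. k < R \<Longrightarrow> z (i, j, k) = z' (i, j, k)" for z z'
        using R F that by (rule span_hw_polys_local)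
      show "F (triangular_part s z) = 0" for z using fun_cong[OF zero, of z] by simp
    qed (rule s_inj)
    then show "F = 0" by (simp add: fun_eq_iff)
  next
    show "finite ?M" using finite_tables by simp
    show "(\<lambda>F z. F (triangular_part s z)) ` hw_polys X S T U \<subseteq> cfun.span ?M"
    proof
      fix G assume "G \<in> (\<lambda>F z. F (triangular_part s z)) ` hw_polys X S T U"
      then obtain f g h where G: "G = (\<lambda>z. hw_poly X f g h (triangular_part s z))"
        and b: "bij_betw f X (diagram S)" "bij_betw g X (diagram T)" "bij_betw h X (diagram U)"
        unfolding hw_polys_def by blast
      show "G \<in> cfun.span ?M"
        unfolding G
        by (intro hw_poly_triangular_in_span[OF fin] filling_of_diagram part b)
    qed
  qed (auto simp: fun_eq_iff)
  also have "\<dots> \<le> card ?M"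
    using finite_tables by (intro cfun.dim_le_card[OF cfun.span_superset]) simp
  also have "\<dots> \<le> card (triangular_tables s S T U)" using finite_tables by (rule card_image_le)
  finally show ?thesis .
qed

lemma sum_mset_by_label:
  fixes x :: "nat \<Rightarrow> nat"
  assumes "\<And>c. c \<in># N \<Longrightarrow> \<phi> c < P"
  shows "(\<Sum>c\<in>#N. x (\<phi> c)) = (\<Sum>i<P. x i * size {#c\<in>#N. \<phi> c = i#})"
  using assms
proof (induction N)
  case (add c N)
  have "(\<Sum>i<P. x i * size {#d\<in>#add_mset c N. \<phi> d = i#})
      = (\<Sum>i<P. x i * size {#d\<in>#N. \<phi> d = i#} + (if \<phi> c = i then x i else 0))"
    by (intro sum.cong) auto
  also have "\<dots> = (\<Sum>i<P. x i * size {#d\<in>#N. \<phi> d = i#}) + x (\<phi> c)"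
    using add.prems by (simp add: sum.distrib)
  finally show ?case using add by simp
qed simp

lemma count_le_size_filter: "P c \<Longrightarrow> count N c \<le> size {#d\<in>#N. P d#}"
  using count_le_size[of "{#d\<in>#N. P d#}" c] by simp

text \<open>For each \<open>k\<close> at most one entry of the slice \<open>k\<close> lies on the diagonal,
and the size of the slice is given.\<close>
lemma triangular_tables_eqI:
  assumes N: "N \<in> triangular_tables s S T U" and N': "N' \<in> triangular_tables s S T U"
    and s_inj: "\<And>i j i' j'. s i j = s i' j' \<Longrightarrow> i = i' \<and> j = j'"
    and off: "\<And>i j k. s i j \<noteq> k \<Longrightarrow> count N (i, j, k) = count N' (i, j, k)"
  shows "N = N'"
proof (rule multiset_eqI)
  fix c :: "nat \<times> nat \<times> nat"
  obtain i j k where c: "c = (i, j, k)" by (cases c)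
  show "count N c = count N' c"
  proof (cases "s i j = k")
    case False
    then show ?thesis using off c by simp
  next
    case True
    have split: "size {#d\<in>#M. snd (snd d) = k#} = count M c + size {#d\<in>#M. snd (snd d) = k \<and> d \<noteq> c#}" for M
    proof -
      have "{#d\<in>#M. snd (snd d) = k#} = {#d\<in>#M. d = c#} + {#d\<in>#M. snd (snd d) = k \<and> d \<noteq> c#}"
        by (rule multiset_eqI) (auto simp: c)
      then show ?thesis by (simp add: filter_eq_replicate_mset)
    qed
    have "{#d\<in>#N. snd (snd d) = k \<and> d \<noteq> c#} = {#d\<in>#N'. snd (snd d) = k \<and> d \<noteq> c#}"
    proof (rule multiset_eqI)
      fix d :: "nat \<times> nat \<times> nat"
      obtain i' j' k' where d: "d = (i', j', k')" by (cases d)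
      show "count {#d\<in>#N. snd (snd d) = k \<and> d \<noteq> c#} d = count {#d\<in>#N'. snd (snd d) = k \<and> d \<noteq> c#} d"
      proof (cases "k' = k \<and> d \<noteq> c")
        case True
        then have "s i' j' \<noteq> k'" using s_inj[of i' j' i j] \<open>s i j = k\<close> by (metis c d)
        then show ?thesis using off True d by simp
      next
        case False
        then show ?thesis by (auto simp: d)
      qed
    qed
    moreover have "size {#d\<in>#N. snd (snd d) = k#} = size {#d\<in>#N'. snd (snd d) = k#}"
      using N N' by (simp add: triangular_tables_def)
    ultimately show ?thesis using split[of N] split[of N'] by simp
  qed
qed

lemma card_triangular_tables_le:
  assumes s_inj: "\<And>i j i' j'. s i j = s i' j' \<Longrightarrow> i = i' \<and> j = j'"
    and box: "\<And>N c. N \<in> triangular_tables s S T U \<Longrightarrow> c \<in># N \<Longrightarrow> c \<in> B" and fin: "finite B"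
    and bound: "\<And>N i j k. N \<in> triangular_tables s S T U \<Longrightarrow> s i j \<noteq> k \<Longrightarrow> count N (i, j, k) \<le> C"
  shows "finite (triangular_tables s S T U)" "card (triangular_tables s S T U) \<le> Suc C ^ card B"
proof -
  let ?E = "triangular_tables s S T U"
  \<comment> \<open>The diagonal is overwritten by \<open>0\<close>; it can be recovered from the marginals.\<close>
  define code where "code N = (\<lambda>c\<in>B. if s (fst c) (fst (snd c)) \<noteq> snd (snd c) then count N c else 0)" for N
  have inj: "inj_on code ?E"
  proof (rule inj_onI)
    fix N N' assume N: "N \<in> ?E" "N' \<in> ?E" and eq: "code N = code N'"
    show "N = N'"
    proof (rule triangular_tables_eqI[OF N s_inj])
      fix i j k assume "s i j \<noteq> k"
      show "count N (i, j, k) = count N' (i, j, k)"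
      proof (cases "(i, j, k) \<in> B")
        case True
        then show ?thesis using fun_cong[OF eq, of "(i, j, k)"] \<open>s i j \<noteq> k\<close> by (simp add: code_def)
      next
        case False
        then have "(i, j, k) \<notin># N" "(i, j, k) \<notin># N'" using box N by blast+
        then show ?thesis by (simp add: not_in_iff)
      qed
    qed
  qed
  have img: "code ` ?E \<subseteq> B \<rightarrow>\<^sub>E {..C}"
    using bound by (auto simp: code_def)
  have finP: "finite (B \<rightarrow>\<^sub>E {..C})" using fin by (intro finite_PiE) auto
  show "finite ?E" using inj_on_finite[OF inj img finP] .
  have "card ?E \<le> card (B \<rightarrow>\<^sub>E {..C})" using card_inj_on_le[OF inj img finP] .
  also have "\<dots> = Suc C ^ card B" using fin by (simp add: card_PiE)
  finally show "card ?E \<le> Suc C ^ card B" .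
qed

section \<open>The bound for hooks\<close>

text \<open>The pairs in the order of decreasing entries of the matrix with corner \<open>c + 1\<close>,
ones in the rest of the first row and column, and zeros elsewhere: first the corner, then the
rest of the first column, then the rest of the first row, and finally all other pairs in an
arbitrary order.\<close>
definition hook_rank :: "nat \<Rightarrow> nat \<Rightarrow> nat \<Rightarrow> nat \<Rightarrow> nat" where
  "hook_rank a b i j =
     (if j = 0 \<and> i \<le> a then i else if i = 0 \<and> j \<le> b then a + j
      else a + b + 1 + prod_encode (i, j))"

lemma hook_rank_inj: "hook_rank a b i j = hook_rank a b i' j' \<Longrightarrow> i = i' \<and> j = j'"
  by (auto simp: hook_rank_def split: if_splits)

text \<open>Row lengths of the hook with arm row of length \<open>k\<close> and \<open>l\<close> further
rows.\<close>
definition hook :: "nat \<Rightarrow> nat \<Rightarrow> nat \<Rightarrow> nat" where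
  "hook k l i = (if i = 0 then k else if i \<le> l then 1 else 0)"

lemma hook_antimono: "0 < k \<Longrightarrow> i \<le> j \<Longrightarrow> hook k l j \<le> hook k l i"
  by (auto simp: hook_def)

lemma sum_mult_hook:
  fixes x :: "nat \<Rightarrow> nat"
  assumes "x 0 = 0" "l < P"
  shows "(\<Sum>i<P. x i * hook k l i) = (\<Sum>i\<in>{1..l}. x i)"
proof -
  have "(\<Sum>i<P. x i * hook k l i) = (\<Sum>i\<in>{1..l}. x i * hook k l i)"
    using assms by (intro sum.mono_neutral_right) (auto simp: hook_def)
  also have "\<dots> = (\<Sum>i\<in>{1..l}. x i)" by (intro sum.cong) (auto simp: hook_def)
  finally show ?thesis .
qed

lemma size_filter_pos:
  assumes "c \<in># N" "P c" shows "0 < size {#d\<in>#N. P d#}"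
proof -
  have "0 < count N c" using assms(1) by simp
  also have "count N c \<le> size {#d\<in>#N. P d#}" using assms(2) by (rule count_le_size_filter)
  finally show ?thesis .
qed

lemma triangular_tables_support:
  assumes "N \<in> triangular_tables r S T U" "(i, j, k) \<in># N"
  shows "S i \<noteq> 0" "T j \<noteq> 0" "U k \<noteq> 0"
proof -
  have "0 < size {#d\<in>#N. fst d = i#}" "0 < size {#d\<in>#N. fst (snd d) = j#}"
    "0 < size {#d\<in>#N. snd (snd d) = k#}"
    by (rule size_filter_pos[OF assms(2)], simp)+
  then show "S i \<noteq> 0" "T j \<noteq> 0" "U k \<noteq> 0" using assms(1) by (auto simp: triangular_tables_def)
qed

text \<open>Give the index \<open>i\<close> the cost \<open>x i\<close>, the index \<open>j\<close> the cost
\<open>y j\<close> and the index \<open>k\<close> the value \<open>v k\<close>, where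
\<open>v k\<close> is the cost of the pair of rank \<open>k\<close> if \<open>k < D\<close>.
Costs of pairs strictly increase with the rank below \<open>D\<close> and are at least
\<open>2 * D\<close> afterwards, so on the lower triangle the cost of \<open>(i, j)\<close> is
at least \<open>v k\<close>, and larger by at least one if \<open>k < D\<close> and the entry is
off the diagonal. The total cost and the total value are determined by the marginals, and their
parts proportional to \<open>n\<close> agree. Hence the number of off-diagonal triples with
\<open>k < D\<close> is bounded by the cost of \<open>s\<close> and \<open>t\<close>. For
\<open>k \<ge> D\<close> the marginal \<open>U k\<close> itself does not depend on
\<open>n\<close>.\<close>
lemma hook_table_count_le:
  fixes a b c n P :: nat and s t u :: "nat \<Rightarrow> nat"
  defines "S \<equiv> \<lambda>i. s i + n * hook (b + c + 1) a i"
    and "T \<equiv> \<lambda>i. t i + n * hook (a + c + 1) b i"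
    and "U \<equiv> \<lambda>i. u i + n * hook (c + 1) (a + b) i"
    and "D \<equiv> a + b + 1"
  assumes P: "a + b < P" "\<And>i. P \<le> i \<Longrightarrow> s i = 0" "\<And>i. P \<le> i \<Longrightarrow> t i = 0" "\<And>i. P \<le> i \<Longrightarrow> u i = 0"
    and N: "N \<in> triangular_tables (hook_rank a b) S T U"
    and off: "hook_rank a b i j \<noteq> k"
  shows "count N (i, j, k) \<le> 2 * D * ((\<Sum>i<P. s i) + (\<Sum>i<P. t i)) + (\<Sum>i<P. u i)"
proof -
  define x where "x i = (if i = 0 then 0 else if i \<le> a then D + i else 2 * D)" for i
  define y where "y j = (if j = 0 then 0 else if j \<le> b then D + a + j else 2 * D)" for j
  define v where "v k = (if k = 0 then 0 else if k < D then D + k else 0)" for k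
  have in_range: "i < P" "j < P" "k < P" if "(i, j, k) \<in># N" for i j k
  proof -
    have "S i = 0" "T i = 0" "U i = 0" if "P \<le> i" for i
      using P that by (auto simp: S_def T_def U_def hook_def)
    then show "i < P" "j < P" "k < P"
      using triangular_tables_support[OF N that] by (metis not_less)+
  qed
  show ?thesis
  proof (cases "k < D")
    case False
    have "count N (i, j, k) \<le> U k"
      using count_le_size_filter[of "\<lambda>d. snd (snd d) = k" "(i, j, k)" N] N
      by (simp add: triangular_tables_def)
    also have "U k = u k" using False by (simp add: U_def hook_def D_def)
    also have "u k \<le> (\<Sum>i<P. u i)"
    proof (cases "k < P")
      case True
      then show ?thesis by (intro member_le_sum) auto
    qed (use P in auto)
    finally show ?thesis by simp
  next
    case True
    define off where "off c = (snd (snd c) < D \<and> hook_rank a b (fst c) (fst (snd c)) \<noteq> snd (snd c))"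
      for c :: "nat \<times> nat \<times> nat"
    have cost: "v (snd (snd c)) + of_bool (off c) \<le> x (fst c) + y (fst (snd c))" if "c \<in># N" for c
    proof -
      obtain i j k where c: "c = (i, j, k)" by (cases c)
      have k: "k \<le> hook_rank a b i j" using N that c by (auto simp: triangular_tables_def)
      have "v k + of_bool (off c) \<le> v (hook_rank a b i j)" if "hook_rank a b i j < D"
        using k that by (auto simp: v_def off_def c)
      moreover have "v (hook_rank a b i j) = x i + y j" if "hook_rank a b i j < D"
        using that by (auto simp: v_def x_def y_def hook_rank_def D_def)
      moreover have "2 * D \<le> x i + y j" if "\<not> hook_rank a b i j < D"
        using that by (auto simp: x_def y_def hook_rank_def D_def split: if_splits)
      moreover have "v k + of_bool (off c) \<le> 2 * D" by (auto simp: v_def off_def c)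
      ultimately show ?thesis by (cases "hook_rank a b i j < D") (auto simp: c)
    qed
    have "(\<Sum>c\<in>#N. v (snd (snd c))) + (\<Sum>c\<in>#N. of_bool (off c))
        \<le> (\<Sum>c\<in>#N. x (fst c)) + (\<Sum>c\<in>#N. y (fst (snd c)))"
      unfolding sum_mset.distrib[symmetric] using cost by (intro sum_mset_mono)
    also have "(\<Sum>c\<in>#N. x (fst c)) = (\<Sum>i<P. x i * S i)"
      using sum_mset_by_label[of N fst P x] in_range N by (force simp: triangular_tables_def)
    also have "(\<Sum>c\<in>#N. y (fst (snd c))) = (\<Sum>i<P. y i * T i)"
      using sum_mset_by_label[of N "\<lambda>c. fst (snd c)" P y] in_range N by (force simp: triangular_tables_def)
    also have "(\<Sum>c\<in>#N. v (snd (snd c))) = (\<Sum>i<P. v i * U i)"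
      using sum_mset_by_label[of N "\<lambda>c. snd (snd c)" P v] in_range N by (force simp: triangular_tables_def)
    finally have ineq: "(\<Sum>i<P. v i * U i) + (\<Sum>c\<in>#N. of_bool (off c)) \<le> (\<Sum>i<P. x i * S i) + (\<Sum>i<P. y i * T i)" .
    have split: "(\<Sum>i<P. w i * (r i + n * h i)) = (\<Sum>i<P. w i * r i) + n * (\<Sum>i<P. w i * h i)"
      for w r h :: "nat \<Rightarrow> nat"
      by (simp add: algebra_simps sum.distrib sum_distrib_left)
    \<comment> \<open>The costs and the values of the hooks themselves agree, which cancels the multiples of
      \<open>n\<close>.\<close>
    have "(\<Sum>i\<in>{1..a}. x i) + (\<Sum>j\<in>{1..b}. y j) = (\<Sum>k\<in>{1..a+b}. v k)"
    proof -
      have "(\<Sum>k\<in>{1..a+b}. v k) = (\<Sum>k\<in>{1..a}. v k) + (\<Sum>k\<in>{a+1..a+b}. v k)"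
        by (subst sum.ub_add_nat) auto
      also have "(\<Sum>k\<in>{a+1..a+b}. v k) = (\<Sum>j\<in>{1..b}. v (a + j))"
        by (rule sum.reindex_bij_witness[of _ "\<lambda>j. a + j" "\<lambda>k. k - a"]) auto
      also have "\<dots> = (\<Sum>j\<in>{1..b}. y j)"
        by (intro sum.cong) (auto simp: v_def y_def D_def)
      also have "(\<Sum>k\<in>{1..a}. v k) = (\<Sum>k\<in>{1..a}. x k)"
        by (intro sum.cong) (auto simp: v_def x_def D_def)
      finally show ?thesis ..
    qed
    then have "(\<Sum>i<P. x i * hook (b + c + 1) a i) + (\<Sum>i<P. y i * hook (a + c + 1) b i)
        = (\<Sum>i<P. v i * hook (c + 1) (a + b) i)"
      using P(1) by (subst (1 2 3) sum_mult_hook) (auto simp: x_def y_def v_def)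
    then have "n * (\<Sum>i<P. x i * hook (b + c + 1) a i) + n * (\<Sum>i<P. y i * hook (a + c + 1) b i)
        = n * (\<Sum>i<P. v i * hook (c + 1) (a + b) i)"
      by (simp add: distrib_left[symmetric])
    then have "(\<Sum>c\<in>#N. of_bool (off c)) \<le> (\<Sum>i<P. x i * s i) + (\<Sum>i<P. y i * t i)"
      using ineq unfolding S_def T_def U_def split by linarith
    also have "\<dots> \<le> (\<Sum>i<P. 2 * D * s i) + (\<Sum>i<P. 2 * D * t i)"
      by (intro add_mono sum_mono mult_right_mono) (auto simp: x_def y_def D_def)
    also have "\<dots> = 2 * D * ((\<Sum>i<P. s i) + (\<Sum>i<P. t i))"
      by (simp add: sum_distrib_left distrib_left)
    finally have "(\<Sum>c\<in>#N. of_bool (off c)) \<le> 2 * D * ((\<Sum>i<P. s i) + (\<Sum>i<P. t i))" .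
    moreover have "count N (i, j, k) \<le> (\<Sum>c\<in>#N. of_bool (off c))"
    proof -
      have "(\<Sum>c\<in>#N. of_bool (off c)) = size {#c\<in>#N. off c#}"
        by (induction N) auto
      then show ?thesis
        using count_le_size_filter[of off "(i, j, k)" N] True \<open>hook_rank a b i j \<noteq> k\<close>
        by (simp add: off_def)
    qed
    ultimately show ?thesis by linarith
  qed
qed

lemma dim_hw_polys_hook_bounded:
  fixes a b c P :: nat and s t u :: "nat \<Rightarrow> nat"
  assumes P: "a + b < P" "\<And>i. P \<le> i \<Longrightarrow> s i = 0" "\<And>i. P \<le> i \<Longrightarrow> t i = 0" "\<And>i. P \<le> i \<Longrightarrow> u i = 0"
    and part: "\<And>i j. i \<le> j \<Longrightarrow> s j \<le> s i" "\<And>i j. i \<le> j \<Longrightarrow> t j \<le> t i" "\<And>i j. i \<le> j \<Longrightarrow> u j \<le> u i"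
  shows "\<exists>C. \<forall>n X. finite X \<longrightarrow> cfun.dim (hw_polys X (\<lambda>i. s i + n * hook (b + c + 1) a i)
    (\<lambda>i. t i + n * hook (a + c + 1) b i) (\<lambda>i. u i + n * hook (c + 1) (a + b) i)) \<le> C"
proof (intro exI allI impI)
  fix n and X :: "nat set" assume fin: "finite X"
  let ?S = "\<lambda>i. s i + n * hook (b + c + 1) a i"
    and ?T = "\<lambda>i. t i + n * hook (a + c + 1) b i"
    and ?U = "\<lambda>i. u i + n * hook (c + 1) (a + b) i"
  let ?B = "{..<P} \<times> {..<P} \<times> {..<P}"
  let ?C = "2 * (a + b + 1) * ((\<Sum>i<P. s i) + (\<Sum>i<P. t i)) + (\<Sum>i<P. u i)"
  have zero: "?S i = 0" "?T i = 0" "?U i = 0" if "P \<le> i" for i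
    using P that by (auto simp: hook_def)
  have box: "d \<in> ?B" if N: "N \<in> triangular_tables (hook_rank a b) ?S ?T ?U" and d: "d \<in># N" for N d
  proof -
    obtain i j k where ijk: "d = (i, j, k)" by (cases d)
    have "i < P" "j < P" "k < P"
      using triangular_tables_support[OF N d[unfolded ijk]] zero by (metis not_less)+
    then show ?thesis by (simp add: ijk)
  qed
  have bound: "count N (i, j, k) \<le> ?C"
    if "N \<in> triangular_tables (hook_rank a b) ?S ?T ?U" "hook_rank a b i j \<noteq> k" for N i j k
    by (rule hook_table_count_le[OF P that])
  note tables = card_triangular_tables_le[OF hook_rank_inj box _ bound]
  have "cfun.dim (hw_polys X ?S ?T ?U) \<le> card (triangular_tables (hook_rank a b) ?S ?T ?U)"
    by (rule dim_hw_polys_le_card_triangular_tables[OF fin tables(1) _ _ _ zero(3) hook_rank_inj])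
      (auto intro!: add_mono mult_left_mono part hook_antimono)
  also have "\<dots> \<le> Suc ?C ^ card ?B" by (rule tables(2)) auto
  finally show "cfun.dim (hw_polys X ?S ?T ?U) \<le> Suc ?C ^ card ?B" .
qed

section \<open>Stability\<close>

lemma row_len_simps [simp]:
  "row_len [] i = 0" "row_len (x # la) 0 = x" "row_len (x # la) (Suc i) = row_len la i"
  by (simp_all add: row_len_def)

lemma row_len_eq_0: "length la \<le> i \<Longrightarrow> row_len la i = 0"
  by (simp add: row_len_def)

lemma row_len_part_add: "row_len (la \<oplus>\<^sub>p \<mu>) i = row_len la i + row_len \<mu> i"
proof (induction la \<mu> arbitrary: i rule: part_add.induct)
  case (3 x la y \<mu>)
  then show ?case by (cases i) auto
qed auto

lemma row_len_part_mult: "row_len (n \<cdot>\<^sub>p la) i = n * row_len la i"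
  by (simp add: row_len_def part_mult_def)

lemma row_len_hook: "row_len (k # replicate l 1) i = hook k l i"
  by (cases i) (auto simp: row_len_def hook_def)

lemma sum_list_part_add: "sum_list (la \<oplus>\<^sub>p \<mu>) = sum_list la + sum_list \<mu>"
  by (induction la \<mu> rule: part_add.induct) auto

lemma sum_list_part_mult: "sum_list (n \<cdot>\<^sub>p la) = n * sum_list la"
  by (simp add: part_mult_def sum_list_const_mult)

lemma row_len_antimono:
  assumes "is_partition la" "i \<le> j" shows "row_len la j \<le> row_len la i"
  using assms sorted_wrt_nth_less[of "(\<ge>)" la i j]
  by (cases "i = j") (auto simp: row_len_def is_partition_def)

lemma bounded_increasing_nat_eventually_constant:
  fixes d :: "nat \<Rightarrow> nat"
  assumes "\<And>n. d n \<le> d (Suc n)" and "\<And>n. d n \<le> C"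
  shows "\<exists>L>0. \<forall>n\<ge>L. d n = d L"
proof -
  have mono: "d m \<le> d n" if "m \<le> n" for m n using that by (induction rule: dec_induct) (auto intro: order_trans assms(1))
  have fin: "finite (range d)" by (rule finite_subset[of _ "{..C}"]) (use assms(2) in auto)
  then have "Max (range d) \<in> range d" by (rule Max_in) simp
  then obtain m where m: "Max (range d) = d m" by blast
  have "d n = d (Suc m)" if "Suc m \<le> n" for n
    using mono[of m n] mono[of m "Suc m"] Max_ge[OF fin, of "d n"] Max_ge[OF fin, of "d (Suc m)"] that m
    by auto
  then show ?thesis by blast
qed

theorem corollary1p2:
  fixes a b c :: nat and la \<mu> \<nu> :: "nat list"
  assumes "is_partition la" and "is_partition \<mu>" and "is_partition \<nu>"
    and "sum_list la = sum_list \<mu>" and "sum_list \<mu> = sum_list \<nu>"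
  shows "\<exists>L>0. \<forall>n\<ge>L.
    kronecker (la \<oplus>\<^sub>p n \<cdot>\<^sub>p ((b + c + 1) # replicate a 1))
              (\<mu> \<oplus>\<^sub>p n \<cdot>\<^sub>p ((a + c + 1) # replicate b 1))
              (\<nu> \<oplus>\<^sub>p n \<cdot>\<^sub>p ((c + 1) # replicate (a + b) 1))
    = kronecker (la \<oplus>\<^sub>p L \<cdot>\<^sub>p ((b + c + 1) # replicate a 1))
                (\<mu> \<oplus>\<^sub>p L \<cdot>\<^sub>p ((a + c + 1) # replicate b 1))
                (\<nu> \<oplus>\<^sub>p L \<cdot>\<^sub>p ((c + 1) # replicate (a + b) 1))"
proof -
  define k where "k = a + b + c + 1"
  define m where "m n = sum_list la + n * k" for n
  define S where "S n i = row_len la i + n * hook (b + c + 1) a i" for n i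
  define T where "T n i = row_len \<mu> i + n * hook (a + c + 1) b i" for n i
  define U where "U n i = row_len \<nu> i + n * hook (c + 1) (a + b) i" for n i
  define d where "d n = cfun.dim (hw_polys {..<m n} (S n) (T n) (U n))" for n
  have kron: "kronecker (la \<oplus>\<^sub>p n \<cdot>\<^sub>p ((b + c + 1) # replicate a 1))
              (\<mu> \<oplus>\<^sub>p n \<cdot>\<^sub>p ((a + c + 1) # replicate b 1))
              (\<nu> \<oplus>\<^sub>p n \<cdot>\<^sub>p ((c + 1) # replicate (a + b) 1)) = of_nat (d n)" for n
  proof -
    have "row_len (la \<oplus>\<^sub>p n \<cdot>\<^sub>p ((b + c + 1) # replicate a 1)) = S n"
      "row_len (\<mu> \<oplus>\<^sub>p n \<cdot>\<^sub>p ((a + c + 1) # replicate b 1)) = T n"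
      "row_len (\<nu> \<oplus>\<^sub>p n \<cdot>\<^sub>p ((c + 1) # replicate (a + b) 1)) = U n"
      by (simp_all only: fun_eq_iff row_len_part_add row_len_part_mult row_len_hook S_def T_def U_def)
        simp_all
    moreover have "sum_list (la \<oplus>\<^sub>p n \<cdot>\<^sub>p ((b + c + 1) # replicate a 1)) = m n"
      "sum_list (\<mu> \<oplus>\<^sub>p n \<cdot>\<^sub>p ((a + c + 1) # replicate b 1)) = m n"
      "sum_list (\<nu> \<oplus>\<^sub>p n \<cdot>\<^sub>p ((c + 1) # replicate (a + b) 1)) = m n"
      using assms(4,5)
      by (simp_all add: sum_list_part_add sum_list_part_mult m_def k_def sum_list_replicate algebra_simps)
    ultimately show ?thesis unfolding d_def by (simp only: kronecker_eq_dim_hw_polys)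
  qed
  have part: "S n j \<le> S n i" "T n j \<le> T n i" "U n j \<le> U n i" if "i \<le> j" for n i j
    unfolding S_def T_def U_def using assms that
    by (auto intro!: add_mono mult_left_mono row_len_antimono hook_antimono)
  have "d n \<le> d (Suc n)" for n
  proof -
    \<comment> \<open>The hook triple is placed on the \<open>k\<close> points that are added in the step from
      \<open>n\<close> to \<open>Suc n\<close>.\<close>
    let ?Y = "{m n..<m n + k}"
    let ?f = "hook_filling (m n) {m n + 1..m n + a} (\<lambda>x. x - m n)"
      and ?g = "hook_filling (m n) {m n + a + 1..m n + a + b} (\<lambda>x. x - (m n + a))"
      and ?h = "hook_filling (m n) {m n + 1..m n + a + b} (\<lambda>x. x - m n)"
    have bij: "bij_betw (\<lambda>x. x - i) {i + 1..i + l} {1..l}" for i l :: nat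
      by (rule bij_betw_byWitness[of _ "\<lambda>x. x + i"]) auto
    have fill: "filling (hook (k - l) l) ?Y (hook_filling (m n) L r)"
      if "bij_betw r L {1..l}" "L \<subseteq> ?Y - {m n}" for L l r
    proof -
      have "filling (\<lambda>i. if i = 0 then card ?Y - l else if i \<le> l then 1 else 0) ?Y (hook_filling (m n) L r)"
        by (rule filling_hook_filling[OF _ _ _ that(2,1)]) (auto simp: k_def)
      then show ?thesis by (simp add: hook_def[abs_def] cong: if_cong)
    qed
    have sub: "{m n + 1..m n + a} \<subseteq> ?Y - {m n}" "{m n + a + 1..m n + a + b} \<subseteq> ?Y - {m n}"
      "{m n + 1..m n + (a + b)} \<subseteq> ?Y - {m n}"
      by (auto simp: k_def)
    have arm: "k - a = b + c + 1" "k - b = a + c + 1" "k - (a + b) = c + 1"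
      by (simp_all add: k_def)
    have fills: "filling (hook (b + c + 1) a) ?Y ?f" "filling (hook (a + c + 1) b) ?Y ?g"
      "filling (hook (c + 1) (a + b)) ?Y ?h"
      using fill[OF bij sub(1)] fill[OF bij sub(2)] fill[OF bij sub(3)]
      by (simp_all only: arm add.assoc[of "m n" a b])
    obtain z where z: "hw_poly ?Y ?f ?g ?h z \<noteq> 0"
      using hook_hw_poly_nonzero[of "m n" a b c] unfolding k_def by blast
    have "d n \<le> cfun.dim (hw_polys ({..<m n} \<union> ?Y) (\<lambda>i. S n i + hook (b + c + 1) a i)
        (\<lambda>i. T n i + hook (a + c + 1) b i) (\<lambda>i. U n i + hook (c + 1) (a + b) i))"
      unfolding d_def by (rule dim_hw_polys_mono[OF _ _ _ part fills z]) auto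
    also have "{..<m n} \<union> ?Y = {..<m (Suc n)}" by (auto simp: m_def)
    also have "(\<lambda>i. S n i + hook (b + c + 1) a i) = S (Suc n)" by (auto simp: S_def)
    also have "(\<lambda>i. T n i + hook (a + c + 1) b i) = T (Suc n)" by (auto simp: T_def)
    also have "(\<lambda>i. U n i + hook (c + 1) (a + b) i) = U (Suc n)" by (auto simp: U_def)
    finally show ?thesis by (simp add: d_def)
  qed
  moreover obtain C where "\<And>n. d n \<le> C"
  proof -
    define P where "P = length la + length \<mu> + length \<nu> + a + b + 1"
    have "\<exists>C. \<forall>n X. finite X \<longrightarrow> cfun.dim (hw_polys X (\<lambda>i. row_len la i + n * hook (b + c + 1) a i)
        (\<lambda>i. row_len \<mu> i + n * hook (a + c + 1) b i) (\<lambda>i. row_len \<nu> i + n * hook (c + 1) (a + b) i)) \<le> C"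
      by (rule dim_hw_polys_hook_bounded[where P = P])
        (simp_all add: P_def row_len_eq_0 row_len_antimono assms)
    then obtain C where C: "\<And>n X. finite X \<Longrightarrow> cfun.dim (hw_polys X (S n) (T n) (U n)) \<le> C"
      unfolding S_def[abs_def] T_def[abs_def] U_def[abs_def] by blast
    then show thesis using that[of C] unfolding d_def by blast
  qed
  ultimately obtain L where "L > 0" "\<forall>n\<ge>L. d n = d L"
    using bounded_increasing_nat_eventually_constant by blast
  then show ?thesis unfolding kron by auto
qed

end
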